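(* Fix $K\ge2$ and constants $C>0$, $c\in(0,1)$. For each $n$, let $A$ be generated from the $K$-community MMSBM with $\Omega=\Pi P\Pi'$ (where $(K,P,\Pi)$, with $P,\Pi$ depending on $n$, are parameters associated with the intrinsic number of communities of $\Omega$), and suppose $$\frac{\max_{k}h_k}{\min_{k}h_k}\le C,\qquad \|G^{-1}\|\le C,\qquad \alpha_0\le c,\qquad n\alpha_0\ge c^{-1}.$$ Let $\tau_n=n^2\alpha_0^{-2}\|P-\alpha_0\mathbf 1_K\mathbf 1_K'\|^4$ and suppose $\tau_n\ge C$. Then there exists a constant $c_2>0$ such that $$\mathbb E\Bigl[\tfrac{Q_n}{2\sqrt2\,n^2\hat\alpha_n^2}\Bigr]\ge c_2\tau_n-o\bigl(1+n^{-1/2}\tau_n^{3/4}\bigr),\qquad \mathrm{Var}\Bigl(\tfrac{Q_n}{2\sqrt2\,n^2\hat\alpha_n^2}\Bigr)=O\Bigl(1+n^{-1}\tau_n^{3/2}+n^{-2}\alpha_0^{-1}\tau_n^2\log(n)\Bigr).$$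
   Context: MMSBM: $\Pi=[\pi_1,\dots,\pi_n]'\in\mathbb R^{n\times K}$ where each $\pi_i\in\mathbb R^K$ is a weight vector (nonnegative entries summing to 1), $P\in\mathbb R^{K\times K}$ is symmetric with entries in $[0,1]$, $\Omega=\Pi P\Pi'$; $A$ is symmetric with zero diagonal and independent upper triangular entries $A_{ij}\sim$ Bernoulli$(\Omega_{ij})$, $i<j$. $\Pi$ is called eligible if each row is a weight vector and $I_K$ is a submatrix of $\Pi$; $P$ is eligible if it is entrywise nonnegative (entries in $[0,1]$). The intrinsic number of communities (INC) of $\Omega$ is the smallest $K$ such that $\Omega=\Pi P\Pi'$ for some eligible $\Pi\in\mathbb R^{n\times K}$, $P\in\mathbb R^{K\times K}$; parameters $(K,P,\Pi)$ are associated with INC if $K$ equals the INC and $\Pi,P$ are eligible. Notation: $h=\frac1n\sum_i\pi_i$, $G=\frac1n\sum_i\pi_i\pi_i'$, $\alpha_0=h'Ph$; $\mathbf 1_m$ is the all-ones vector in $\mathbb R^m$; $\|\cdot\|$ is the operator norm of a matrix. Asymptotics are as $n\to\infty$ with $K$ fixed. Statistic: $\hat\alpha_n=[n(n-1)]^{-1}\mathbf 1_n'A\mathbf 1_n$ (if $\hat\alpha_n=0$ or $1$, it is replaced by $\frac{2}{n(n-1)}$ or $\frac{n(n-1)-2}{n(n-1)}$ respectively), and $Q_n=\sum_{i_1,i_2,i_3,i_4\text{ distinct}}(A_{i_1i_2}-\hat\alpha_n)(A_{i_2i_3}-\hat\alpha_n)(A_{i_3i_4}-\hat\alpha_n)(A_{i_4i_1}-\hat\alpha_n)$,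 the sum being over ordered 4-tuples of distinct indices in $\{1,\dots,n\}$. *)

theory Defs
  imports
    "HOL-Probability.Probability"
    "HOL-Library.Landau_Symbols"
    "Jordan_Normal_Form.Matrix"
begin

hide_const (open) Finite_Cartesian_Product.vec Finite_Cartesian_Product.mat
  Finite_Cartesian_Product.row Finite_Cartesian_Product.transpose

text \<open>Since both the number of nodes and, in the definition of the intrinsic number of communities,
  the number of communities vary, matrices are those with explicit dimensions of
  \<^theory>\<open>Jordan_Normal_Form.Matrix\<close>. Nodes are numbered \<open>0, \<dots>, n - 1\<close> and
  communities \<open>0, \<dots>, K - 1\<close>.\<close>

definition l2_norm :: "real vec \<Rightarrow> real" where
  "l2_norm v = L2_set (\<lambda>i. v $ i) {..<dim_vec v}"

text \<open>As in \<^const>\<open>onorm\<close>, the zero vector contributes \<open>0 / 0 = 0\<close>.\<close>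

definition op_norm :: "real mat \<Rightarrow> real" where
  "op_norm B = (SUP v \<in> carrier_vec (dim_col B). l2_norm (B *\<^sub>v v) / l2_norm v)"

definition ones :: "nat \<Rightarrow> real vec" where
  "ones m = vec m (\<lambda>_. 1)"

definition ones_mat :: "nat \<Rightarrow> real mat" where
  "ones_mat m = mat m m (\<lambda>(i, j). ones m $ i * ones m $ j)"


definition weight_vector :: "real vec \<Rightarrow> bool" where
  "weight_vector v \<longleftrightarrow> (\<forall>k<dim_vec v. 0 \<le> v $ k) \<and> (\<Sum>k<dim_vec v. v $ k) = 1"

text \<open>That the identity is a submatrix is understood up to the order of the selected rows: for
  every community \<open>k\<close>, some row is the \<open>k\<close>-th standard basis vector. (The selection is then
  automatically injective.)\<close>

definition has_identity_submatrix :: "real mat \<Rightarrow> bool" where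
  "has_identity_submatrix PI \<longleftrightarrow>
     (\<forall>k<dim_col PI. \<exists>i<dim_row PI. row PI i = unit_vec (dim_col PI) k)"

definition eligible_Pi :: "nat \<Rightarrow> nat \<Rightarrow> real mat \<Rightarrow> bool" where
  "eligible_Pi n K PI \<longleftrightarrow> PI \<in> carrier_mat n K \<and> (\<forall>i<n. weight_vector (row PI i)) \<and>
     has_identity_submatrix PI"

definition eligible_P :: "nat \<Rightarrow> real mat \<Rightarrow> bool" where
  "eligible_P K P \<longleftrightarrow> P \<in> carrier_mat K K \<and> (\<forall>k<K. \<forall>l<K. P $$ (k, l) \<in> {0..1})"

definition Omega :: "real mat \<Rightarrow> real mat \<Rightarrow> real mat" where
  "Omega P PI = PI * P * transpose_mat PI"

definition INC :: "real mat \<Rightarrow> nat" where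
  "INC W = (LEAST K. \<exists>PI P. eligible_Pi (dim_row W) K PI \<and> eligible_P K P \<and> W = Omega P PI)"

definition associated_with_INC :: "nat \<Rightarrow> nat \<Rightarrow> real mat \<Rightarrow> real mat \<Rightarrow> bool" where
  "associated_with_INC n K P PI \<longleftrightarrow>
     eligible_Pi n K PI \<and> eligible_P K P \<and> K = INC (Omega P PI)"


text \<open>The law of an entry is compared on \<^const>\<open>borel\<close>, so entries lie in \<open>{0, 1}\<close> almost
  surely. Independence is only claimed above the diagonal.\<close>

definition mmsbm ::
  "nat \<Rightarrow> nat \<Rightarrow> real mat \<Rightarrow> real mat \<Rightarrow> 'a measure \<Rightarrow> ('a \<Rightarrow> real mat) \<Rightarrow> bool" where
  "mmsbm n K P PI M A \<longleftrightarrow>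
     PI \<in> carrier_mat n K \<and> (\<forall>i<n. weight_vector (row PI i)) \<and>
     P \<in> carrier_mat K K \<and> transpose_mat P = P \<and> (\<forall>k<K. \<forall>l<K. P $$ (k, l) \<in> {0..1}) \<and>
     prob_space M \<and>
     (\<forall>\<omega>\<in>space M. A \<omega> \<in> carrier_mat n n \<and> transpose_mat (A \<omega>) = A \<omega> \<and>
        (\<forall>i<n. A \<omega> $$ (i, i) = 0)) \<and>
     prob_space.indep_vars M (\<lambda>_. borel) (\<lambda>ij \<omega>. A \<omega> $$ ij) {(i, j). i < j \<and> j < n} \<and>
     (\<forall>i j. i < j \<and> j < n \<longrightarrow>
        distr M borel (\<lambda>\<omega>. A \<omega> $$ (i, j)) =
        distr (measure_pmf (bernoulli_pmf (Omega P PI $$ (i, j)))) borel of_bool)"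

definition h_vec :: "real mat \<Rightarrow> real vec" where
  "h_vec PI =
     vec (dim_col PI) (\<lambda>k. (1 / real (dim_row PI)) * (\<Sum>i<dim_row PI. row PI i $ k))"

definition G_mat :: "real mat \<Rightarrow> real mat" where
  "G_mat PI = mat (dim_col PI) (dim_col PI)
     (\<lambda>(k, l). (1 / real (dim_row PI)) * (\<Sum>i<dim_row PI. row PI i $ k * row PI i $ l))"

definition alpha0 :: "real mat \<Rightarrow> real mat \<Rightarrow> real" where
  "alpha0 P PI = h_vec PI \<bullet> (P *\<^sub>v h_vec PI)"

definition tau :: "nat \<Rightarrow> nat \<Rightarrow> real mat \<Rightarrow> real mat \<Rightarrow> real" where
  "tau n K P PI = (real n)\<^sup>2 * op_norm (P - alpha0 P PI \<cdot>\<^sub>m ones_mat K) ^ 4 / (alpha0 P PI)\<^sup>2"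


definition alpha_hat :: "nat \<Rightarrow> real mat \<Rightarrow> real" where
  "alpha_hat n A =
     (let N = real n * (real n - 1);
          a = (ones n \<bullet> (A *\<^sub>v ones n)) / N
      in if a = 0 then 2 / N else if a = 1 then (N - 2) / N else a)"

definition Q_stat :: "nat \<Rightarrow> real mat \<Rightarrow> real" where
  "Q_stat n A =
     (\<Sum>(i1, i2, i3, i4) \<in> {(i1, i2, i3, i4). {i1, i2, i3, i4} \<subseteq> {..<n} \<and> distinct [i1, i2, i3, i4]}.
        (A $$ (i1, i2) - alpha_hat n A) * (A $$ (i2, i3) - alpha_hat n A) *
        (A $$ (i3, i4) - alpha_hat n A) * (A $$ (i4, i1) - alpha_hat n A))"

definition test_stat :: "nat \<Rightarrow> real mat \<Rightarrow> real" where
  "test_stat n A = Q_stat n A / (2 * sqrt 2 * (real n)\<^sup>2 * (alpha_hat n A)\<^sup>2)"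

end

theory Submission
  imports Defs "HOL-Real_Asymp.Real_Asymp"
begin

text \<open>Let \<open>\<mu>\<close> be the average edge probability, \<open>W\<close> the centred noise of the adjacency matrix and \<open>\<rho>\<close> the
  deviation of the edge probabilities from \<open>\<mu>\<close>. Apart from its modified extreme values, the density estimate is
  \<open>\<mu> + \<Delta>\<close>, where \<open>\<Delta>\<close> is a normalised sum of the noise. Every factor of the cycle sum \<open>Q\<^sub>n\<close> is then
  \<open>W + \<rho> - \<Delta>\<close>, and multiplying out gives \<open>Q\<^sub>n = q + lin + rest\<close> (\<open>Q_decomposition\<close>): \<open>q\<close> is the
  pure signal, \<open>lin\<close> collects the terms without \<open>\<Delta>\<close> that contain noise and the term linear in \<open>\<Delta>\<close>
  alone, and everything in \<open>rest\<close> has a factor \<open>\<Delta>\<close> that is accompanied by noise or by another \<open>\<Delta>\<close>.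

  The signal is, up to lower order terms, the trace of the fourth power of the matrix \<open>\<Omega> - \<alpha>\<^sub>0 1 1'\<close>, which
  equals \<open>\<Pi> (P - \<alpha>\<^sub>0 1 1') \<Pi>'\<close>. Because the Gram matrix \<open>G\<close> is well conditioned, a test vector shows
  that this trace is at least a constant times \<open>n\<^sup>4\<close> times the fourth power of the norm of
  \<open>P - \<alpha>\<^sub>0 1 1'\<close> (\<open>frobenius_square_ge\<close>, \<open>q_ge\<close>). Divided by \<open>n\<^sup>2 \<alpha>\<^sub>0\<^sup>2\<close> this is of order
  \<open>\<tau>\<^sub>n\<close>.

  The part \<open>lin\<close> has mean zero, and its variance is computed by orthogonality: two products of noise variables
  are uncorrelated unless they use the same edges. Hence a second moment is a count of pairs of cycles that
  share the edges carrying the noise (\<open>second_moment_le_collisions\<close>, \<open>card_collisions_le\<close>). With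
  \<open>x\<close> of order \<open>sqrt \<tau>\<^sub>n / n\<close> the result is \<open>1 + n\<^sup>2 x\<^sup>3\<close> after normalisation; the term \<open>n\<^sup>2 x\<^sup>3\<close>, of order
  \<open>\<tau>\<^sub>n\<^sup>3\<^sup>/\<^sup>2 / n\<close>, comes from a single noisy edge.

  The part \<open>rest\<close> may be biased, but by Chernoff's bound \<open>\<Delta>\<^sup>2\<close> is below \<open>\<alpha>\<^sub>0 n\<^sup>-\<^sup>3\<^sup>/\<^sup>2\<close> except with a
  probability that is exponentially small in \<open>sqrt n\<close> (\<open>prob_not_G\<close>). On this good event each \<open>\<Delta>\<close> is replaced
  by its bound, and \<open>rest\<close> is smaller than the bound on the fluctuations of \<open>lin\<close> by a power of \<open>n\<close>. There
  the random denominator is also within a small relative error of \<open>\<mu>\<^sup>2\<close>; its fluctuation, multiplied by the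
  signal, is the source of the last term of the variance bound. Off the good event the statistic is at most
  polynomially large in \<open>n\<close>, so its contribution vanishes. This gives explicit bounds for each \<open>n\<close>
  (\<open>expectation_T_ge\<close>, \<open>variance_T_le\<close>), from which the asymptotic statement follows.\<close>

section \<open>Centred Bernoulli families\<close>

text \<open>The two-sided version of the elementary bound behind Bernstein-type exponential inequalities: it turns
  the moment generating function of a bounded centred variable into a bound by its variance.\<close>
lemma exp_le_quadratic:
  fixes y :: real
  assumes "\<bar>y\<bar> \<le> 1"
  shows "exp y \<le> 1 + y + y\<^sup>2"
proof (cases "y \<ge> 0")
  case True
  then show ?thesis using assms exp_bound[of y] by auto
next
  case False
  define z where "z = - y"
  have z: "0 \<le> z" "z \<le> 1" using False assms by (auto simp: z_def)
  have "1 \<le> 1 + z\<^sup>2 * (1 + z) / 2 + z^4 / 2"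
    using z by (simp add: add_nonneg_nonneg)
  also have "\<dots> = (1 - z + z\<^sup>2) * (1 + z + z\<^sup>2 / 2)"
    by (simp add: field_simps power2_eq_square eval_nat_numeral)
  also have "\<dots> \<le> (1 - z + z\<^sup>2) * exp z"
    using z exp_lower_Taylor_quadratic[of z] by (intro mult_left_mono) auto
  finally have "exp (- z) \<le> 1 - z + z\<^sup>2"
    by (simp add: exp_minus field_simps)
  then show ?thesis by (simp add: z_def)
qed

locale bernoulli_family = prob_space +
  fixes E :: "'e set" and X :: "'e \<Rightarrow> 'a \<Rightarrow> real" and p :: "'e \<Rightarrow> real"
  assumes finite_E [simp]: "finite E"
    and indep: "indep_vars (\<lambda>_. borel) X E"
    and X01: "e \<in> E \<Longrightarrow> \<omega> \<in> space M \<Longrightarrow> X e \<omega> \<in> {0, 1}"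
    and mean: "e \<in> E \<Longrightarrow> expectation (X e) = p e"
begin

definition W :: "'e \<Rightarrow> 'a \<Rightarrow> real" where
  "W e \<omega> = X e \<omega> - p e"

lemma X_measurable [measurable]: "e \<in> E \<Longrightarrow> X e \<in> borel_measurable M"
  using indep by (auto simp: indep_vars_def)

lemma W_measurable [measurable]: "e \<in> E \<Longrightarrow> W e \<in> borel_measurable M"
  unfolding W_def by measurable

lemma integrable_X: "e \<in> E \<Longrightarrow> integrable M (X e)"
  using X01 by (intro integrable_const_bound[where B = 1] AE_I2) (fastforce, measurable)

lemma p_range: assumes "e \<in> E" shows "0 \<le> p e" "p e \<le> 1"
proof -
  have "0 \<le> expectation (X e)"
    using X01[OF assms] by (intro integral_nonneg_AE AE_I2) fastforce
  then show "0 \<le> p e" using mean[OF assms] by simp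
  have "expectation (X e) \<le> expectation (\<lambda>_. 1)"
    using X01[OF assms] integrable_X[OF assms] by (intro integral_mono_AE AE_I2) fastforce+
  then show "p e \<le> 1" using mean[OF assms] by (simp add: prob_space)
qed

lemma W_bound: "e \<in> E \<Longrightarrow> \<omega> \<in> space M \<Longrightarrow> \<bar>W e \<omega>\<bar> \<le> 1"
  using X01[of e \<omega>] p_range[of e] by (auto simp: W_def)

lemma integrable_bounded:
  fixes f :: "'a \<Rightarrow> real"
  assumes "f \<in> borel_measurable M" and "\<And>\<omega>. \<omega> \<in> space M \<Longrightarrow> \<bar>f \<omega>\<bar> \<le> B"
  shows "integrable M f"
  using assms by (intro integrable_const_bound[where B = B] AE_I2) auto

lemma integrable_W: "e \<in> E \<Longrightarrow> integrable M (W e)"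
  using W_bound by (intro integrable_bounded[where B = 1]) auto

lemma expectation_W: "e \<in> E \<Longrightarrow> expectation (W e) = 0"
  using mean[of e] integrable_X[of e] by (simp add: W_def[abs_def] prob_space)

lemma expectation_W_square:
  assumes "e \<in> E"
  shows "expectation (\<lambda>\<omega>. (W e \<omega>)\<^sup>2) = p e * (1 - p e)"
proof -
  have "expectation (\<lambda>\<omega>. (W e \<omega>)\<^sup>2) = expectation (\<lambda>\<omega>. (1 - 2 * p e) * X e \<omega> + (p e)\<^sup>2)"
    using X01[OF assms]
    by (intro Bochner_Integration.integral_cong) (fastforce simp: W_def power2_eq_square algebra_simps)+
  also have "\<dots> = (1 - 2 * p e) * p e + (p e)\<^sup>2"
    using integrable_X[OF assms] mean[OF assms] by (simp add: prob_space)
  finally show ?thesis by (simp add: power2_eq_square algebra_simps)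
qed

lemma prod_W_measurable [measurable]: "F \<subseteq> E \<Longrightarrow> (\<lambda>\<omega>. \<Prod>e\<in>F. W e \<omega>) \<in> borel_measurable M"
  by (intro borel_measurable_prod) auto

lemma prod_W_bound: "F \<subseteq> E \<Longrightarrow> \<omega> \<in> space M \<Longrightarrow> \<bar>\<Prod>e\<in>F. W e \<omega>\<bar> \<le> 1"
  unfolding abs_prod by (intro prod_le_1) (use W_bound in auto)

lemma integrable_prod_W: "F \<subseteq> E \<Longrightarrow> integrable M (\<lambda>\<omega>. \<Prod>e\<in>F. W e \<omega>)"
  by (intro integrable_bounded[where B = 1]) (auto simp: prod_W_bound)

text \<open>By independence the expectation factorises over the edges, and an edge occurring in exactly one of
  the two products contributes the vanishing mean of its noise. So products of noise variables over
  distinct edge sets are orthogonal, which is what makes all second moments below countable.\<close>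
lemma expectation_prod_W_prod_W:
  assumes F: "F \<subseteq> E" and F': "F' \<subseteq> E"
  shows "expectation (\<lambda>\<omega>. (\<Prod>e\<in>F. W e \<omega>) * (\<Prod>e\<in>F'. W e \<omega>)) =
    (if F = F' then \<Prod>e\<in>F. p e * (1 - p e) else 0)"
proof -
  define g where "g e y = (if e \<in> F then y - p e else 1) * (if e \<in> F' then y - p e else 1)" for e y
  have fin: "finite F" "finite F'" using F F' finite_subset[OF _ finite_E] by auto
  have g_meas: "g e \<in> borel_measurable borel" for e
    unfolding g_def by measurable
  have ind: "indep_vars (\<lambda>_. borel) (\<lambda>e \<omega>. g e (X e \<omega>)) E"
    by (rule indep_vars_compose2[OF indep]) (use g_meas in auto)
  have bound: "\<bar>g e (X e \<omega>)\<bar> \<le> 1" if "e \<in> E" "\<omega> \<in> space M" for e \<omega>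
    using W_bound[OF that] by (auto simp: g_def W_def abs_mult abs_square_le_1 simp flip: power2_eq_square intro: mult_le_one)
  have int: "integrable M (\<lambda>\<omega>. g e (X e \<omega>))" if "e \<in> E" for e
    using bound that g_meas[of e]
    by (intro integrable_bounded[where B = 1] measurable_compose[OF X_measurable]) auto
  have split: "(\<Prod>e\<in>A. W e \<omega>) = (\<Prod>e\<in>E. if e \<in> A then W e \<omega> else 1)" if "A \<subseteq> E" for A \<omega>
    using that by (simp add: prod.If_cases Int_absorb1)
  have "expectation (\<lambda>\<omega>. (\<Prod>e\<in>F. W e \<omega>) * (\<Prod>e\<in>F'. W e \<omega>)) = expectation (\<lambda>\<omega>. \<Prod>e\<in>E. g e (X e \<omega>))"
    unfolding split[OF F] split[OF F'] prod.distrib[symmetric] by (simp add: g_def W_def cong: if_cong)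
  also have "\<dots> = (\<Prod>e\<in>E. expectation (\<lambda>\<omega>. g e (X e \<omega>)))"
    by (rule indep_vars_lebesgue_integral) (use ind int in auto)
  finally have *: "expectation (\<lambda>\<omega>. (\<Prod>e\<in>F. W e \<omega>) * (\<Prod>e\<in>F'. W e \<omega>)) = \<dots>" .
  show ?thesis
  proof (cases "F = F'")
    case True
    have "(\<Prod>e\<in>E. expectation (\<lambda>\<omega>. g e (X e \<omega>))) = (\<Prod>e\<in>E. if e \<in> F then p e * (1 - p e) else 1)"
    proof (rule prod.cong)
      fix e assume "e \<in> E"
      then show "expectation (\<lambda>\<omega>. g e (X e \<omega>)) = (if e \<in> F then p e * (1 - p e) else 1)"
        using expectation_W_square[of e] True
        by (auto simp: g_def W_def[abs_def] power2_eq_square prob_space)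
    qed simp
    also have "\<dots> = (\<Prod>e\<in>F. p e * (1 - p e))"
      using F by (simp add: prod.If_cases Int_absorb1)
    finally show ?thesis using True * by simp
  next
    case False
    then obtain e where e: "e \<in> F \<longleftrightarrow> e \<notin> F'" "e \<in> E" using F F' by blast
    then have "expectation (\<lambda>\<omega>. g e (X e \<omega>)) = 0"
      using expectation_W[of e] by (auto simp: g_def W_def[abs_def])
    then have "(\<Prod>e\<in>E. expectation (\<lambda>\<omega>. g e (X e \<omega>))) = 0"
      using e by (intro prod_zero) auto
    then show ?thesis using False * by simp
  qed
qed

lemma expectation_prod_W:
  assumes "F \<subseteq> E" "F \<noteq> {}"
  shows "expectation (\<lambda>\<omega>. \<Prod>e\<in>F. W e \<omega>) = 0"
  using expectation_prod_W_prod_W[of F "{}"] assms by simp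

text \<open>After orthogonality only pairs of indices with the same edge set survive in the square, each
  contributing at most a product of \<open>k\<close> variances; bounding a second moment is thereby reduced to
  counting collisions.\<close>
lemma second_moment_le_collisions:
  fixes g :: "'t \<Rightarrow> real"
  assumes T: "finite T" and \<phi>: "\<And>t. t \<in> T \<Longrightarrow> \<phi> t \<subseteq> E" "\<And>t. t \<in> T \<Longrightarrow> card (\<phi> t) = k"
    and g: "\<And>t. t \<in> T \<Longrightarrow> \<bar>g t\<bar> \<le> B" and v: "\<And>e. e \<in> E \<Longrightarrow> p e \<le> v"
  shows "expectation (\<lambda>\<omega>. (\<Sum>t\<in>T. g t * (\<Prod>e\<in>\<phi> t. W e \<omega>))\<^sup>2)
    \<le> B\<^sup>2 * v ^ k * real (\<Sum>t\<in>T. card {t' \<in> T. \<phi> t' = \<phi> t})"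
proof -
  let ?P = "\<lambda>t \<omega>. \<Prod>e\<in>\<phi> t. W e \<omega>"
  have int: "integrable M (\<lambda>\<omega>. ?P t \<omega> * ?P t' \<omega>)" if "t \<in> T" "t' \<in> T" for t t'
    using \<phi>(1) that prod_W_bound[of "\<phi> t"] prod_W_bound[of "\<phi> t'"]
    by (intro integrable_bounded[where B = 1]) (auto simp: abs_mult intro: mult_le_one)
  have "expectation (\<lambda>\<omega>. (\<Sum>t\<in>T. g t * ?P t \<omega>)\<^sup>2) =
      expectation (\<lambda>\<omega>. \<Sum>t\<in>T. \<Sum>t'\<in>T. (g t * g t') * (?P t \<omega> * ?P t' \<omega>))"
    by (simp add: power2_eq_square sum_product mult_ac)
  also have "\<dots> = (\<Sum>t\<in>T. \<Sum>t'\<in>T. (g t * g t') * expectation (\<lambda>\<omega>. ?P t \<omega> * ?P t' \<omega>))"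
    using int by (simp add: Bochner_Integration.integral_sum)
  also have "\<dots> \<le> (\<Sum>t\<in>T. \<Sum>t'\<in>T. if \<phi> t' = \<phi> t then B\<^sup>2 * v ^ k else 0)"
  proof (intro sum_mono)
    fix t t' assume t: "t \<in> T" "t' \<in> T"
    show "(g t * g t') * expectation (\<lambda>\<omega>. ?P t \<omega> * ?P t' \<omega>) \<le> (if \<phi> t' = \<phi> t then B\<^sup>2 * v ^ k else 0)"
    proof (cases "\<phi> t' = \<phi> t")
      case True
      have pe: "0 \<le> p e * (1 - p e) \<and> p e * (1 - p e) \<le> v" if "e \<in> \<phi> t" for e
      proof -
        have e: "e \<in> E" using that \<phi>(1) t by auto
        have "p e * (1 - p e) \<le> p e * 1" using p_range[OF e] by (intro mult_left_mono) auto
        then show ?thesis using p_range[OF e] v[OF e] by auto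
      qed
      have "(\<Prod>e\<in>\<phi> t. p e * (1 - p e)) \<le> (\<Prod>e\<in>\<phi> t. v)"
        by (rule prod_mono) (use pe in auto)
      then have 1: "(\<Prod>e\<in>\<phi> t. p e * (1 - p e)) \<le> v ^ k" using \<phi>(2) t by simp
      have 2: "0 \<le> (\<Prod>e\<in>\<phi> t. p e * (1 - p e))" by (rule prod_nonneg) (use pe in auto)
      have "g t * g t' \<le> \<bar>g t\<bar> * \<bar>g t'\<bar>" by (metis abs_mult abs_ge_self)
      also have "\<dots> \<le> B\<^sup>2" using g t unfolding power2_eq_square by (intro mult_mono) force+
      finally have 3: "g t * g t' \<le> B\<^sup>2" .
      have "(g t * g t') * (\<Prod>e\<in>\<phi> t. p e * (1 - p e)) \<le> B\<^sup>2 * v ^ k"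
        by (rule order_trans[OF mult_right_mono[OF 3 2] mult_left_mono[OF 1]]) simp
      then show ?thesis using True \<phi>(1) t by (simp add: expectation_prod_W_prod_W)
    next
      case False
      then have "\<phi> t \<noteq> \<phi> t'" by simp
      then show ?thesis using False \<phi>(1) t by (simp add: expectation_prod_W_prod_W)
    qed
  qed
  also have "\<dots> = (\<Sum>t\<in>T. B\<^sup>2 * v ^ k * real (card {t' \<in> T. \<phi> t' = \<phi> t}))"
    using T by (simp add: sum.If_cases Int_def mult_ac)
  finally show ?thesis by (simp add: sum_distrib_left)
qed

lemma expectation_exp_sum_W_le:
  assumes s: "\<bar>s\<bar> \<le> 1"
  shows "expectation (\<lambda>\<omega>. exp (s * (\<Sum>e\<in>E. W e \<omega>))) \<le> exp (s\<^sup>2 * (\<Sum>e\<in>E. p e))"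
proof -
  have bnd: "\<bar>s * W e \<omega>\<bar> \<le> 1" if "e \<in> E" "\<omega> \<in> space M" for e \<omega>
    using W_bound[OF that] s by (simp add: abs_mult mult_le_one)
  have ind: "indep_vars (\<lambda>_. borel) (\<lambda>e \<omega>. exp (s * (X e \<omega> - p e))) E"
    by (rule indep_vars_compose2[OF indep]) measurable
  have int: "integrable M (\<lambda>\<omega>. exp (s * W e \<omega>))" if "e \<in> E" for e
  proof (rule integrable_bounded[where B = "exp 1"])
    show "\<bar>exp (s * W e \<omega>)\<bar> \<le> exp 1" if "\<omega> \<in> space M" for \<omega>
      using bnd[OF \<open>e \<in> E\<close> that] by simp
  qed (use that in measurable)
  have single: "expectation (\<lambda>\<omega>. exp (s * W e \<omega>)) \<le> exp (s\<^sup>2 * p e)" if e: "e \<in> E" for e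
  proof -
    have intW: "integrable M (\<lambda>\<omega>. (W e \<omega>)\<^sup>2)"
      using W_bound[OF e] e by (intro integrable_bounded[where B = 1]) (auto simp: abs_square_le_1 power2_abs)
    have "expectation (\<lambda>\<omega>. exp (s * W e \<omega>)) \<le> expectation (\<lambda>\<omega>. 1 + s * W e \<omega> + s\<^sup>2 * (W e \<omega>)\<^sup>2)"
    proof (rule integral_mono)
      show "integrable M (\<lambda>\<omega>. exp (s * W e \<omega>))" using int e .
      show "integrable M (\<lambda>\<omega>. 1 + s * W e \<omega> + s\<^sup>2 * (W e \<omega>)\<^sup>2)"
        using integrable_W[OF e] intW by auto
      show "exp (s * W e \<omega>) \<le> 1 + s * W e \<omega> + s\<^sup>2 * (W e \<omega>)\<^sup>2" if "\<omega> \<in> space M" for \<omega>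
        using exp_le_quadratic[OF bnd[OF e that]] by (simp add: power_mult_distrib)
    qed
    also have "\<dots> = 1 + s\<^sup>2 * (p e * (1 - p e))"
      using integrable_W[OF e] intW expectation_W[OF e] expectation_W_square[OF e] by (simp add: prob_space)
    also have "\<dots> \<le> 1 + s\<^sup>2 * p e"
      using p_range[OF e] by (auto intro!: mult_left_mono simp: mult_left_le)
    also have "\<dots> \<le> exp (s\<^sup>2 * p e)" by (simp add: exp_ge_add_one_self)
    finally show ?thesis .
  qed
  have "expectation (\<lambda>\<omega>. exp (s * (\<Sum>e\<in>E. W e \<omega>))) = expectation (\<lambda>\<omega>. \<Prod>e\<in>E. exp (s * W e \<omega>))"
    by (simp add: sum_distrib_left exp_sum)
  also have "\<dots> = (\<Prod>e\<in>E. expectation (\<lambda>\<omega>. exp (s * W e \<omega>)))"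
    by (rule indep_vars_lebesgue_integral) (use ind int in \<open>auto simp: W_def\<close>)
  also have "\<dots> \<le> (\<Prod>e\<in>E. exp (s\<^sup>2 * p e))"
    by (rule prod_mono) (use single in \<open>auto intro: integral_nonneg_AE\<close>)
  finally show ?thesis by (simp add: exp_sum sum_distrib_left)
qed

text \<open>Chernoff's bound with the variance proxy \<open>V\<close>. Hoeffding's inequality would put the number of edges
  in place of \<open>V\<close> and is too weak for sparse graphs, where \<open>V\<close> may be only linear in the number
  of nodes.\<close>
lemma prob_sum_W_ge_le:
  assumes V: "V = (\<Sum>e\<in>E. p e)" "V > 0" and t: "0 < t" "t \<le> 2 * V"
  shows "prob {\<omega> \<in> space M. t \<le> \<bar>\<Sum>e\<in>E. W e \<omega>\<bar>} \<le> 2 * exp (- t\<^sup>2 / (4 * V))"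
proof -
  \<comment> \<open>The minimiser of the exponent \<open>s\<^sup>2 V - s t\<close>; the range of \<open>t\<close> makes it at most \<open>1\<close>.\<close>
  define s where "s = t / (2 * V)"
  have s: "0 < s" "s \<le> 1" using V t by (auto simp: s_def)
  have one: "prob {\<omega> \<in> space M. t \<le> \<sigma> * (\<Sum>e\<in>E. W e \<omega>)} \<le> exp (- t\<^sup>2 / (4 * V))" if \<sigma>: "\<bar>\<sigma>\<bar> = 1" for \<sigma>
  proof -
    let ?u = "\<lambda>\<omega>. exp ((s * \<sigma>) * (\<Sum>e\<in>E. W e \<omega>))"
    have sb: "\<bar>\<Sum>e\<in>E. W e \<omega>\<bar> \<le> card E" if "\<omega> \<in> space M" for \<omega>
      using sum_norm_le[of E "\<lambda>e. W e \<omega>" "\<lambda>_. 1"] W_bound that by auto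
    have ub: "\<bar>?u \<omega>\<bar> \<le> exp (card E)" if "\<omega> \<in> space M" for \<omega>
    proof -
      have "(s * \<sigma>) * (\<Sum>e\<in>E. W e \<omega>) \<le> \<bar>s * \<sigma>\<bar> * \<bar>\<Sum>e\<in>E. W e \<omega>\<bar>" by (metis abs_ge_self abs_mult)
      also have "\<dots> \<le> 1 * real (card E)" using s \<sigma> sb[OF that] by (intro mult_mono) (auto simp: abs_mult)
      finally show ?thesis by simp
    qed
    have int: "integrable M ?u"
      by (rule integrable_bounded[OF _ ub]) measurable
    have "prob {\<omega> \<in> space M. t \<le> \<sigma> * (\<Sum>e\<in>E. W e \<omega>)} \<le> prob {\<omega> \<in> space M. ?u \<omega> \<ge> exp (s * t)}"
      using s by (intro finite_measure_mono) (auto simp: mult.assoc)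
    also have "\<dots> \<le> expectation ?u / exp (s * t)"
      by (rule integral_Markov_inequality_measure[where A = "{}"]) (use int in auto)
    also have "\<dots> \<le> exp ((s * \<sigma>)\<^sup>2 * V) / exp (s * t)"
      using expectation_exp_sum_W_le[of "s * \<sigma>"] s \<sigma> V by (intro divide_right_mono) (auto simp: abs_mult)
    also have "\<dots> = exp (s\<^sup>2 * V - s * t)"
      using \<sigma> by (simp add: exp_diff power_mult_distrib flip: power2_abs[of \<sigma>])
    also have "s\<^sup>2 * V - s * t = - t\<^sup>2 / (4 * V)"
      using V by (simp add: s_def field_simps power2_eq_square)
    finally show ?thesis .
  qed
  have "prob {\<omega> \<in> space M. t \<le> \<bar>\<Sum>e\<in>E. W e \<omega>\<bar>} \<le>
      prob ({\<omega> \<in> space M. t \<le> 1 * (\<Sum>e\<in>E. W e \<omega>)} \<union> {\<omega> \<in> space M. t \<le> (-1) * (\<Sum>e\<in>E. W e \<omega>)})"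
    by (intro finite_measure_mono) auto
  also have "\<dots> \<le> prob {\<omega> \<in> space M. t \<le> 1 * (\<Sum>e\<in>E. W e \<omega>)} + prob {\<omega> \<in> space M. t \<le> (-1) * (\<Sum>e\<in>E. W e \<omega>)}"
    by (intro measure_Un_le) auto
  finally show ?thesis using one[of 1] one[of "-1"] by simp
qed

end

section \<open>Cycles of length four and their collisions\<close>

definition edges :: "nat \<Rightarrow> (nat \<times> nat) set" where
  "edges n = {(i, j). i < j \<and> j < n}"

text \<open>An unordered pair of nodes is represented by its increasing arrangement, so that the entries
  strictly above the diagonal are enumerated exactly once.\<close>
definition edge :: "nat \<Rightarrow> nat \<Rightarrow> nat \<times> nat" where
  "edge i j = (min i j, max i j)"

definition quads :: "nat \<Rightarrow> (nat \<times> nat \<times> nat \<times> nat) set" where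
  "quads n = {(i1, i2, i3, i4). {i1, i2, i3, i4} \<subseteq> {..<n} \<and> distinct [i1, i2, i3, i4]}"

text \<open>Positions on a cycle are numbered \<open>0\<close> to \<open>3\<close>; the edge at position \<open>m\<close> joins the nodes at positions
  \<open>m\<close> and \<open>m + 1\<close> modulo \<open>4\<close>.\<close>
fun node :: "nat \<times> nat \<times> nat \<times> nat \<Rightarrow> nat \<Rightarrow> nat" where
  "node (i1, i2, i3, i4) m = [i1, i2, i3, i4] ! m"

definition cyc :: "nat \<times> nat \<times> nat \<times> nat \<Rightarrow> nat \<Rightarrow> nat \<times> nat" where
  "cyc t m = edge (node t m) (node t (Suc m mod 4))"

text \<open>The positions of the nodes covered by the edges at the positions \<open>S\<close>.\<close>
definition touched :: "nat set \<Rightarrow> nat set" where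
  "touched S = S \<union> (\<lambda>m. Suc m mod 4) ` S"

lemma lessThan_4: "{..<4::nat} = {0, 1, 2, 3}"
  by auto

lemma finite_edges [simp]: "finite (edges n)"
  by (rule finite_subset[of _ "{..<n} \<times> {..<n}"]) (auto simp: edges_def)

lemma quads_subset: "quads n \<subseteq> {..<n} \<times> {..<n} \<times> {..<n} \<times> {..<n}"
  by (auto simp: quads_def)

lemma finite_quads [simp]: "finite (quads n)"
  by (rule finite_subset[OF quads_subset]) auto

lemma card_quads_le: "card (quads n) \<le> n ^ 4"
proof -
  have "card (quads n) \<le> card ({..<n} \<times> {..<n} \<times> {..<n} \<times> {..<n})"
    by (rule card_mono[OF _ quads_subset]) auto
  then show ?thesis by (simp add: card_cartesian_product eval_nat_numeral mult_ac)
qed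

lemma edge_eq_iff: "edge i j = edge k l \<longleftrightarrow> i = k \<and> j = l \<or> i = l \<and> j = k"
  by (auto simp: edge_def min_def max_def split: if_splits)

lemma edge_in_edges_iff: "edge i j \<in> edges n \<longleftrightarrow> i \<noteq> j \<and> i < n \<and> j < n"
  by (auto simp: edge_def edges_def min_def max_def split: if_splits)

lemma less_4_cases: "m < (4::nat) \<Longrightarrow> m = 0 \<or> m = 1 \<or> m = 2 \<or> m = 3"
  by auto

lemma cyc_in_edges:
  assumes "t \<in> quads n" "m < 4"
  shows "cyc t m \<in> edges n"
proof -
  obtain i j k l where "t = (i, j, k, l)" by (cases t)
  then show ?thesis
    using assms(1) less_4_cases[OF assms(2)]
    by (elim disjE) (simp_all add: quads_def cyc_def edge_in_edges_iff)
qed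

lemma inj_on_cyc: "t \<in> quads n \<Longrightarrow> inj_on (cyc t) {..<4}"
proof -
  assume "t \<in> quads n"
  moreover obtain i j k l where "t = (i, j, k, l)" by (cases t)
  ultimately have "distinct [cyc t 0, cyc t 1, cyc t 2, cyc t 3]"
    by (simp add: quads_def cyc_def edge_eq_iff)
  then show ?thesis by (simp add: lessThan_4)
qed

lemma card_touched:
  assumes "S \<subseteq> {..<4}"
  shows "card (touched S) \<le> 4"
    and "card S = 1 \<Longrightarrow> card (touched S) \<ge> 2"
    and "card S = 2 \<Longrightarrow> card (touched S) \<ge> 3"
    and "card S \<ge> 3 \<Longrightarrow> card (touched S) = 4"
proof -
  have "touched S \<subseteq> {..<4}" using assms by (auto simp: touched_def)
  then show "card (touched S) \<le> 4" using card_mono[of "{..<4}" "touched S"] by simp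
  have all: "\<forall>S\<in>Pow {0, 1, 2, 3}. (card S = 1 \<longrightarrow> card (touched S) \<ge> 2) \<and>
      (card S = 2 \<longrightarrow> card (touched S) \<ge> 3) \<and> (card S \<ge> 3 \<longrightarrow> card (touched S) = 4)"
    unfolding touched_def by code_simp
  have "S \<in> Pow {0, 1, 2, 3}" using assms by (simp add: lessThan_4)
  from bspec[OF all this]
  show "card S = 1 \<Longrightarrow> card (touched S) \<ge> 2" "card S = 2 \<Longrightarrow> card (touched S) \<ge> 3"
    "card S \<ge> 3 \<Longrightarrow> card (touched S) = 4" by simp_all
qed

text \<open>If two cycles have the same edges at the positions \<open>S\<close>, the nodes of the second at touched positions
  are among the four nodes of the first; only untouched positions are free. Few touched positions are
  what makes a noise term large, so this count decides the order of every variance.\<close>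
lemma card_collisions_le:
  assumes t: "t \<in> quads n" and S: "S \<subseteq> {..<4}"
  shows "card {t' \<in> quads n. cyc t' ` S = cyc t ` S} \<le> 256 * n ^ (4 - card (touched S))"
proof -
  define U where "U = node t ` {..<4}"
  define A where "A m = (if m \<in> touched S then U else {..<n})" for m
  have U: "finite U" "card U \<le> 4" using card_image_le[of "{..<4}" "node t"] by (auto simp: U_def)
  have ends: "node t' m \<in> U \<and> node t' (Suc m mod 4) \<in> U"
    if "cyc t' ` S = cyc t ` S" "m \<in> S" for t' m
  proof -
    have "cyc t' m \<in> cyc t ` S" using that by blast
    then obtain m' where m': "m' \<in> S" "cyc t' m = cyc t m'" by blast
    have "{fst (edge i j), snd (edge i j)} = {i, j}" for i j
      by (auto simp: edge_def min_def max_def)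
    then have "{node t' m, node t' (Suc m mod 4)} = {node t m', node t (Suc m' mod 4)}"
      using m'(2) unfolding cyc_def by metis
    moreover have "node t m' \<in> U" "node t (Suc m' mod 4) \<in> U"
      using m'(1) S unfolding U_def by auto
    ultimately have "{node t' m, node t' (Suc m mod 4)} \<subseteq> U" by simp
    then show ?thesis by simp
  qed
  have "{t' \<in> quads n. cyc t' ` S = cyc t ` S} \<subseteq> A 0 \<times> A 1 \<times> A 2 \<times> A 3"
  proof
    fix t' assume t': "t' \<in> {t' \<in> quads n. cyc t' ` S = cyc t ` S}"
    have "node t' m \<in> A m" if "m < 4" for m
    proof (cases "m \<in> touched S")
      case True
      then show ?thesis using ends[of t'] t' by (auto simp: A_def touched_def)
    next
      case False
      then show ?thesis using t' that
        by (cases t') (auto simp: A_def quads_def numeral_eq_Suc less_Suc_eq)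
    qed
    from this[of 0] this[of 1] this[of 2] this[of 3] show "t' \<in> A 0 \<times> A 1 \<times> A 2 \<times> A 3"
      by (cases t') auto
  qed
  then have "card {t' \<in> quads n. cyc t' ` S = cyc t ` S} \<le> card (A 0 \<times> A 1 \<times> A 2 \<times> A 3)"
    by (rule card_mono[rotated]) (auto simp: A_def U)
  also have "\<dots> = (\<Prod>m<4. card (A m))"
    by (simp add: card_cartesian_product numeral_eq_Suc mult_ac)
  also have "\<dots> \<le> (\<Prod>m<4. if m \<in> touched S then 4 else n)"
    using U by (intro prod_mono) (auto simp: A_def)
  also have "\<dots> = 4 ^ card (touched S) * n ^ (4 - card (touched S))"
  proof -
    have T: "touched S \<subseteq> {..<4}" using S by (auto simp: touched_def)
    have "card ({..<4} - touched S) = 4 - card (touched S)"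
      using T by (subst card_Diff_subset) (auto intro: finite_subset)
    then show ?thesis using T by (simp add: prod.If_cases Int_absorb1 Diff_eq)
  qed
  also have "\<dots> \<le> 4 ^ 4 * n ^ (4 - card (touched S))"
    using card_touched(1)[OF S] by (intro mult_right_mono power_increasing) auto
  finally show ?thesis by simp
qed

locale bernoulli_graph = bernoulli_family M "edges n" X p
  for M :: "'a measure" and n :: nat and X :: "nat \<times> nat \<Rightarrow> 'a \<Rightarrow> real" and p +
  fixes \<rho> :: "nat \<times> nat \<Rightarrow> real" and b v :: real
  assumes \<rho>_bound: "e \<in> edges n \<Longrightarrow> \<bar>\<rho> e\<bar> \<le> b" and p_le: "e \<in> edges n \<Longrightarrow> p e \<le> v"
    and b_nonneg: "b \<ge> 0" and v_nonneg: "v \<ge> 0"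
begin

text \<open>The part of the expansion of the cycle sum with noise at the positions \<open>S\<close> and signal at the
  positions \<open>R\<close>. Remaining positions carry a factor that does not depend on the cycle.\<close>
definition Z :: "nat set \<Rightarrow> nat set \<Rightarrow> 'a \<Rightarrow> real" where
  "Z S R \<omega> = (\<Sum>t\<in>quads n. (\<Prod>m\<in>R. \<rho> (cyc t m)) * (\<Prod>m\<in>S. W (cyc t m) \<omega>))"

lemma Z_measurable [measurable]: "S \<subseteq> {..<4} \<Longrightarrow> Z S R \<in> borel_measurable M"
  unfolding Z_def
  by (intro borel_measurable_sum borel_measurable_times borel_measurable_prod)
    (auto intro!: W_measurable cyc_in_edges)

lemma coeff_bound:
  assumes "t \<in> quads n" "R \<subseteq> {..<4}"
  shows "\<bar>\<Prod>m\<in>R. \<rho> (cyc t m)\<bar> \<le> b ^ card R"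
proof -
  have "\<bar>\<Prod>m\<in>R. \<rho> (cyc t m)\<bar> \<le> (\<Prod>m\<in>R. b)"
    unfolding abs_prod using assms by (intro prod_mono) (auto intro!: \<rho>_bound cyc_in_edges)
  then show ?thesis by simp
qed

lemma prod_W_cyc:
  assumes "t \<in> quads n" "S \<subseteq> {..<4}"
  shows "(\<Prod>m\<in>S. W (cyc t m) \<omega>) = (\<Prod>e\<in>cyc t ` S. W e \<omega>)"
  using inj_on_subset[OF inj_on_cyc[OF assms(1)] assms(2)] by (simp add: prod.reindex)

lemma Z_bound:
  assumes "S \<subseteq> {..<4}" "R \<subseteq> {..<4}" "\<omega> \<in> space M"
  shows "\<bar>Z S R \<omega>\<bar> \<le> real n ^ 4 * b ^ card R"
proof -
  have "\<bar>Z S R \<omega>\<bar> \<le> (\<Sum>t\<in>quads n. b ^ card R)"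
    unfolding Z_def
  proof (rule order_trans[OF sum_abs sum_mono])
    fix t assume t: "t \<in> quads n"
    have "\<bar>\<Prod>m\<in>S. W (cyc t m) \<omega>\<bar> \<le> 1"
      unfolding abs_prod by (rule prod_le_1) (use assms t in \<open>auto intro!: W_bound cyc_in_edges\<close>)
    then have "\<bar>\<Prod>m\<in>R. \<rho> (cyc t m)\<bar> * \<bar>\<Prod>m\<in>S. W (cyc t m) \<omega>\<bar> \<le> b ^ card R * 1"
      using coeff_bound[OF t assms(2)] b_nonneg by (intro mult_mono) auto
    then show "\<bar>(\<Prod>m\<in>R. \<rho> (cyc t m)) * (\<Prod>m\<in>S. W (cyc t m) \<omega>)\<bar> \<le> b ^ card R"
      by (simp add: abs_mult)
  qed
  also have "\<dots> \<le> real n ^ 4 * b ^ card R"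
    using card_quads_le[of n] b_nonneg by (simp add: mult_right_mono flip: of_nat_power)
  finally show ?thesis .
qed

lemma expectation_Z:
  assumes "S \<subseteq> {..<4}" "S \<noteq> {}"
  shows "expectation (Z S R) = 0"
proof -
  have sub: "cyc t ` S \<subseteq> edges n" if "t \<in> quads n" for t
    using that assms(1) by (auto intro!: cyc_in_edges)
  have "expectation (Z S R) =
      expectation (\<lambda>\<omega>. \<Sum>t\<in>quads n. (\<Prod>m\<in>R. \<rho> (cyc t m)) * (\<Prod>e\<in>cyc t ` S. W e \<omega>))"
    unfolding Z_def[abs_def] using assms(1) by (simp add: prod_W_cyc cong: sum.cong)
  also have "\<dots> = (\<Sum>t\<in>quads n. (\<Prod>m\<in>R. \<rho> (cyc t m)) * expectation (\<lambda>\<omega>. \<Prod>e\<in>cyc t ` S. W e \<omega>))"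
    using integrable_prod_W[OF sub] by (simp add: Bochner_Integration.integral_sum)
  also have "\<dots> = 0"
    using expectation_prod_W[OF sub] assms(2) by simp
  finally show ?thesis .
qed

lemma Z_second_moment_le:
  assumes S: "S \<subseteq> {..<4}" and R: "R \<subseteq> {..<4}"
  shows "expectation (\<lambda>\<omega>. (Z S R \<omega>)\<^sup>2)
    \<le> 256 * v ^ card S * b ^ (2 * card R) * real n ^ (8 - card (touched S))"
proof -
  have "expectation (\<lambda>\<omega>. (Z S R \<omega>)\<^sup>2) =
      expectation (\<lambda>\<omega>. (\<Sum>t\<in>quads n. (\<Prod>m\<in>R. \<rho> (cyc t m)) * (\<Prod>e\<in>cyc t ` S. W e \<omega>))\<^sup>2)"
    unfolding Z_def using S by (simp add: prod_W_cyc cong: sum.cong)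
  also have "\<dots> \<le> (b ^ card R)\<^sup>2 * v ^ card S * real (\<Sum>t\<in>quads n. card {t' \<in> quads n. cyc t' ` S = cyc t ` S})"
  proof (rule second_moment_le_collisions)
    show "cyc t ` S \<subseteq> edges n" if "t \<in> quads n" for t using that S by (auto intro!: cyc_in_edges)
    show "card (cyc t ` S) = card S" if "t \<in> quads n" for t
      using inj_on_subset[OF inj_on_cyc[OF that] S] by (rule card_image)
  qed (use coeff_bound R p_le in auto)
  also have "\<dots> \<le> (b ^ card R)\<^sup>2 * v ^ card S * real (\<Sum>t\<in>quads n. 256 * n ^ (4 - card (touched S)))"
    using v_nonneg b_nonneg card_collisions_le[OF _ S]
    by (intro mult_left_mono of_nat_mono sum_mono mult_nonneg_nonneg) auto
  also have "\<dots> \<le> (b ^ card R)\<^sup>2 * v ^ card S * real (n ^ 4 * (256 * n ^ (4 - card (touched S))))"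
    using v_nonneg b_nonneg card_quads_le
    by (intro mult_left_mono of_nat_mono mult_nonneg_nonneg) auto
  also have "\<dots> = 256 * v ^ card S * b ^ (2 * card R) * real n ^ (4 + (4 - card (touched S)))"
    by (simp add: power_add power_mult mult_ac flip: power2_eq_square power_mult[of b 2] )
  finally show ?thesis using card_touched(1)[OF S] by simp
qed

end

text \<open>The modified density estimate and the test statistic as functions of the edge weights alone. This form
  can be evaluated both at the adjacency matrix and at weights that take the values \<open>0\<close> and \<open>1\<close>
  everywhere, not just almost surely.\<close>
definition edge_density :: "nat \<Rightarrow> (nat \<times> nat \<Rightarrow> real) \<Rightarrow> real" where
  "edge_density n x =
     (let N = real n * (real n - 1); r = 2 / N * (\<Sum>e\<in>edges n. x e)
      in if r = 0 then 2 / N else if r = 1 then (N - 2) / N else r)"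

definition cycle_stat :: "nat \<Rightarrow> (nat \<times> nat \<Rightarrow> real) \<Rightarrow> real" where
  "cycle_stat n x =
     (\<Sum>t\<in>quads n. \<Prod>m<4. x (cyc t m) - edge_density n x) /
     (2 * sqrt 2 * real n ^ 2 * (edge_density n x)\<^sup>2)"

lemma cycle_stat_measurable:
  fixes X :: "nat \<times> nat \<Rightarrow> 'a \<Rightarrow> real"
  assumes X: "\<And>e. e \<in> edges n \<Longrightarrow> X e \<in> borel_measurable M"
  shows "(\<lambda>\<omega>. cycle_stat n (\<lambda>e. X e \<omega>)) \<in> borel_measurable M"
proof -
  have [measurable]: "(\<lambda>\<omega>. edge_density n (\<lambda>e. X e \<omega>)) \<in> borel_measurable M"
  proof -
    have [measurable]: "(\<lambda>\<omega>. \<Sum>e\<in>edges n. X e \<omega>) \<in> borel_measurable M"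
      using X by (rule borel_measurable_sum)
    show ?thesis unfolding edge_density_def Let_def by measurable
  qed
  have [measurable]: "(\<lambda>\<omega>. \<Sum>t\<in>quads n. \<Prod>m<4. X (cyc t m) \<omega> - edge_density n (\<lambda>e. X e \<omega>))
      \<in> borel_measurable M"
    using X cyc_in_edges by (intro borel_measurable_sum borel_measurable_prod borel_measurable_diff) auto
  show ?thesis unfolding cycle_stat_def by measurable
qed

section \<open>Bounded random variables\<close>

context prob_space begin

text \<open>All random variables below are built from finitely many bounded ones, so boundedness is a property
  that is closed under the operations of the expansion and yields integrability at once.\<close>
definition bounded_rv :: "('a \<Rightarrow> real) \<Rightarrow> bool" where
  "bounded_rv f \<longleftrightarrow> f \<in> borel_measurable M \<and> (\<exists>B. \<forall>\<omega>\<in>space M. \<bar>f \<omega>\<bar> \<le> B)"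

lemma bounded_rvI:
  assumes "f \<in> borel_measurable M" "\<And>\<omega>. \<omega> \<in> space M \<Longrightarrow> \<bar>f \<omega>\<bar> \<le> B"
  shows "bounded_rv f"
  using assms unfolding bounded_rv_def by blast

lemma bounded_rv_integrable: "bounded_rv f \<Longrightarrow> integrable M f"
  unfolding bounded_rv_def by (metis (no_types, lifting) AE_I2 integrable_const_bound real_norm_def)

lemma bounded_rv_const [intro!]: "bounded_rv (\<lambda>_. c)"
  unfolding bounded_rv_def by auto

lemma bounded_rv_add [intro!]:
  assumes "bounded_rv f" "bounded_rv g" shows "bounded_rv (\<lambda>\<omega>. f \<omega> + g \<omega>)"
proof -
  obtain B B' where "f \<in> borel_measurable M" "g \<in> borel_measurable M"
      "\<And>\<omega>. \<omega> \<in> space M \<Longrightarrow> \<bar>f \<omega>\<bar> \<le> B" "\<And>\<omega>. \<omega> \<in> space M \<Longrightarrow> \<bar>g \<omega>\<bar> \<le> B'"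
    using assms unfolding bounded_rv_def by blast
  then show ?thesis
    by (intro bounded_rvI[where B = "B + B'"]) (auto intro!: order_trans[OF abs_triangle_ineq add_mono])
qed

lemma bounded_rv_mult [intro!]:
  assumes "bounded_rv f" "bounded_rv g" shows "bounded_rv (\<lambda>\<omega>. f \<omega> * g \<omega>)"
proof -
  obtain B B' where "f \<in> borel_measurable M" "g \<in> borel_measurable M"
      "\<And>\<omega>. \<omega> \<in> space M \<Longrightarrow> \<bar>f \<omega>\<bar> \<le> B" "\<And>\<omega>. \<omega> \<in> space M \<Longrightarrow> \<bar>g \<omega>\<bar> \<le> B'"
    using assms unfolding bounded_rv_def by blast
  then show ?thesis
    by (intro bounded_rvI[where B = "\<bar>B\<bar> * \<bar>B'\<bar>"])
      (simp_all add: abs_mult mult_mono order_trans[OF _ abs_ge_self])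
qed

lemma bounded_rv_minus [intro!]: "bounded_rv f \<Longrightarrow> bounded_rv (\<lambda>\<omega>. - f \<omega>)"
  unfolding bounded_rv_def by auto

lemma bounded_rv_abs [intro!]: "bounded_rv f \<Longrightarrow> bounded_rv (\<lambda>\<omega>. \<bar>f \<omega>\<bar>)"
  unfolding bounded_rv_def by auto

lemma bounded_rv_diff [intro!]: "bounded_rv f \<Longrightarrow> bounded_rv g \<Longrightarrow> bounded_rv (\<lambda>\<omega>. f \<omega> - g \<omega>)"
  using bounded_rv_add[OF _ bounded_rv_minus, of f g] by simp

lemma bounded_rv_divide [intro!]: "bounded_rv f \<Longrightarrow> bounded_rv (\<lambda>\<omega>. f \<omega> / c)"
  using bounded_rv_mult[OF _ bounded_rv_const, of f "1 / c"] by simp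

lemma bounded_rv_power [intro!]: "bounded_rv f \<Longrightarrow> bounded_rv (\<lambda>\<omega>. f \<omega> ^ k)"
  by (induction k) auto

lemma bounded_rv_sum [intro!]: "(\<And>i. i \<in> I \<Longrightarrow> bounded_rv (f i)) \<Longrightarrow> bounded_rv (\<lambda>\<omega>. \<Sum>i\<in>I. f i \<omega>)"
  by (induction I rule: infinite_finite_induct) auto

lemma bounded_rv_prod [intro!]: "(\<And>i. i \<in> I \<Longrightarrow> bounded_rv (f i)) \<Longrightarrow> bounded_rv (\<lambda>\<omega>. \<Prod>i\<in>I. f i \<omega>)"
  by (induction I rule: infinite_finite_induct) auto

lemma bounded_rv_indicator [intro!]: "G \<in> events \<Longrightarrow> bounded_rv (indicator G)"
  by (intro bounded_rvI[where B = 1]) (auto simp: indicator_def)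

abbreviation mean_square :: "('a \<Rightarrow> real) \<Rightarrow> real" where
  "mean_square f \<equiv> expectation (\<lambda>\<omega>. (f \<omega>)\<^sup>2)"

text \<open>Cauchy--Schwarz, obtained from the pointwise inequality of arithmetic and geometric means with the
  weights \<open>B / A\<close> and \<open>A / B\<close>.\<close>
lemma expectation_abs_mult_le:
  assumes f: "bounded_rv f" and g: "bounded_rv g"
    and A: "mean_square f \<le> A\<^sup>2" "A > 0" and B: "mean_square g \<le> B\<^sup>2" "B > 0"
  shows "expectation (\<lambda>\<omega>. \<bar>f \<omega> * g \<omega>\<bar>) \<le> A * B"
proof -
  have "expectation (\<lambda>\<omega>. \<bar>f \<omega> * g \<omega>\<bar>) \<le> expectation (\<lambda>\<omega>. (B / (2 * A)) * (f \<omega>)\<^sup>2 + (A / (2 * B)) * (g \<omega>)\<^sup>2)"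
  proof (rule integral_mono)
    show "\<bar>f \<omega> * g \<omega>\<bar> \<le> (B / (2 * A)) * (f \<omega>)\<^sup>2 + (A / (2 * B)) * (g \<omega>)\<^sup>2" for \<omega>
    proof -
      have "0 \<le> (B * \<bar>f \<omega>\<bar> - A * \<bar>g \<omega>\<bar>)\<^sup>2 / (2 * A * B)" using A B by simp
      also have "\<dots> = (B / (2 * A)) * (f \<omega>)\<^sup>2 + (A / (2 * B)) * (g \<omega>)\<^sup>2 - \<bar>f \<omega>\<bar> * \<bar>g \<omega>\<bar>"
        using A B by (simp add: power2_diff power_mult_distrib divide_simps) (simp add: power2_eq_square algebra_simps)
      finally show ?thesis by (simp add: abs_mult)
    qed
  qed (use f g in \<open>auto intro!: bounded_rv_integrable\<close>)
  also have "\<dots> = (B / (2 * A)) * mean_square f + (A / (2 * B)) * mean_square g"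
    using f g by (simp add: bounded_rv_integrable bounded_rv_power)
  also have "\<dots> \<le> (B / (2 * A)) * A\<^sup>2 + (A / (2 * B)) * B\<^sup>2"
    using A B by (intro add_mono mult_left_mono) auto
  also have "\<dots> = A * B" using A(2) B(2) by (simp add: power2_eq_square)
  finally show ?thesis .
qed

end

section \<open>The good event for the density estimate\<close>

text \<open>Here \<open>a\<close> is the sparsity level, \<open>\<mu>\<close> the average edge probability, \<open>b\<close> a bound on the deviations of
  the edge probabilities from \<open>\<mu>\<close>, and \<open>D\<close> collects the constants. All bounds are for a fixed number of
  nodes and depend on the model only through these quantities.\<close>
locale four_cycle_model = bernoulli_graph M n X p "\<lambda>e. p e - \<mu>" b "D * a"
  for M :: "'a measure" and n :: nat and X :: "nat \<times> nat \<Rightarrow> 'a \<Rightarrow> real" and p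
    and \<mu> b D a :: real +
  assumes n_ge: "n \<ge> 256" and D_ge: "D \<ge> 1" and a_pos: "a > 0" and a_le: "a \<le> 1"
    and na_ge: "real n * a \<ge> 1"
    and \<mu>_ge: "a / 2 \<le> \<mu>" and \<mu>_le: "\<mu> \<le> 2 * a"
    and \<mu>_mean: "\<mu> * (real n * (real n - 1)) = 2 * (\<Sum>e\<in>edges n. p e)"
    and b_le: "b \<le> D * a"
begin

definition N :: real where "N = real n * (real n - 1)"

definition w :: real where "w = sqrt (real n)"

text \<open>The natural measure of the signal strength: up to constants the number \<open>\<tau>\<close> of the theorem is
  \<open>n\<^sup>2 x\<^sup>2\<close>, so \<open>\<tau>\<^sup>3\<^sup>/\<^sup>2 / n\<close> becomes \<open>n\<^sup>2 x\<^sup>3\<close> and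
  \<open>n\<^sup>-\<^sup>1\<^sup>/\<^sup>2 \<tau>\<^sup>3\<^sup>/\<^sup>4\<close> becomes \<open>n x\<^sup>3\<^sup>/\<^sup>2\<close>.\<close>
definition x :: real where "x = b\<^sup>2 / a"

definition \<Delta> :: "'a \<Rightarrow> real" where "\<Delta> \<omega> = 2 / N * (\<Sum>e\<in>edges n. W e \<omega>)"

text \<open>The threshold for \<open>\<Delta>\<close> on the good event, \<open>\<eta>\<^sup>2 = a n\<^sup>-\<^sup>3\<^sup>/\<^sup>2\<close>. The typical size of \<open>\<Delta>\<^sup>2\<close> is
  \<open>a n\<^sup>-\<^sup>2\<close>; the spare factor \<open>sqrt n\<close> makes the exceptional probability decay faster than every
  power of \<open>n\<close>, while \<open>\<eta>\<close> is still small compared with \<open>a\<close> because \<open>n a \<ge> 1\<close>.\<close>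
definition \<eta> :: real where "\<eta> = sqrt (a / w ^ 3)"

definition G :: "'a set" where "G = {\<omega> \<in> space M. \<bar>\<Delta> \<omega>\<bar> < \<eta>}"

definition \<epsilon> :: real where "\<epsilon> = exp (- w / 32)"

lemma w_square: "w\<^sup>2 = real n" by (simp add: w_def)

lemma w_power4: "w ^ 4 = real n ^ 2"
  using power_mult[of w 2 2] by (simp add: w_square)

lemma w_ge: "w \<ge> 16"
  using n_ge real_sqrt_le_mono[of "256" "real n"] by (simp add: w_def)

lemma N_ge: "N \<ge> real n ^ 2 / 2" and N_le: "N \<le> real n ^ 2" and N_pos: "N > 0"
proof -
  show "N \<ge> real n ^ 2 / 2" "N \<le> real n ^ 2"
    using n_ge by (auto simp: N_def power2_eq_square field_simps)
  moreover have "real n ^ 2 / 2 > 0" using n_ge by simp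
  ultimately show "N > 0" by linarith
qed

lemma b_square: "b\<^sup>2 = a * x" using a_pos by (simp add: x_def)

lemma x_nonneg: "x \<ge> 0" using a_pos by (simp add: x_def)

lemma x_le: "x \<le> D\<^sup>2"
proof -
  have "b\<^sup>2 \<le> (D * a)\<^sup>2" using b_le b_nonneg by (intro power_mono) auto
  also have "\<dots> = D\<^sup>2 * a * a" by (simp add: power2_eq_square)
  also have "\<dots> \<le> D\<^sup>2 * a * 1" using a_pos a_le by (intro mult_left_mono) auto
  finally show ?thesis using a_pos by (simp add: x_def field_simps)
qed

lemma \<mu>_pos: "\<mu> > 0" using a_pos \<mu>_ge by linarith

lemma bounded_W: "e \<in> edges n \<Longrightarrow> bounded_rv (W e)"
  using W_bound by (intro bounded_rvI[where B = 1]) auto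

lemma bounded_Z: "S \<subseteq> {..<4} \<Longrightarrow> R \<subseteq> {..<4} \<Longrightarrow> bounded_rv (Z S R)"
  using Z_bound by (intro bounded_rvI[where B = "real n ^ 4 * b ^ card R"]) auto

lemma bounded_\<Delta>: "bounded_rv \<Delta>"
  unfolding \<Delta>_def[abs_def] using bounded_W by auto

lemma \<Delta>_measurable [measurable]: "\<Delta> \<in> borel_measurable M"
  using bounded_\<Delta> by (simp add: bounded_rv_def)

lemma G_event [measurable]: "G \<in> events"
  unfolding G_def by measurable

lemma expectation_\<Delta>: "expectation \<Delta> = 0"
proof -
  have "expectation \<Delta> = 2 / N * (\<Sum>e\<in>edges n. expectation (W e))"
    unfolding \<Delta>_def[abs_def] using integrable_W by (simp add: Bochner_Integration.integral_sum)
  then show ?thesis using expectation_W by simp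
qed

lemma expectation_\<Delta>_square: "mean_square \<Delta> \<le> 16 * D * a / real n ^ 2"
proof -
  have c: "card (edges n) \<le> n\<^sup>2"
    using card_mono[of "{..<n} \<times> {..<n}" "edges n"]
    by (auto simp: edges_def power2_eq_square card_cartesian_product subset_iff)
  have "expectation (\<lambda>\<omega>. (\<Sum>e\<in>edges n. 1 * (\<Prod>e\<in>{e}. W e \<omega>))\<^sup>2)
      \<le> 1\<^sup>2 * (D * a) ^ 1 * real (\<Sum>e\<in>edges n. card {e' \<in> edges n. {e'} = {e}})"
    by (rule second_moment_le_collisions) (auto simp: p_le)
  also have "(\<Sum>e\<in>edges n. card {e' \<in> edges n. {e'} = {e}}) = (\<Sum>e\<in>edges n. 1)"
  proof (rule sum.cong)
    fix e assume "e \<in> edges n"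
    then have "{e' \<in> edges n. {e'} = {e}} = {e}" by auto
    then show "card {e' \<in> edges n. {e'} = {e}} = 1" by simp
  qed simp
  finally have "expectation (\<lambda>\<omega>. (\<Sum>e\<in>edges n. W e \<omega>)\<^sup>2) \<le> D * a * real (card (edges n))" by simp
  also have "\<dots> \<le> D * a * real n ^ 2"
    using c v_nonneg by (intro mult_left_mono) (auto simp flip: of_nat_power)
  finally have E: "expectation (\<lambda>\<omega>. (\<Sum>e\<in>edges n. W e \<omega>)\<^sup>2) \<le> D * a * real n ^ 2" .
  have "mean_square \<Delta> = (2 / N)\<^sup>2 * expectation (\<lambda>\<omega>. (\<Sum>e\<in>edges n. W e \<omega>)\<^sup>2)"
    unfolding \<Delta>_def power_mult_distrib by simp
  also have "\<dots> \<le> (2 / N)\<^sup>2 * (D * a * real n ^ 2)"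
    using E by (intro mult_left_mono) auto
  also have "(2 / N)\<^sup>2 \<le> (2 / (real n ^ 2 / 2))\<^sup>2"
    using N_ge N_pos n_ge by (intro power_mono divide_left_mono) auto
  then have "(2 / N)\<^sup>2 * (D * a * real n ^ 2) \<le> (2 / (real n ^ 2 / 2))\<^sup>2 * (D * a * real n ^ 2)"
    using v_nonneg by (intro mult_right_mono) auto
  also have "\<dots> = 16 * D * a / real n ^ 2"
    using n_ge by (simp add: field_simps power2_eq_square)
  finally show ?thesis .
qed

lemma aw2: "a * w\<^sup>2 \<ge> 1" using na_ge by (simp add: w_square mult.commute)

lemma \<eta>_le: "\<eta> \<le> a / 4"
proof -
  have "16 * 1 \<le> w * (a * w\<^sup>2)" using w_ge aw2 by (intro mult_mono) auto
  then have "a / w ^ 3 \<le> (a / 4)\<^sup>2"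
    using w_ge a_pos by (simp add: field_simps power2_eq_square power3_eq_cube)
  then show ?thesis unfolding \<eta>_def using a_pos by (intro real_le_lsqrt) auto
qed

lemma \<eta>_pos: "\<eta> > 0" using a_pos w_ge by (simp add: \<eta>_def)

lemma \<eta>_square: "\<eta>\<^sup>2 = a / w ^ 3" using a_pos w_ge by (simp add: \<eta>_def)

text \<open>Chernoff's bound at \<open>t = N \<eta> / 2\<close>, where the exponent \<open>N \<eta>\<^sup>2 / (8 \<mu>)\<close> is of order \<open>sqrt n\<close>.\<close>
lemma prob_not_G: "prob (space M - G) \<le> 2 * \<epsilon>"
proof -
  let ?V = "\<Sum>e\<in>edges n. p e" and ?t = "N / 2 * \<eta>"
  have V: "?V = \<mu> * N / 2" using \<mu>_mean by (simp add: N_def)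
  have Vpos: "?V > 0" unfolding V using \<mu>_pos N_pos by simp
  have tV: "?t\<^sup>2 / (4 * ?V) = N * \<eta>\<^sup>2 / (8 * \<mu>)"
    unfolding V using N_pos \<mu>_pos by (simp add: field_simps power2_eq_square)
  have "w / 32 = (w ^ 4 / 2) * (a / w ^ 3) / (8 * (2 * a))"
    using w_ge a_pos by (simp add: field_simps eval_nat_numeral)
  also have "\<dots> \<le> N * \<eta>\<^sup>2 / (8 * \<mu>)"
    unfolding \<eta>_square using N_ge \<mu>_le \<mu>_pos a_pos w_ge N_pos
    by (intro frac_le mult_right_mono mult_nonneg_nonneg) (auto simp: w_power4)
  finally have exponent: "w / 32 \<le> ?t\<^sup>2 / (4 * ?V)" unfolding tV .
  have "prob (space M - G) = prob {\<omega> \<in> space M. ?t \<le> \<bar>\<Sum>e\<in>edges n. W e \<omega>\<bar>}"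
    using N_pos by (intro arg_cong[where f = prob])
      (auto simp: G_def \<Delta>_def abs_mult field_simps)
  also have "\<dots> \<le> 2 * exp (- ?t\<^sup>2 / (4 * ?V))"
  proof (rule prob_sum_W_ge_le[OF refl Vpos])
    show "0 < ?t" using N_pos \<eta>_pos by simp
    show "?t \<le> 2 * ?V" unfolding V using N_pos \<eta>_le \<mu>_ge a_pos by (simp add: field_simps)
  qed
  also have "\<dots> \<le> 2 * \<epsilon>" using exponent unfolding \<epsilon>_def by simp
  finally show ?thesis .
qed

end

section \<open>Decomposition of the cycle sum\<close>

lemma (in prob_space) expectation_sum_square_le:
  fixes f :: "'i \<Rightarrow> 'a \<Rightarrow> real"
  assumes f: "\<And>i. i \<in> I \<Longrightarrow> bounded_rv (f i)"
    and c: "\<And>i. i \<in> I \<Longrightarrow> expectation (\<lambda>\<omega>. (f i \<omega>)\<^sup>2) \<le> c"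
  shows "expectation (\<lambda>\<omega>. (\<Sum>i\<in>I. f i \<omega>)\<^sup>2) \<le> (real (card I))\<^sup>2 * c"
proof -
  have "expectation (\<lambda>\<omega>. (\<Sum>i\<in>I. f i \<omega>)\<^sup>2) \<le> expectation (\<lambda>\<omega>. (\<Sum>i\<in>I. (f i \<omega>)\<^sup>2) * real (card I))"
    using f by (intro integral_mono sum_squared_le_sum_of_squares bounded_rv_integrable) auto
  also have "\<dots> = (\<Sum>i\<in>I. expectation (\<lambda>\<omega>. (f i \<omega>)\<^sup>2)) * real (card I)"
    using f by (simp add: Bochner_Integration.integral_sum bounded_rv_integrable bounded_rv_power)
  also have "\<dots> \<le> (\<Sum>i\<in>I. c) * real (card I)"
    using c by (intro mult_right_mono sum_mono) auto
  finally show ?thesis by (simp add: power2_eq_square mult_ac)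
qed

context four_cycle_model
begin

text \<open>The number of the four positions that carry the common error \<open>\<Delta>\<close> of the density estimate.\<close>
definition excess :: "nat set \<times> nat set \<Rightarrow> nat" where
  "excess = (\<lambda>(S, R). card ({..<4} - S - R))"

definition summand :: "nat set \<times> nat set \<Rightarrow> 'a \<Rightarrow> real" where
  "summand = (\<lambda>(S, R) \<omega>. (- \<Delta> \<omega>) ^ excess (S, R) * Z S R \<omega>)"

definition splits :: "(nat set \<times> nat set) set" where
  "splits = Sigma (Pow {..<4}) (\<lambda>S. Pow ({..<4} - S))"

text \<open>Apart from the deterministic term, the splits fall into two classes. Those in \<open>lin_splits\<close> have mean
  zero, either because pure noise and signal factors are left or because \<open>\<Delta>\<close> enters linearly and
  without further noise. All others carry a factor \<open>\<Delta>\<close> together with noise or with another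
  \<open>\<Delta>\<close>; they are biased, but of smaller order on the good event.\<close>
definition lin_splits :: "(nat set \<times> nat set) set" where
  "lin_splits = {(S, R) \<in> splits. excess (S, R) = 0 \<and> S \<noteq> {} \<or> excess (S, R) = 1 \<and> S = {}}"

definition rest_splits :: "(nat set \<times> nat set) set" where
  "rest_splits = {(S, R) \<in> splits. excess (S, R) \<ge> 1 \<and> (S = {} \<longrightarrow> excess (S, R) \<ge> 2)}"

definition q :: real where
  "q = (\<Sum>t\<in>quads n. \<Prod>m<4. p (cyc t m) - \<mu>)"

definition lin :: "'a \<Rightarrow> real" where "lin \<omega> = (\<Sum>SR\<in>lin_splits. summand SR \<omega>)"

definition rest :: "'a \<Rightarrow> real" where "rest \<omega> = (\<Sum>SR\<in>rest_splits. summand SR \<omega>)"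

definition Q :: "real \<Rightarrow> 'a \<Rightarrow> real" where
  "Q \<alpha> \<omega> = (\<Sum>t\<in>quads n. \<Prod>m<4. X (cyc t m) \<omega> - \<alpha>)"

lemma finite_splits: "finite splits" and card_splits: "card splits \<le> 256"
proof -
  have sub: "splits \<subseteq> Pow {..<4} \<times> Pow {..<4}" by (auto simp: splits_def)
  then show "finite splits" by (rule finite_subset) auto
  have "card splits \<le> card (Pow {..<4::nat} \<times> Pow {..<4::nat})" by (rule card_mono[OF _ sub]) auto
  then show "card splits \<le> 256" by (simp add: card_cartesian_product card_Pow)
qed

lemma splits_cards:
  assumes "(S, R) \<in> splits"
  shows "S \<subseteq> {..<4}" "R \<subseteq> {..<4}" "card S + card R + excess (S, R) = 4"
proof -
  show sub: "S \<subseteq> {..<4}" "R \<subseteq> {..<4}" using assms by (auto simp: splits_def)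
  have fin: "finite S" "finite R" using sub finite_subset by auto
  have "card ({..<4} - S - R) = card ({..<4} - S) - card R"
    using assms fin by (intro card_Diff_subset) (auto simp: splits_def)
  moreover have "card ({..<4} - S) = 4 - card S"
    using sub fin by (subst card_Diff_subset) auto
  moreover have "card R \<le> card ({..<4} - S)"
    using assms by (intro card_mono) (auto simp: splits_def)
  moreover have "card S \<le> 4" using card_mono[OF _ sub(1)] by simp
  ultimately show "card S + card R + excess (S, R) = 4" by (simp add: excess_def)
qed

lemma Q_decomposition: "Q (\<mu> + \<Delta> \<omega>) \<omega> = q + lin \<omega> + rest \<omega>"
proof -
  have "Q (\<mu> + \<Delta> \<omega>) \<omega> =
      (\<Sum>t\<in>quads n. \<Sum>S\<in>Pow {..<4}. (\<Prod>m\<in>S. W (cyc t m) \<omega>) *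
        (\<Sum>R\<in>Pow ({..<4} - S). (\<Prod>m\<in>R. p (cyc t m) - \<mu>) * (\<Prod>m\<in>{..<4} - S - R. - \<Delta> \<omega>)))"
  proof -
    have "(\<Prod>m<4. X (cyc t m) \<omega> - (\<mu> + \<Delta> \<omega>)) =
        (\<Prod>m<4. W (cyc t m) \<omega> + ((p (cyc t m) - \<mu>) + (- \<Delta> \<omega>)))" for t
      by (rule prod.cong) (auto simp: W_def)
    then show ?thesis unfolding Q_def by (simp only: prod_add finite_lessThan finite_Diff)
  qed
  also have "\<dots> = (\<Sum>S\<in>Pow {..<4}. \<Sum>R\<in>Pow ({..<4} - S). summand (S, R) \<omega>)"
    by (subst sum.swap, rule sum.cong, simp, unfold sum_distrib_left, subst sum.swap)
      (simp add: summand_def excess_def Z_def sum_distrib_left mult_ac)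
  also have "\<dots> = (\<Sum>SR\<in>splits. summand SR \<omega>)"
    unfolding splits_def by (subst sum.Sigma) auto
  also have "splits = insert ({}, {..<4}) (lin_splits \<union> rest_splits)"
  proof -
    have "({}, {..<4}) \<in> splits" by (auto simp: splits_def)
    moreover have "SR = ({}, {..<4})" if "SR \<in> splits" "SR \<notin> lin_splits \<union> rest_splits" for SR
    proof -
      obtain S R where SR: "SR = (S, R)" by (cases SR)
      have "excess (S, R) = 0" "S = {}"
        using that unfolding SR lin_splits_def rest_splits_def by auto
      then have "S = {}" "R = {..<4}"
        using that unfolding SR by (auto simp: splits_def excess_def)
      then show ?thesis using SR by simp
    qed
    moreover have "lin_splits \<union> rest_splits \<subseteq> splits" by (auto simp: lin_splits_def rest_splits_def)
    ultimately show ?thesis by blast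
  qed
  also have "(\<Sum>SR\<in>insert ({}, {..<4}) (lin_splits \<union> rest_splits). summand SR \<omega>) =
      summand ({}, {..<4}) \<omega> + (lin \<omega> + rest \<omega>)"
  proof -
    have fin: "finite lin_splits" "finite rest_splits"
      using finite_splits by (auto intro: rev_finite_subset simp: lin_splits_def rest_splits_def)
    have "({}, {..<4}) \<notin> lin_splits \<union> rest_splits"
      by (auto simp: lin_splits_def rest_splits_def excess_def)
    moreover have "lin_splits \<inter> rest_splits = {}"
      by (auto simp: lin_splits_def rest_splits_def)
    ultimately show ?thesis using fin unfolding lin_def rest_def by (simp add: sum.union_disjoint)
  qed
  also have "summand ({}, {..<4}) \<omega> = q"
    by (simp add: summand_def excess_def Z_def q_def)
  finally show ?thesis by simp
qed

lemma bounded_summand: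
  assumes "SR \<in> splits"
  shows "bounded_rv (summand SR)"
proof -
  obtain S R where SR: "SR = (S, R)" by (cases SR)
  then have "bounded_rv (\<lambda>\<omega>. (- \<Delta> \<omega>) ^ excess (S, R) * Z S R \<omega>)"
    using assms splits_cards(1,2)[of S R] bounded_\<Delta> bounded_Z[of S R] by auto
  then show ?thesis using SR by (simp add: summand_def)
qed

lemma lin_sub: "lin_splits \<subseteq> splits" and rest_sub: "rest_splits \<subseteq> splits"
  by (auto simp: lin_splits_def rest_splits_def)

lemma bounded_lin: "bounded_rv lin" and bounded_rest: "bounded_rv rest"
  unfolding lin_def[abs_def] rest_def[abs_def]
  using bounded_summand lin_sub rest_sub by (auto intro!: bounded_rv_sum)

lemma q_abs_le: "\<bar>q\<bar> \<le> real n ^ 4 * b ^ 4"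
proof -
  obtain \<omega> where "\<omega> \<in> space M" using not_empty by auto
  then show ?thesis using Z_bound[of "{}" "{..<4}" \<omega>] by (simp add: Z_def q_def)
qed

lemma Z_empty: "Z {} R \<omega> = (\<Sum>t\<in>quads n. \<Prod>m\<in>R. p (cyc t m) - \<mu>)"
  by (simp add: Z_def)

lemma expectation_lin: "expectation lin = 0"
proof -
  have "expectation lin = (\<Sum>SR\<in>lin_splits. expectation (summand SR))"
    unfolding lin_def[abs_def]
    by (intro Bochner_Integration.integral_sum bounded_rv_integrable bounded_summand) (use lin_sub in auto)
  also have "\<dots> = 0"
  proof (rule sum.neutral, rule ballI)
    fix SR assume SR: "SR \<in> lin_splits"
    obtain S R where [simp]: "SR = (S, R)" by (cases SR)
    have sub: "S \<subseteq> {..<4}" using SR lin_sub splits_cards by auto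
    consider "excess (S, R) = 0" "S \<noteq> {}" | "excess (S, R) = 1" "S = {}"
      using SR by (auto simp: lin_splits_def)
    then show "expectation (summand SR) = 0"
    proof cases
      case 1
      then show ?thesis using expectation_Z[OF sub] by (simp add: summand_def)
    next
      case 2
      then show ?thesis using expectation_\<Delta> by (simp add: summand_def Z_empty)
    qed
  qed
  finally show ?thesis .
qed

lemma D_power_le: "j \<le> k \<Longrightarrow> D ^ j \<le> D ^ k"
  using D_ge by (intro power_increasing) auto

lemma b_power: "b ^ (2 * r) = a ^ r * x ^ r"
  by (simp add: power_mult b_square power_mult_distrib)

text \<open>Interpolation: \<open>n x\<^sup>2\<close> is \<open>n\<^sup>-\<^sup>1\<^sup>/\<^sup>3\<close> times the power \<open>2/3\<close> of \<open>n\<^sup>2 x\<^sup>3\<close>. It disposes of the cycles with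
  two adjacent noise edges.\<close>
lemma nx2_le: "real n * x\<^sup>2 \<le> 1 + real n ^ 2 * x ^ 3"
proof (cases "real n * x \<ge> 1")
  case True
  have "real n * x\<^sup>2 * 1 \<le> real n * x\<^sup>2 * (real n * x)"
    using True by (intro mult_left_mono) auto
  then show ?thesis by (simp add: power2_eq_square power3_eq_cube mult_ac)
next
  case False
  have "x \<le> 1 / real n" using False n_ge by (simp add: field_simps)
  also have "\<dots> \<le> 1" using n_ge by simp
  finally have "(real n * x) * x \<le> 1 * 1"
    using False x_nonneg by (intro mult_mono) auto
  then have "real n * x\<^sup>2 \<le> 1" by (simp add: power2_eq_square mult_ac)
  moreover have "real n ^ 2 * x ^ 3 \<ge> 0" using x_nonneg by simp
  ultimately show ?thesis by linarith
qed

text \<open>Relative to \<open>a\<^sup>4 n\<^sup>4\<close>, the case of four noise edges, the collision count gives the orders \<open>x\<close>, \<open>n x\<^sup>2\<close> and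
  \<open>n\<^sup>2 x\<^sup>3\<close> for three, two and one noise edges: trading a noise factor for a signal factor costs
  \<open>b\<^sup>2 / a = x\<close>, but frees nodes. A single factor \<open>\<Delta>\<close> behaves like a single noise edge.\<close>
lemma lin_summand_second_moment:
  assumes SR: "(S, R) \<in> lin_splits"
  shows "mean_square (summand (S, R))
    \<le> 256 * D ^ 8 * a ^ 4 * real n ^ 4 * (1 + real n ^ 2 * x ^ 3)"
proof -
  have SRs: "(S, R) \<in> splits" using SR lin_sub by auto
  note sub = splits_cards[OF SRs]
  let ?y = "1 + real n ^ 2 * x ^ 3"
  have y1: "1 \<le> ?y" using x_nonneg by simp
  have n1: "real n \<ge> 1" using n_ge by simp
  consider "excess (S, R) = 0" "S \<noteq> {}" | "excess (S, R) = 1" "S = {}"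
    using SR by (auto simp: lin_splits_def)
  then show ?thesis
  proof cases
    case 1
    have fS: "finite S" using sub finite_subset by auto
    have "mean_square (summand (S, R)) = mean_square (Z S R)"
      using 1 by (simp add: summand_def)
    also have "\<dots> \<le> 256 * (D * a) ^ card S * b ^ (2 * card R) * real n ^ (8 - card (touched S))"
      by (rule Z_second_moment_le[OF sub(1,2)])
    also have "\<dots> = 256 * (D ^ card S * a ^ 4 * (x ^ card R * real n ^ (8 - card (touched S))))"
      using sub(3) 1 by (simp add: b_power power_mult_distrib flip: power_add mult.assoc[of "a ^ _" "a ^ _"])
    also have "\<dots> \<le> 256 * (D ^ 8 * a ^ 4 * (real n ^ 4 * ?y))"
    proof -
      have key: "D ^ card S * (x ^ card R * real n ^ (8 - card (touched S))) \<le> D ^ 8 * (real n ^ 4 * ?y)"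
      proof -
        have "card S \<noteq> 0" using 1 fS by simp
        then consider "card S = 1" "card R = 3" | "card S = 2" "card R = 2"
          | "card S = 3" "card R = 1" | "card S = 4" "card R = 0"
          using sub(3) 1 by linarith
        then show ?thesis
        proof cases
          case a: 1
          have "real n ^ (8 - card (touched S)) \<le> real n ^ 6"
            using card_touched(2)[OF sub(1) a(1)] n1 by (intro power_increasing) auto
          then have "x ^ 3 * real n ^ (8 - card (touched S)) \<le> x ^ 3 * real n ^ 6"
            using x_nonneg by (intro mult_left_mono) auto
          also have "\<dots> = real n ^ 4 * (real n ^ 2 * x ^ 3)" by (simp add: eval_nat_numeral)
          also have "\<dots> \<le> real n ^ 4 * ?y" by (intro mult_left_mono) auto
          finally show ?thesis unfolding a
            by - (rule mult_mono, insert D_power_le[of 1 8] D_ge x_nonneg, auto)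
        next
          case a: 2
          have "real n ^ (8 - card (touched S)) \<le> real n ^ 5"
            using card_touched(3)[OF sub(1) a(1)] n1 by (intro power_increasing) auto
          then have "x ^ 2 * real n ^ (8 - card (touched S)) \<le> x ^ 2 * real n ^ 5"
            using x_nonneg by (intro mult_left_mono) auto
          also have "\<dots> = real n ^ 4 * (real n * x\<^sup>2)" by (simp add: eval_nat_numeral)
          also have "\<dots> \<le> real n ^ 4 * ?y" using nx2_le by (intro mult_left_mono) auto
          finally show ?thesis unfolding a
            by - (rule mult_mono, insert D_power_le[of 2 8] D_ge x_nonneg, auto)
        next
          case a: 3
          have "D ^ 3 * (x * real n ^ 4) \<le> D ^ 3 * (D\<^sup>2 * real n ^ 4)"
            using x_le D_ge by (intro mult_left_mono mult_right_mono) auto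
          also have "\<dots> = D ^ 5 * (real n ^ 4 * 1)" by (simp add: eval_nat_numeral)
          also have "\<dots> \<le> D ^ 8 * (real n ^ 4 * ?y)"
            using D_power_le[of 5 8] D_ge y1 by (intro mult_mono) auto
          finally show ?thesis using card_touched(4)[OF sub(1)] unfolding a by simp
        next
          case a: 4
          have "D ^ 4 * (real n ^ 4 * 1) \<le> D ^ 8 * (real n ^ 4 * ?y)"
            using D_power_le[of 4 8] D_ge y1 by (intro mult_mono) auto
          then show ?thesis using card_touched(4)[OF sub(1)] unfolding a by simp
        qed
      qed
      have "D ^ card S * a ^ 4 * (x ^ card R * real n ^ (8 - card (touched S))) =
          a ^ 4 * (D ^ card S * (x ^ card R * real n ^ (8 - card (touched S))))"
        by (simp only: mult_ac)
      also have "\<dots> \<le> a ^ 4 * (D ^ 8 * (real n ^ 4 * ?y))"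
        using key a_pos by (intro mult_left_mono) auto
      also have "\<dots> = D ^ 8 * a ^ 4 * (real n ^ 4 * ?y)" by (simp only: mult_ac)
      finally show ?thesis by (intro mult_left_mono) auto
    qed
    finally show ?thesis by (simp add: mult_ac)
  next
    case 2
    have cR: "card R = 3" using sub(3) 2 by simp
    obtain \<omega>0 where \<omega>0: "\<omega>0 \<in> space M" using not_empty by auto
    define z where "z = Z {} R \<omega>0"
    have z: "Z {} R \<omega> = z" for \<omega> by (simp add: z_def Z_empty)
    have "z\<^sup>2 \<le> (real n ^ 4 * b ^ 3)\<^sup>2"
      using Z_bound[OF _ sub(2) \<omega>0, of "{}"] power_mono[of "\<bar>z\<bar>" _ 2] by (simp add: z_def cR)
    also have "\<dots> = real n ^ 8 * (a ^ 3 * x ^ 3)"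
      using b_power[of 3] by (simp add: power_mult_distrib flip: power_mult)
    finally have z2: "z\<^sup>2 \<le> real n ^ 8 * (a ^ 3 * x ^ 3)" .
    have "mean_square (summand (S, R)) = mean_square \<Delta> * z\<^sup>2"
      using 2 by (simp add: summand_def z power_mult_distrib)
    also have "\<dots> \<le> (16 * D * a / real n ^ 2) * (real n ^ 8 * (a ^ 3 * x ^ 3))"
      using expectation_\<Delta>_square z2 D_ge a_pos by (intro mult_mono) auto
    also have "\<dots> = 16 * D * (a ^ 4 * real n ^ 4 * (real n ^ 2 * x ^ 3))"
      using n_ge by (simp add: field_simps eval_nat_numeral)
    also have "\<dots> \<le> (256 * D ^ 8) * (a ^ 4 * real n ^ 4 * ?y)"
      using D_power_le[of 1 8] D_ge a_pos x_nonneg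
      by (intro mult_mono mult_left_mono) auto
    finally show ?thesis by (simp add: mult_ac)
  qed
qed

lemma lin_second_moment:
  "mean_square lin \<le> 2 ^ 24 * D ^ 8 * a ^ 4 * real n ^ 4 * (1 + real n ^ 2 * x ^ 3)"
proof -
  let ?c = "256 * D ^ 8 * a ^ 4 * real n ^ 4 * (1 + real n ^ 2 * x ^ 3)"
  have c: "?c \<ge> 0" using D_ge a_pos x_nonneg by simp
  have "mean_square lin \<le> (real (card lin_splits))\<^sup>2 * ?c"
    unfolding lin_def
    by (rule expectation_sum_square_le) (use bounded_summand lin_sub lin_summand_second_moment in auto)
  also have "card lin_splits \<le> 256"
    using card_mono[OF finite_splits lin_sub] card_splits by linarith
  then have "(real (card lin_splits))\<^sup>2 * ?c \<le> 256\<^sup>2 * ?c"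
    using c by (intro mult_right_mono power_mono) auto
  finally show ?thesis by simp
qed

text \<open>On the good event each factor \<open>\<Delta>\<close> may be replaced by its threshold, so that the second moments of
  the noise sums suffice. The two worst cases, both with
  two signal factors, are one \<open>\<Delta>\<close> with one noise edge and two factors \<open>\<Delta>\<close>; both are at
  most \<open>n x\<^sup>2\<close>, and all others are of order \<open>n\<^sup>-\<^sup>1\<^sup>/\<^sup>2\<close> or smaller.\<close>
lemma rest_summand_second_moment:
  assumes SR: "(S, R) \<in> rest_splits"
  shows "expectation (\<lambda>\<omega>. (indicator G \<omega> * summand (S, R) \<omega>)\<^sup>2)
    \<le> 256 * D ^ 8 * a ^ 4 * real n ^ 4 * (real n * x\<^sup>2 + 1 / w)"
proof -
  have SRs: "(S, R) \<in> splits" using SR rest_sub by auto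
  note sub = splits_cards[OF SRs]
  define d where "d = excess (S, R)"
  define s where "s = card S"
  define r where "r = card R"
  have fS: "finite S" using sub finite_subset by auto
  have sum4: "s + r + d = 4" using sub(3) by (simp add: s_def r_def d_def)
  have d: "d \<ge> 1" "s = 0 \<Longrightarrow> d \<ge> 2"
    using SR fS by (auto simp: rest_splits_def d_def s_def)
  have n1: "real n \<ge> 1" using n_ge by simp
  have w0: "w > 0" "w \<ge> 1" using w_ge by auto
  have nw: "real n ^ k = w ^ (2 * k)" for k by (simp add: power_mult w_square)
  have "expectation (\<lambda>\<omega>. (indicator G \<omega> * summand (S, R) \<omega>)\<^sup>2)
      \<le> expectation (\<lambda>\<omega>. (a / w ^ 3) ^ d * (Z S R \<omega>)\<^sup>2)"
  proof (rule integral_mono)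
    show "integrable M (\<lambda>\<omega>. (indicator G \<omega> * summand (S, R) \<omega>)\<^sup>2)"
      using bounded_summand[OF SRs] by (intro bounded_rv_integrable) auto
    show "integrable M (\<lambda>\<omega>. (a / w ^ 3) ^ d * (Z S R \<omega>)\<^sup>2)"
      using bounded_Z[OF sub(1,2)] by (intro bounded_rv_integrable) auto
    fix \<omega>
    show "(indicator G \<omega> * summand (S, R) \<omega>)\<^sup>2 \<le> (a / w ^ 3) ^ d * (Z S R \<omega>)\<^sup>2"
    proof (cases "\<omega> \<in> G")
      case True
      then have "\<bar>\<Delta> \<omega>\<bar> \<le> \<eta>" by (simp add: G_def)
      then have "(\<Delta> \<omega>)\<^sup>2 \<le> a / w ^ 3" unfolding \<eta>_square[symmetric] using \<eta>_pos by (simp add: abs_le_square_iff[symmetric])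
      then have "((\<Delta> \<omega>)\<^sup>2) ^ d * (Z S R \<omega>)\<^sup>2 \<le> (a / w ^ 3) ^ d * (Z S R \<omega>)\<^sup>2"
        by (intro mult_right_mono power_mono) auto
      moreover have "((- \<Delta> \<omega>) ^ d)\<^sup>2 = ((\<Delta> \<omega>)\<^sup>2) ^ d"
        by (metis power2_minus power_mult mult.commute)
      ultimately show ?thesis using True by (simp add: summand_def d_def power_mult_distrib)
    next
      case False
      then show ?thesis using a_pos w0 by simp
    qed
  qed
  also have "\<dots> = (a / w ^ 3) ^ d * mean_square (Z S R)" by simp
  also have "\<dots> \<le> (a / w ^ 3) ^ d * (256 * (D * a) ^ s * b ^ (2 * r) * real n ^ (8 - card (touched S)))"
    unfolding s_def r_def using a_pos w0 by (intro mult_left_mono Z_second_moment_le[OF sub(1,2)]) auto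
  also have "\<dots> = 256 * (a ^ (s + r + d) * (D ^ s * x ^ r * (real n ^ (8 - card (touched S)) / w ^ (3 * d))))"
    unfolding b_power using w0 by (simp add: power_mult_distrib power_divide power_add power_mult)
  also have "\<dots> = 256 * (a ^ 4 * (D ^ s * x ^ r * (real n ^ (8 - card (touched S)) / w ^ (3 * d))))"
    unfolding sum4 ..
  also have "\<dots> \<le> 256 * (a ^ 4 * (D ^ 8 * (real n ^ 4 * (real n * x\<^sup>2 + 1 / w))))"
  proof -
    \<comment> \<open>The least number of nodes that \<open>s\<close> edges of a cycle can touch.\<close>
    define v where "v = (if s = 0 then 0 else if s = 1 then 2 else if s = 2 then 3 else 4::nat)"
    have "v \<le> card (touched S)"
      using card_touched(2-4)[OF sub(1)] by (auto simp: v_def s_def)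
    then have "real n ^ (8 - card (touched S)) \<le> real n ^ (8 - v)"
      using n1 by (intro power_increasing) auto
    then have 1: "D ^ s * x ^ r * (real n ^ (8 - card (touched S)) / w ^ (3 * d)) \<le>
        D ^ s * x ^ r * (w ^ (2 * (8 - v)) / w ^ (3 * d))"
      unfolding nw using w0 x_nonneg D_ge by (intro mult_left_mono divide_right_mono) auto
    have big: "D ^ s * x ^ r * (w ^ i / w ^ j) \<le> D ^ 8 * (w ^ 7)"
      if "i \<le> 7 + j" "s + 2 * r \<le> 8" for i j
    proof -
      have "x ^ r \<le> (D\<^sup>2) ^ r" using x_le x_nonneg by (intro power_mono) auto
      then have "D ^ s * x ^ r \<le> D ^ s * (D\<^sup>2) ^ r" using D_ge by (intro mult_left_mono) auto
      also have "\<dots> = D ^ (s + 2 * r)" by (simp add: power_add power_mult)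
      also have "\<dots> \<le> D ^ 8" using that by (intro D_power_le)
      finally have "D ^ s * x ^ r \<le> D ^ 8" .
      moreover have "w ^ i \<le> w ^ 7 * w ^ j"
        using that w0 by (simp add: power_increasing flip: power_add)
      then have "w ^ i / w ^ j \<le> w ^ 7" using w0 by (simp add: pos_divide_le_eq)
      ultimately show ?thesis using w0 D_ge x_nonneg by (intro mult_mono) auto
    qed
    have w7: "D ^ 8 * w ^ 7 \<le> D ^ 8 * (real n ^ 4 * (real n * x\<^sup>2 + 1 / w))"
    proof -
      have "w ^ 7 = real n ^ 4 * (1 / w)" unfolding nw using w0 by (simp add: field_simps eval_nat_numeral)
      also have "\<dots> \<le> real n ^ 4 * (real n * x\<^sup>2 + 1 / w)" by (intro mult_left_mono) auto
      finally show ?thesis using D_ge by (intro mult_left_mono) auto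
    qed
    have two: "D ^ s * x\<^sup>2 * w ^ 10 \<le> D ^ 8 * (real n ^ 4 * (real n * x\<^sup>2 + 1 / w))" if "s \<le> 8" for s
    proof -
      have "x\<^sup>2 * w ^ 10 = real n ^ 4 * (real n * x\<^sup>2)"
        using nw[of 5] by (simp add: eval_nat_numeral)
      also have "\<dots> \<le> real n ^ 4 * (real n * x\<^sup>2 + 1 / w)"
        using w0 by (intro mult_left_mono) auto
      finally have "D ^ s * (x\<^sup>2 * w ^ 10) \<le> D ^ 8 * (real n ^ 4 * (real n * x\<^sup>2 + 1 / w))"
        by - (rule mult_mono, insert D_power_le[OF that] w0 D_ge, auto)
      then show ?thesis by (simp add: mult.assoc)
    qed
    have "D ^ s * x ^ r * (w ^ (2 * (8 - v)) / w ^ (3 * d)) \<le> D ^ 8 * (real n ^ 4 * (real n * x\<^sup>2 + 1 / w))"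
    proof (cases "r = 2")
      case True
      then consider "s = 0" "d = 2" | "s = 1" "d = 1" using sum4 d by linarith
      then show ?thesis
      proof cases
        case 1
        have "w ^ (2 * (8 - v)) / w ^ (3 * d) = w ^ 10"
          using w0 1 by (simp add: v_def field_simps flip: power_add)
        then show ?thesis using two[of 0] True 1 by simp
      next
        case 2
        have "w ^ (2 * (8 - v)) / w ^ (3 * d) = w ^ 9"
          using w0 2 by (simp add: v_def field_simps flip: power_add)
        moreover have "w ^ 9 \<le> w ^ 10" using w0 by (intro power_increasing) auto
        ultimately have "D ^ s * x ^ r * (w ^ (2 * (8 - v)) / w ^ (3 * d)) \<le> D ^ 1 * x\<^sup>2 * w ^ 10"
          using True 2 D_ge by (simp add: mult_left_mono)
        then show ?thesis using two[of 1] by linarith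
      qed
    next
      case False
      have "2 * (8 - v) \<le> 7 + 3 * d" "s + 2 * r \<le> 8"
        using sum4 d False unfolding v_def by presburger+
      then show ?thesis using order_trans[OF big w7] by blast
    qed
    with 1 have "D ^ s * x ^ r * (real n ^ (8 - card (touched S)) / w ^ (3 * d))
        \<le> D ^ 8 * (real n ^ 4 * (real n * x\<^sup>2 + 1 / w))" by linarith
    then show ?thesis using a_pos by (intro mult_left_mono) auto
  qed
  finally show ?thesis by (simp add: mult_ac)
qed

lemma rest_second_moment:
  "mean_square (\<lambda>\<omega>. indicator G \<omega> * rest \<omega>)
    \<le> 2 ^ 24 * D ^ 8 * a ^ 4 * real n ^ 4 * (real n * x\<^sup>2 + 1 / w)"
proof -
  let ?c = "256 * D ^ 8 * a ^ 4 * real n ^ 4 * (real n * x\<^sup>2 + 1 / w)"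
  have c: "?c \<ge> 0" using D_ge a_pos w_ge by simp
  have "mean_square (\<lambda>\<omega>. indicator G \<omega> * rest \<omega>)
      = expectation (\<lambda>\<omega>. (\<Sum>SR\<in>rest_splits. indicator G \<omega> * summand SR \<omega>)\<^sup>2)"
    by (simp add: rest_def sum_distrib_left)
  also have "\<dots> \<le> (real (card rest_splits))\<^sup>2 * ?c"
  proof (rule expectation_sum_square_le)
    show "bounded_rv (\<lambda>\<omega>. indicator G \<omega> * summand SR \<omega>)" if "SR \<in> rest_splits" for SR
      by (intro bounded_rv_mult bounded_rv_indicator bounded_summand G_event) (use rest_sub that in blast)
    show "expectation (\<lambda>\<omega>. (indicator G \<omega> * summand SR \<omega>)\<^sup>2) \<le> ?c" if "SR \<in> rest_splits" for SR
      using rest_summand_second_moment that by (cases SR) auto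
  qed
  also have "card rest_splits \<le> 256"
    using card_mono[OF finite_splits rest_sub] card_splits by linarith
  then have "(real (card rest_splits))\<^sup>2 * ?c \<le> 256\<^sup>2 * ?c"
    using c by (intro mult_right_mono power_mono) auto
  finally show ?thesis by simp
qed

end

section \<open>Mean and variance for a fixed number of nodes\<close>

text \<open>Controls the random denominator of the statistic to first order in the error of the density estimate.\<close>
lemma inverse_square_perturbation:
  fixes \<mu> \<delta> :: real
  assumes "\<mu> > 0" "\<bar>\<delta>\<bar> \<le> \<mu> / 2"
  shows "1 / (4 * \<mu>\<^sup>2) \<le> 1 / (\<mu> + \<delta>)\<^sup>2" and "1 / (\<mu> + \<delta>)\<^sup>2 \<le> 4 / \<mu>\<^sup>2"
    and "\<bar>1 / (\<mu> + \<delta>)\<^sup>2 - 1 / \<mu>\<^sup>2\<bar> \<le> 10 * \<bar>\<delta>\<bar> / \<mu> ^ 3"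
proof -
  have lo: "\<mu> / 2 \<le> \<mu> + \<delta>" and hi: "\<mu> + \<delta> \<le> 2 * \<mu>" using assms by linarith+
  have pos: "\<mu> + \<delta> > 0" using lo assms by linarith
  have "(\<mu> + \<delta>)\<^sup>2 \<le> (2 * \<mu>)\<^sup>2" using hi pos by (intro power_mono) auto
  then show "1 / (4 * \<mu>\<^sup>2) \<le> 1 / (\<mu> + \<delta>)\<^sup>2"
    using pos assms by (intro divide_left_mono) (auto simp: power_mult_distrib)
  have sq: "(\<mu> / 2)\<^sup>2 \<le> (\<mu> + \<delta>)\<^sup>2" using lo assms by (intro power_mono) auto
  then have "1 / (\<mu> + \<delta>)\<^sup>2 \<le> 1 / (\<mu> / 2)\<^sup>2" using assms pos by (intro divide_left_mono) auto
  then show inv: "1 / (\<mu> + \<delta>)\<^sup>2 \<le> 4 / \<mu>\<^sup>2" by (simp add: power_divide)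
  have "1 / (\<mu> + \<delta>)\<^sup>2 - 1 / \<mu>\<^sup>2 = (- \<delta> * (2 * \<mu> + \<delta>) / \<mu>\<^sup>2) * (1 / (\<mu> + \<delta>)\<^sup>2)"
    using assms pos by (simp add: divide_simps) (simp add: power2_eq_square algebra_simps)
  then have "\<bar>1 / (\<mu> + \<delta>)\<^sup>2 - 1 / \<mu>\<^sup>2\<bar> = (\<bar>\<delta>\<bar> * \<bar>2 * \<mu> + \<delta>\<bar> / \<mu>\<^sup>2) * (1 / (\<mu> + \<delta>)\<^sup>2)"
    by (simp add: abs_mult)
  also have "\<dots> \<le> (\<bar>\<delta>\<bar> * (5 / 2 * \<mu>) / \<mu>\<^sup>2) * (4 / \<mu>\<^sup>2)"
    using assms inv by (intro mult_mono divide_right_mono mult_left_mono) auto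
  also have "\<dots> = 10 * \<bar>\<delta>\<bar> / \<mu> ^ 3"
    using assms by (simp add: field_simps eval_nat_numeral)
  finally show "\<bar>1 / (\<mu> + \<delta>)\<^sup>2 - 1 / \<mu>\<^sup>2\<bar> \<le> 10 * \<bar>\<delta>\<bar> / \<mu> ^ 3" .
qed

context four_cycle_model
begin

definition \<alpha>hat :: "'a \<Rightarrow> real" where
  "\<alpha>hat \<omega> = edge_density n (\<lambda>e. X e \<omega>)"

definition T :: "'a \<Rightarrow> real" where "T \<omega> = cycle_stat n (\<lambda>e. X e \<omega>)"

definition u :: real where "u = 2 * sqrt 2 * real n ^ 2"

lemma \<alpha>hat_eq: "\<alpha>hat \<omega> = (let r = 2 / N * (\<Sum>e\<in>edges n. X e \<omega>)
     in if r = 0 then 2 / N else if r = 1 then (N - 2) / N else r)"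
  by (simp add: \<alpha>hat_def edge_density_def N_def Let_def)

lemma T_eq: "T \<omega> = Q (\<alpha>hat \<omega>) \<omega> / (u * (\<alpha>hat \<omega>)\<^sup>2)"
  by (simp add: T_def cycle_stat_def Q_def \<alpha>hat_def u_def)

definition Y :: real where "Y = 1 + real n * (x * sqrt x)"

lemma density_eq: "2 / N * (\<Sum>e\<in>edges n. X e \<omega>) = \<mu> + \<Delta> \<omega>"
proof -
  have "2 / N * (\<Sum>e\<in>edges n. p e) = \<mu>"
    using \<mu>_mean N_pos by (simp add: N_def[symmetric] field_simps)
  then show ?thesis by (simp add: \<Delta>_def W_def sum_subtractf right_diff_distrib)
qed

lemma u_ge: "u \<ge> 2 * real n ^ 2" and u_pos: "u > 0"
proof -
  have "sqrt 2 \<ge> 1" by simp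
  then show "u \<ge> 2 * real n ^ 2" unfolding u_def by (intro mult_right_mono) auto
  then show "u > 0" using n_ge by (auto simp: u_def)
qed

text \<open>The replacement rule at density \<open>0\<close>, together with the discreteness of the density, keeps the
  estimate polynomially far from \<open>0\<close>. Hence the statistic is at most polynomially large, which the
  exponentially small probability outside the good event absorbs.\<close>
lemma \<alpha>hat_bounds:
  assumes "\<omega> \<in> space M"
  shows "1 / N \<le> \<alpha>hat \<omega>" "\<alpha>hat \<omega> \<le> 4"
proof -
  let ?s = "\<Sum>e\<in>edges n. X e \<omega>"
  have N3: "N \<ge> 3"
  proof -
    have "256 * 255 \<le> N" unfolding N_def using n_ge by (intro mult_mono) auto
    then show ?thesis by simp
  qed
  have X: "X e \<omega> \<in> {0, 1}" if "e \<in> edges n" for e using X01[OF that assms] .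
  have s0: "?s \<ge> 0" using X by (intro sum_nonneg) fastforce
  have s1: "?s = 0 \<or> ?s \<ge> 1"
  proof (cases "\<forall>e\<in>edges n. X e \<omega> = 0")
    case False
    then obtain e where e: "e \<in> edges n" "X e \<omega> = 1" using X by auto
    have "X e \<omega> \<le> ?s" using X e by (intro member_le_sum) fastforce+
    then show ?thesis using e by simp
  qed simp
  have "?s \<le> (\<Sum>e\<in>edges n. 1)" using X by (intro sum_mono) fastforce
  also have "\<dots> \<le> real n ^ 2"
    using card_mono[of "{..<n} \<times> {..<n}" "edges n"]
    by (auto simp: edges_def power2_eq_square card_cartesian_product subset_iff simp flip: of_nat_mult)
  finally have "?s \<le> 2 * N" using N_ge by linarith
  then have r4: "2 / N * ?s \<le> 4" using N_pos by (simp add: field_simps)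
  show "1 / N \<le> \<alpha>hat \<omega>"
    using s0 s1 N_pos N3 by (auto simp: \<alpha>hat_eq Let_def field_simps)
  show "\<alpha>hat \<omega> \<le> 4"
    using r4 N3 N_pos unfolding \<alpha>hat_eq Let_def by (auto simp: field_simps)
qed

lemma Q_abs_le:
  assumes "\<omega> \<in> space M" "0 \<le> \<alpha>" "\<alpha> \<le> 4"
  shows "\<bar>Q \<alpha> \<omega>\<bar> \<le> 256 * real n ^ 4"
proof -
  have "\<bar>Q \<alpha> \<omega>\<bar> \<le> (\<Sum>t\<in>quads n. 256)"
    unfolding Q_def
  proof (rule order_trans[OF sum_abs sum_mono])
    fix t assume t: "t \<in> quads n"
    have "\<bar>\<Prod>m<4. X (cyc t m) \<omega> - \<alpha>\<bar> \<le> (\<Prod>m<4::nat. 4)"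
      unfolding abs_prod
    proof (rule prod_mono, safe)
      fix m :: nat assume "m < 4"
      then have "X (cyc t m) \<omega> \<in> {0, 1}" using X01 cyc_in_edges[OF t] assms(1) by auto
      then show "\<bar>X (cyc t m) \<omega> - \<alpha>\<bar> \<le> 4" using assms by auto
    qed simp
    then show "\<bar>\<Prod>m<4. X (cyc t m) \<omega> - \<alpha>\<bar> \<le> 256" by simp
  qed
  also have "\<dots> \<le> 256 * real n ^ 4"
    using card_quads_le[of n] by (simp flip: of_nat_power)
  finally show ?thesis .
qed

lemma T_abs_le:
  assumes "\<omega> \<in> space M"
  shows "\<bar>T \<omega>\<bar> \<le> 256 * real n ^ 6"
proof -
  have pos: "\<alpha>hat \<omega> > 0" using N_pos by (intro less_le_trans[OF _ \<alpha>hat_bounds(1)[OF assms]]) simp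
  have "(1 / N)\<^sup>2 \<le> (\<alpha>hat \<omega>)\<^sup>2"
    using \<alpha>hat_bounds(1)[OF assms] N_pos by (intro power_mono) auto
  then have "real n ^ 2 * (1 / N)\<^sup>2 \<le> u * (\<alpha>hat \<omega>)\<^sup>2"
    using u_ge u_pos by (intro mult_mono) auto
  then have "\<bar>T \<omega>\<bar> \<le> 256 * real n ^ 4 / (real n ^ 2 * (1 / N)\<^sup>2)"
    using Q_abs_le[OF assms _ \<alpha>hat_bounds(2)[OF assms]] pos n_ge N_pos u_pos
    unfolding T_eq abs_divide by (intro frac_le) auto
  also have "\<dots> = 256 * real n ^ 2 * N\<^sup>2"
    using n_ge N_pos by (simp add: field_simps eval_nat_numeral)
  also have "\<dots> \<le> 256 * real n ^ 2 * (real n ^ 2)\<^sup>2"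
    using N_le N_pos by (intro mult_left_mono power_mono) auto
  finally show ?thesis by (simp add: eval_nat_numeral mult_ac)
qed

lemma bounded_T: "bounded_rv T"
  by (rule bounded_rvI[OF _ T_abs_le]) (auto simp: T_def[abs_def] intro!: cycle_stat_measurable)

lemma \<Delta>_small: "\<omega> \<in> G \<Longrightarrow> \<bar>\<Delta> \<omega>\<bar> \<le> \<mu> / 2"
  using \<eta>_le \<mu>_ge by (auto simp: G_def)

lemma not_G_square: "expectation (\<lambda>\<omega>. (1 - indicator G \<omega> :: real)\<^sup>2) \<le> (sqrt (2 * \<epsilon>))\<^sup>2"
proof -
  have "expectation (\<lambda>\<omega>. (1 - indicator G \<omega> :: real)\<^sup>2) = expectation (indicator (space M - G))"
    by (intro Bochner_Integration.integral_cong) (auto simp: indicator_def)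
  also have "\<dots> = prob (space M - G)" by simp
  finally show ?thesis using prob_not_G by (simp add: \<epsilon>_def)
qed

lemma lin_norm_le:
  "mean_square lin \<le> (2 ^ 12 * D ^ 4 * a\<^sup>2 * real n ^ 2 * Y)\<^sup>2"
proof -
  have "(x * sqrt x)\<^sup>2 = x ^ 3" using x_nonneg by (simp add: power_mult_distrib eval_nat_numeral)
  then have "1 + real n ^ 2 * x ^ 3 \<le> Y\<^sup>2"
    unfolding Y_def power2_sum using x_nonneg by (simp add: power_mult_distrib)
  then have "2 ^ 24 * D ^ 8 * a ^ 4 * real n ^ 4 * (1 + real n ^ 2 * x ^ 3)
      \<le> 2 ^ 24 * D ^ 8 * a ^ 4 * real n ^ 4 * Y\<^sup>2"
    using D_ge a_pos by (intro mult_left_mono) auto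
  then show ?thesis using lin_second_moment by (simp add: power_mult_distrib flip: power_mult)
qed

end

text \<open>The extra condition keeps the observed density below \<open>1\<close> on the good event, so that the replacement
  rule does not apply there.\<close>
locale four_cycle_model_sparse = four_cycle_model +
  assumes \<mu>_less: "\<mu> + \<eta> < 1"
begin

lemma \<alpha>hat_on_G: "\<omega> \<in> G \<Longrightarrow> \<alpha>hat \<omega> = \<mu> + \<Delta> \<omega>"
  using \<mu>_less \<mu>_pos \<Delta>_small[of \<omega>] unfolding \<alpha>hat_eq density_eq Let_def by (auto simp: G_def)

lemma T_on_G:
  assumes "\<omega> \<in> G"
  shows "T \<omega> = (q + lin \<omega> + rest \<omega>) / u * (1 / (\<mu> + \<Delta> \<omega>)\<^sup>2)"
  unfolding T_eq \<alpha>hat_on_G[OF assms] Q_decomposition by simp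

text \<open>A pointwise lower bound for the statistic in which every term has a computable expectation bound. The
  random denominator is replaced by \<open>\<mu>\<^sup>2\<close> in the terms from \<open>lin\<close>, at the price of the product of
  \<open>lin\<close> and \<open>\<Delta>\<close>; only then does the vanishing mean of \<open>lin\<close> become available.\<close>
definition lower :: "'a \<Rightarrow> real" where
  "lower \<omega> = q / (4 * u * \<mu>\<^sup>2) * indicator G \<omega> + lin \<omega> / (u * \<mu>\<^sup>2)
    - \<bar>lin \<omega> * (1 - indicator G \<omega>)\<bar> / (u * \<mu>\<^sup>2) - 10 / (u * \<mu> ^ 3) * \<bar>lin \<omega> * \<Delta> \<omega>\<bar>
    - 4 / (u * \<mu>\<^sup>2) * \<bar>(indicator G \<omega> * rest \<omega>) * 1\<bar> - 256 * real n ^ 6 * (1 - indicator G \<omega>)"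

definition centre :: real where "centre = q / (u * \<mu>\<^sup>2)"

definition upper :: "'a \<Rightarrow> real" where
  "upper \<omega> = 300 * q\<^sup>2 / (u\<^sup>2 * \<mu> ^ 6) * (\<Delta> \<omega>)\<^sup>2
    + 48 / (u\<^sup>2 * \<mu> ^ 4) * (lin \<omega>)\<^sup>2 + 48 / (u\<^sup>2 * \<mu> ^ 4) * (indicator G \<omega> * rest \<omega>)\<^sup>2
    + (2 * (256 * real n ^ 6)\<^sup>2 + 2 * centre\<^sup>2) * (1 - indicator G \<omega>)"

lemma T_ge_lower:
  assumes \<omega>: "\<omega> \<in> space M" and q: "q \<ge> 0"
  shows "lower \<omega> \<le> T \<omega>"
proof (cases "\<omega> \<in> G")
  case True
  note inv = inverse_square_perturbation[OF \<mu>_pos \<Delta>_small[OF True]]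
  define i where "i = 1 / (\<mu> + \<Delta> \<omega>)\<^sup>2"
  have 1: "q * i \<ge> q * (1 / (4 * \<mu>\<^sup>2))" using inv(1) q unfolding i_def by (intro mult_left_mono)
  have "\<bar>lin \<omega> * (i - 1 / \<mu>\<^sup>2)\<bar> \<le> \<bar>lin \<omega>\<bar> * (10 * \<bar>\<Delta> \<omega>\<bar> / \<mu> ^ 3)"
    unfolding abs_mult using inv(3) by (intro mult_left_mono) (auto simp: i_def)
  then have 2: "lin \<omega> * i \<ge> lin \<omega> / \<mu>\<^sup>2 - \<bar>lin \<omega>\<bar> * (10 * \<bar>\<Delta> \<omega>\<bar> / \<mu> ^ 3)"
    by (simp add: right_diff_distrib abs_le_iff)
  have "\<bar>rest \<omega> * i\<bar> \<le> \<bar>rest \<omega>\<bar> * (4 / \<mu>\<^sup>2)"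
    unfolding abs_mult using inv(2) by (intro mult_left_mono) (auto simp: i_def)
  then have 3: "rest \<omega> * i \<ge> - \<bar>rest \<omega>\<bar> * (4 / \<mu>\<^sup>2)" by (simp add: abs_le_iff)
  have "T \<omega> = (q * i + lin \<omega> * i + rest \<omega> * i) / u"
    unfolding T_on_G[OF True] i_def[symmetric] by (simp add: field_simps)
  also have "\<dots> \<ge> (q * (1 / (4 * \<mu>\<^sup>2)) + (lin \<omega> / \<mu>\<^sup>2 - \<bar>lin \<omega>\<bar> * (10 * \<bar>\<Delta> \<omega>\<bar> / \<mu> ^ 3))
      + - \<bar>rest \<omega>\<bar> * (4 / \<mu>\<^sup>2)) / u"
    using 1 2 3 u_pos by (intro divide_right_mono) auto
  finally show ?thesis using True u_pos \<mu>_pos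
    by (simp add: lower_def add_divide_distrib diff_divide_distrib abs_mult mult_ac)
next
  case False
  have "lin \<omega> / (u * \<mu>\<^sup>2) \<le> \<bar>lin \<omega>\<bar> / (u * \<mu>\<^sup>2)"
    using u_pos by (intro divide_right_mono) auto
  moreover have "10 / (u * \<mu> ^ 3) * \<bar>lin \<omega> * \<Delta> \<omega>\<bar> \<ge> 0" using u_pos \<mu>_pos by simp
  ultimately show ?thesis using False T_abs_le[OF \<omega>] by (simp add: lower_def)
qed

text \<open>The signal term survives with a constant factor. The errors are bounded by Cauchy--Schwarz: \<open>lin\<close> outside
  the good event, the product of \<open>lin\<close> and \<open>\<Delta>\<close> from the denominator, and \<open>rest\<close>.\<close>
lemma expectation_T_ge:
  assumes q: "q \<ge> 0" and \<epsilon>_le: "2 * \<epsilon> \<le> 1 / 2"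
  shows "expectation T \<ge> q / (8 * u * \<mu>\<^sup>2) -
    2 ^ 20 * D ^ 5 * ((sqrt \<epsilon> + 1 / w + real n ^ 6 * \<epsilon>) * Y + sqrt (real n * x\<^sup>2 + 1 / w))"
proof -
  \<comment> \<open>Bounds for the \<open>L\<^sup>2\<close> norms of \<open>lin\<close>, \<open>\<Delta>\<close> and the restriction of \<open>rest\<close> to the good event.\<close>
  define A where "A = 2 ^ 12 * D ^ 4 * a\<^sup>2 * real n ^ 2 * Y"
  define B where "B = 4 * D * sqrt a / real n"
  define R where "R = 2 ^ 12 * D ^ 4 * a\<^sup>2 * real n ^ 2 * sqrt (real n * x\<^sup>2 + 1 / w)"
  have \<epsilon>0: "\<epsilon> > 0" by (simp add: \<epsilon>_def)
  have Y1: "Y \<ge> 1" using x_nonneg by (simp add: Y_def)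
  have n0: "real n > 0" using n_ge by simp
  have w0: "w > 0" using w_ge by simp
  have rad: "real n * x\<^sup>2 + 1 / w > 0" using w0 by (simp add: add_nonneg_pos)
  have A0: "A > 0" and B0: "B > 0" and R0: "R > 0"
    using D_ge a_pos n0 Y1 rad by (auto simp: A_def B_def R_def)
  have lin2: "mean_square lin \<le> A\<^sup>2" using lin_norm_le unfolding A_def .
  have "16 * D * a / real n ^ 2 \<le> 16 * D\<^sup>2 * a / real n ^ 2"
    using D_power_le[of 1 2] a_pos by (intro divide_right_mono mult_right_mono) auto
  also have "\<dots> = B\<^sup>2" using a_pos by (simp add: B_def power_mult_distrib power_divide)
  finally have \<Delta>2: "mean_square \<Delta> \<le> B\<^sup>2" using expectation_\<Delta>_square by linarith
  have "R\<^sup>2 = 2 ^ 24 * D ^ 8 * a ^ 4 * real n ^ 4 * (real n * x\<^sup>2 + 1 / w)"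
    using rad by (simp add: R_def power_mult_distrib flip: power_mult)
  then have rest2: "mean_square (\<lambda>\<omega>. indicator G \<omega> * rest \<omega>) \<le> R\<^sup>2"
    using rest_second_moment by simp
  have bI: "bounded_rv (\<lambda>\<omega>. 1 - indicator G \<omega>)" by auto
  have bGr: "bounded_rv (\<lambda>\<omega>. indicator G \<omega> * rest \<omega>)" using bounded_rest by auto
  have e1: "expectation (\<lambda>\<omega>. \<bar>lin \<omega> * (1 - indicator G \<omega>)\<bar>) \<le> A * sqrt (2 * \<epsilon>)"
    using \<epsilon>0 A0 by (intro expectation_abs_mult_le bounded_lin bI lin2 not_G_square) auto
  have e2: "expectation (\<lambda>\<omega>. \<bar>lin \<omega> * \<Delta> \<omega>\<bar>) \<le> A * B"
    using A0 B0 by (intro expectation_abs_mult_le bounded_lin bounded_\<Delta> lin2 \<Delta>2)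
  have e3: "expectation (\<lambda>\<omega>. \<bar>(indicator G \<omega> * rest \<omega>) * 1\<bar>) \<le> R * 1"
    using R0 by (intro expectation_abs_mult_le bGr rest2) (auto simp: prob_space)
  have pG: "prob G \<ge> 1 / 2" and pG': "1 - prob G \<le> 2 * \<epsilon>"
    using prob_not_G \<epsilon>_le by (simp_all add: prob_compl)
  note ints = bounded_rv_integrable[OF bounded_lin] bounded_rv_integrable[OF bI]
    bounded_rv_integrable[OF bounded_rv_abs[OF bounded_rv_mult[OF bounded_lin bI]]]
    bounded_rv_integrable[OF bounded_rv_abs[OF bounded_rv_mult[OF bounded_lin bounded_\<Delta>]]]
    bounded_rv_integrable[OF bounded_rv_abs[OF bounded_rv_mult[OF bGr bounded_rv_const[of 1]]]]
    bounded_rv_integrable[OF bounded_rv_indicator[OF G_event]]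
  have low: "expectation lower = q / (4 * u * \<mu>\<^sup>2) * prob G + expectation lin / (u * \<mu>\<^sup>2)
    - expectation (\<lambda>\<omega>. \<bar>lin \<omega> * (1 - indicator G \<omega>)\<bar>) / (u * \<mu>\<^sup>2)
    - 10 / (u * \<mu> ^ 3) * expectation (\<lambda>\<omega>. \<bar>lin \<omega> * \<Delta> \<omega>\<bar>)
    - 4 / (u * \<mu>\<^sup>2) * expectation (\<lambda>\<omega>. \<bar>(indicator G \<omega> * rest \<omega>) * 1\<bar>)
    - 256 * real n ^ 6 * (1 - prob G)"
    unfolding lower_def[abs_def] using ints by (simp del: mult_1_right abs_mult add: prob_space)
  have "bounded_rv lower"
    unfolding lower_def[abs_def] using bounded_lin bounded_\<Delta> bounded_rest by auto
  then have "expectation lower \<le> expectation T"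
    using bounded_T by (intro integral_mono T_ge_lower q bounded_rv_integrable)
  moreover have "expectation lower \<ge> q / (4 * u * \<mu>\<^sup>2) * (1 / 2) + 0 / (u * \<mu>\<^sup>2)
    - A * sqrt (2 * \<epsilon>) / (u * \<mu>\<^sup>2) - 10 / (u * \<mu> ^ 3) * (A * B)
    - 4 / (u * \<mu>\<^sup>2) * (R * 1) - 256 * real n ^ 6 * (2 * \<epsilon>)"
    unfolding low expectation_lin using e1 e2 e3 pG pG' q u_pos \<mu>_pos
    by (intro diff_mono add_mono mult_left_mono divide_right_mono) auto
  ultimately have T_ge: "q / (8 * u * \<mu>\<^sup>2) - A * sqrt (2 * \<epsilon>) * (1 / (u * \<mu>\<^sup>2))
    - 10 * (A * B) * (1 / (u * \<mu> ^ 3)) - 4 * R * (1 / (u * \<mu>\<^sup>2)) - 512 * real n ^ 6 * \<epsilon> \<le> expectation T"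
    by simp
  have i2: "1 / (u * \<mu>\<^sup>2) \<le> 2 / (real n ^ 2 * a\<^sup>2)"
  proof -
    have "(2 * real n ^ 2) * (a / 2)\<^sup>2 \<le> u * \<mu>\<^sup>2"
      using u_ge \<mu>_ge a_pos u_pos by (intro mult_mono power_mono) auto
    then have "1 / (u * \<mu>\<^sup>2) \<le> 1 / ((2 * real n ^ 2) * (a / 2)\<^sup>2)"
      using n0 a_pos u_pos \<mu>_pos by (intro divide_left_mono) auto
    then show ?thesis by (simp add: power_divide mult.commute)
  qed
  have i3: "1 / (u * \<mu> ^ 3) \<le> 4 / (real n ^ 2 * a ^ 3)"
  proof -
    have "(2 * real n ^ 2) * (a / 2) ^ 3 \<le> u * \<mu> ^ 3"
      using u_ge \<mu>_ge a_pos u_pos by (intro mult_mono power_mono) auto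
    then have "1 / (u * \<mu> ^ 3) \<le> 1 / ((2 * real n ^ 2) * (a / 2) ^ 3)"
      using n0 a_pos u_pos \<mu>_pos by (intro divide_left_mono) auto
    then show ?thesis by (simp add: power_divide mult.commute)
  qed
  have t1: "A * sqrt (2 * \<epsilon>) * (1 / (u * \<mu>\<^sup>2)) \<le> 2 ^ 20 * D ^ 5 * sqrt \<epsilon> * Y"
  proof -
    have "A * sqrt (2 * \<epsilon>) * (1 / (u * \<mu>\<^sup>2)) \<le> A * sqrt (2 * \<epsilon>) * (2 / (real n ^ 2 * a\<^sup>2))"
      using i2 A0 \<epsilon>0 by (intro mult_left_mono) auto
    also have "\<dots> = (2 ^ 13 * sqrt 2) * D ^ 4 * (sqrt \<epsilon> * Y)"
      using n0 a_pos by (simp add: A_def real_sqrt_mult field_simps)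
    also have "\<dots> \<le> 2 ^ 20 * D ^ 5 * (sqrt \<epsilon> * Y)"
      using D_power_le[of 4 5] D_ge \<epsilon>0 Y1 sqrt2_less_2
      by (intro mult_right_mono mult_mono) auto
    finally show ?thesis by (simp add: mult_ac)
  qed
  have t2: "10 * (A * B) * (1 / (u * \<mu> ^ 3)) \<le> 2 ^ 20 * D ^ 5 * (1 / w) * Y"
  proof -
    have "w \<le> real n * sqrt a"
    proof -
      have "w * 1 \<le> w * sqrt (real n * a)" using na_ge w0 by (intro mult_left_mono) auto
      also have "\<dots> = real n * sqrt a" by (simp add: w_def real_sqrt_mult)
      finally show ?thesis by simp
    qed
    then have iw: "1 / (real n * sqrt a) \<le> 1 / w" using w0 by (intro divide_left_mono) auto
    have "10 * (A * B) * (1 / (u * \<mu> ^ 3)) \<le> 10 * (A * B) * (4 / (real n ^ 2 * a ^ 3))"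
      using i3 A0 B0 by (intro mult_left_mono) auto
    also have "\<dots> = 160 * 2 ^ 12 * D ^ 5 * Y * (sqrt a / (real n * a))"
      using n0 a_pos by (simp add: A_def B_def field_simps eval_nat_numeral)
    also have "sqrt a / (real n * a) = 1 / (real n * sqrt a)"
      using a_pos n0 by (simp add: field_simps)
    also have "160 * 2 ^ 12 * D ^ 5 * Y * \<dots> \<le> 2 ^ 20 * D ^ 5 * Y * (1 / w)"
      using iw D_ge Y1 n0 a_pos by (intro mult_mono) auto
    finally show ?thesis by (simp add: mult_ac)
  qed
  have t3: "4 * R * (1 / (u * \<mu>\<^sup>2)) \<le> 2 ^ 20 * D ^ 5 * sqrt (real n * x\<^sup>2 + 1 / w)"
  proof -
    have "4 * R * (1 / (u * \<mu>\<^sup>2)) \<le> 4 * R * (2 / (real n ^ 2 * a\<^sup>2))"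
      using i2 R0 by (intro mult_left_mono) auto
    also have "\<dots> = 2 ^ 15 * D ^ 4 * sqrt (real n * x\<^sup>2 + 1 / w)"
      using n0 a_pos by (simp add: R_def field_simps)
    also have "\<dots> \<le> 2 ^ 20 * D ^ 5 * sqrt (real n * x\<^sup>2 + 1 / w)"
      using D_power_le[of 4 5] D_ge rad by (intro mult_mono) auto
    finally show ?thesis .
  qed
  have t4: "512 * real n ^ 6 * \<epsilon> \<le> 2 ^ 20 * D ^ 5 * (real n ^ 6 * \<epsilon>) * Y"
  proof -
    have "512 * 1 * (real n ^ 6 * \<epsilon>) * 1 \<le> 2 ^ 20 * D ^ 5 * (real n ^ 6 * \<epsilon>) * Y"
      using D_power_le[of 0 5] D_ge Y1 \<epsilon>0 by (intro mult_mono) auto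
    then show ?thesis by simp
  qed
  have "2 ^ 20 * D ^ 5 * ((sqrt \<epsilon> + 1 / w + real n ^ 6 * \<epsilon>) * Y + sqrt (real n * x\<^sup>2 + 1 / w)) =
      2 ^ 20 * D ^ 5 * sqrt \<epsilon> * Y + 2 ^ 20 * D ^ 5 * (1 / w) * Y
      + 2 ^ 20 * D ^ 5 * (real n ^ 6 * \<epsilon>) * Y + 2 ^ 20 * D ^ 5 * sqrt (real n * x\<^sup>2 + 1 / w)"
    by (simp only: distrib_left distrib_right mult.assoc)
  then show ?thesis using T_ge t1 t2 t3 t4 by linarith
qed

lemma T_deviation_le_upper:
  assumes \<omega>: "\<omega> \<in> space M"
  shows "(T \<omega> - centre)\<^sup>2 \<le> upper \<omega>"
proof (cases "\<omega> \<in> G")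
  case True
  note inv = inverse_square_perturbation[OF \<mu>_pos \<Delta>_small[OF True]]
  define i where "i = 1 / (\<mu> + \<Delta> \<omega>)\<^sup>2"
  define y1 where "y1 = q / u * (i - 1 / \<mu>\<^sup>2)"
  define y2 where "y2 = lin \<omega> / u * i"
  define y3 where "y3 = rest \<omega> / u * i"
  have "T \<omega> - centre = y1 + y2 + y3"
    unfolding T_on_G[OF True] centre_def y1_def y2_def y3_def i_def
    by (simp add: add_divide_distrib algebra_simps)
  moreover have "(y1 + y2 + y3)\<^sup>2 \<le> 3 * (y1\<^sup>2 + y2\<^sup>2 + y3\<^sup>2)"
  proof -
    have "0 \<le> (y1 - y2)\<^sup>2 + (y1 - y3)\<^sup>2 + (y2 - y3)\<^sup>2" by simp
    then show ?thesis by (simp add: power2_eq_square algebra_simps)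
  qed
  moreover have "y1\<^sup>2 \<le> 100 * q\<^sup>2 / (u\<^sup>2 * \<mu> ^ 6) * (\<Delta> \<omega>)\<^sup>2"
  proof -
    have "(i - 1 / \<mu>\<^sup>2)\<^sup>2 \<le> (10 * \<bar>\<Delta> \<omega>\<bar> / \<mu> ^ 3)\<^sup>2"
      using inv(3) power_mono[of "\<bar>i - 1 / \<mu>\<^sup>2\<bar>" _ 2] by (simp add: i_def)
    then have "(q / u)\<^sup>2 * (i - 1 / \<mu>\<^sup>2)\<^sup>2 \<le> (q / u)\<^sup>2 * (10 * \<bar>\<Delta> \<omega>\<bar> / \<mu> ^ 3)\<^sup>2"
      by (intro mult_left_mono) auto
    then show ?thesis
      by (simp add: y1_def power_mult_distrib power_divide mult.left_commute flip: power_mult)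
  qed
  moreover have i2: "i\<^sup>2 \<le> 16 / \<mu> ^ 4"
  proof -
    have "i\<^sup>2 \<le> (4 / \<mu>\<^sup>2)\<^sup>2" using inv(2) by (intro power_mono) (auto simp: i_def)
    then show ?thesis by (simp add: power_divide flip: power_mult)
  qed
  have "y2\<^sup>2 \<le> 16 / (u\<^sup>2 * \<mu> ^ 4) * (lin \<omega>)\<^sup>2"
    using mult_left_mono[OF i2, of "(lin \<omega> / u)\<^sup>2"]
    by (simp add: y2_def power_mult_distrib power_divide mult_ac)
  moreover have "y3\<^sup>2 \<le> 16 / (u\<^sup>2 * \<mu> ^ 4) * (rest \<omega>)\<^sup>2"
    using mult_left_mono[OF i2, of "(rest \<omega> / u)\<^sup>2"]
    by (simp add: y3_def power_mult_distrib power_divide mult_ac)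
  ultimately show ?thesis using True by (simp add: upper_def power_mult_distrib)
next
  case False
  have "(T \<omega> - centre)\<^sup>2 \<le> 2 * (T \<omega>)\<^sup>2 + 2 * centre\<^sup>2"
  proof -
    have "0 \<le> (T \<omega> + centre)\<^sup>2" by simp
    then show ?thesis by (simp add: power2_eq_square algebra_simps)
  qed
  moreover have "(T \<omega>)\<^sup>2 \<le> (256 * real n ^ 6)\<^sup>2"
    using power_mono[OF T_abs_le[OF \<omega>], of 2] by simp
  ultimately have "(T \<omega> - centre)\<^sup>2 \<le> 0 + 0 + 0 + (2 * (256 * real n ^ 6)\<^sup>2 + 2 * centre\<^sup>2) * 1" by simp
  also have "\<dots> \<le> upper \<omega>"
    unfolding upper_def
    using False \<mu>_pos by (intro add_mono) auto
  finally show ?thesis .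
qed

text \<open>The variance is at most the mean square distance from any constant, here from the signal term with
  denominator \<open>\<mu>\<^sup>2\<close>. The noise contributes \<open>1 + n\<^sup>2 x\<^sup>3\<close>; the fluctuating denominator multiplies the
  squared signal by the relative variance of the density estimate and contributes \<open>n\<^sup>2 x\<^sup>4 / a\<close>.\<close>
lemma variance_T_le:
  assumes \<epsilon>_le: "real n ^ 12 * \<epsilon> \<le> 1"
  shows "variance T \<le> 2 ^ 35 * D ^ 8 * (1 + real n ^ 2 * x ^ 3 + real n ^ 2 * x ^ 4 / a)"
proof -
  have n0: "real n > 0" using n_ge by simp
  have w0: "w > 0" using w_ge by simp
  have \<epsilon>0: "\<epsilon> > 0" by (simp add: \<epsilon>_def)
  have i4: "1 / (u\<^sup>2 * \<mu> ^ 4) \<le> 4 / (real n ^ 4 * a ^ 4)"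
  proof -
    have "(2 * real n ^ 2)\<^sup>2 * (a / 2) ^ 4 \<le> u\<^sup>2 * \<mu> ^ 4"
      using u_ge \<mu>_ge a_pos u_pos by (intro mult_mono power_mono) auto
    then have "1 / (u\<^sup>2 * \<mu> ^ 4) \<le> 1 / ((2 * real n ^ 2)\<^sup>2 * (a / 2) ^ 4)"
      using n0 a_pos u_pos \<mu>_pos by (intro divide_left_mono) auto
    then show ?thesis by (simp add: power_divide power_mult_distrib mult.commute flip: power_mult)
  qed
  have i6: "1 / (u\<^sup>2 * \<mu> ^ 6) \<le> 16 / (real n ^ 4 * a ^ 6)"
  proof -
    have "(2 * real n ^ 2)\<^sup>2 * (a / 2) ^ 6 \<le> u\<^sup>2 * \<mu> ^ 6"
      using u_ge \<mu>_ge a_pos u_pos by (intro mult_mono power_mono) auto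
    then have "1 / (u\<^sup>2 * \<mu> ^ 6) \<le> 1 / ((2 * real n ^ 2)\<^sup>2 * (a / 2) ^ 6)"
      using n0 a_pos u_pos \<mu>_pos by (intro divide_left_mono) auto
    then show ?thesis by (simp add: power_divide power_mult_distrib mult.commute flip: power_mult)
  qed
  have q2: "q\<^sup>2 \<le> real n ^ 8 * (a ^ 4 * x ^ 4)"
  proof -
    have "q\<^sup>2 \<le> (real n ^ 4 * b ^ 4)\<^sup>2" using q_abs_le power_mono[of "\<bar>q\<bar>" _ 2] by simp
    then show ?thesis using b_power[of 4] by (simp add: power_mult_distrib flip: power_mult)
  qed
  have bI: "bounded_rv (\<lambda>\<omega>. 1 - indicator G \<omega>)" by auto
  have bGr: "bounded_rv (\<lambda>\<omega>. (indicator G \<omega> * rest \<omega>)\<^sup>2)" using bounded_rest by auto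
  note ints = bounded_rv_integrable[OF bounded_rv_power[OF bounded_lin, of 2]] bounded_rv_integrable[OF bI]
    bounded_rv_integrable[OF bounded_rv_power[OF bounded_\<Delta>, of 2]] bounded_rv_integrable[OF bGr]
    bounded_rv_integrable[OF bounded_rv_indicator[OF G_event]]
  have bU: "bounded_rv upper"
    unfolding upper_def[abs_def] using bounded_lin bounded_\<Delta> bounded_rest by auto
  have bT: "bounded_rv (\<lambda>\<omega>. (T \<omega> - centre)\<^sup>2)" using bounded_T by auto
  have "variance T \<le> expectation (\<lambda>\<omega>. (T \<omega> - centre)\<^sup>2)"
  proof -
    have iT: "integrable M T" "integrable M (\<lambda>\<omega>. (T \<omega>)\<^sup>2)"
      using bounded_T by (auto intro!: bounded_rv_integrable)
    have "expectation (\<lambda>\<omega>. (T \<omega> - centre)\<^sup>2) = expectation (\<lambda>\<omega>. (T \<omega>)\<^sup>2) - 2 * centre * expectation T + centre\<^sup>2"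
      using iT by (simp add: power2_diff prob_space mult_ac)
    moreover have "variance T = expectation (\<lambda>\<omega>. (T \<omega>)\<^sup>2) - (expectation T)\<^sup>2"
      using iT by (rule variance_eq)
    moreover have "0 \<le> (expectation T)\<^sup>2 - 2 * centre * expectation T + centre\<^sup>2"
      using zero_le_power2[of "expectation T - centre"] by (simp add: power2_diff mult_ac)
    ultimately show ?thesis by linarith
  qed
  also have "\<dots> \<le> expectation upper"
    by (intro integral_mono T_deviation_le_upper bounded_rv_integrable bT bU)
  also have "\<dots> = 300 * q\<^sup>2 / (u\<^sup>2 * \<mu> ^ 6) * mean_square \<Delta>
      + 48 / (u\<^sup>2 * \<mu> ^ 4) * mean_square lin
      + 48 / (u\<^sup>2 * \<mu> ^ 4) * mean_square (\<lambda>\<omega>. indicator G \<omega> * rest \<omega>)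
      + (2 * (256 * real n ^ 6)\<^sup>2 + 2 * centre\<^sup>2) * (1 - prob G)"
    unfolding upper_def[abs_def] using ints by (simp add: prob_space)
  also have "\<dots> \<le> 2 ^ 17 * D ^ 8 * (real n ^ 2 * x ^ 4 / a)
      + 2 ^ 32 * D ^ 8 * (1 + real n ^ 2 * x ^ 3) + 2 ^ 32 * D ^ 8 * (2 + real n ^ 2 * x ^ 3)
      + 2 ^ 20 * D ^ 8"
  proof (intro add_mono)
    have D18: "D \<le> D ^ 8" using D_power_le[of 1 8] by simp
    have "300 * q\<^sup>2 / (u\<^sup>2 * \<mu> ^ 6) * mean_square \<Delta>
        = 300 * (q\<^sup>2 * (1 / (u\<^sup>2 * \<mu> ^ 6)) * mean_square \<Delta>)" by simp
    also have "\<dots> \<le> 300 * (real n ^ 8 * (a ^ 4 * x ^ 4) * (16 / (real n ^ 4 * a ^ 6)) * (16 * D * a / real n ^ 2))"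
      using q2 i6 expectation_\<Delta>_square a_pos x_nonneg u_pos \<mu>_pos
      by (intro mult_left_mono mult_mono) auto
    also have "\<dots> = 76800 * D * (real n ^ 2 * x ^ 4 / a)"
      using n0 a_pos by (simp add: field_simps eval_nat_numeral)
    also have "\<dots> \<le> 2 ^ 17 * D ^ 8 * (real n ^ 2 * x ^ 4 / a)"
      using D18 D_ge a_pos by (intro mult_right_mono mult_mono) auto
    finally show "300 * q\<^sup>2 / (u\<^sup>2 * \<mu> ^ 6) * mean_square \<Delta> \<le> 2 ^ 17 * D ^ 8 * (real n ^ 2 * x ^ 4 / a)" .
  next
    have "48 / (u\<^sup>2 * \<mu> ^ 4) * mean_square lin = 48 * ((1 / (u\<^sup>2 * \<mu> ^ 4)) * mean_square lin)" by simp
    also have "\<dots> \<le> 48 * (4 / (real n ^ 4 * a ^ 4) * (2 ^ 24 * D ^ 8 * a ^ 4 * real n ^ 4 * (1 + real n ^ 2 * x ^ 3)))"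
      using i4 lin_second_moment n0 a_pos by (intro mult_left_mono mult_mono) auto
    also have "\<dots> = 192 * 2 ^ 24 * D ^ 8 * (1 + real n ^ 2 * x ^ 3)"
      using n0 a_pos by (simp add: field_simps)
    also have "\<dots> \<le> 2 ^ 32 * D ^ 8 * (1 + real n ^ 2 * x ^ 3)"
      using D_ge x_nonneg by (intro mult_right_mono) auto
    finally show "48 / (u\<^sup>2 * \<mu> ^ 4) * mean_square lin \<le> 2 ^ 32 * D ^ 8 * (1 + real n ^ 2 * x ^ 3)" .
  next
    have "48 / (u\<^sup>2 * \<mu> ^ 4) * mean_square (\<lambda>\<omega>. indicator G \<omega> * rest \<omega>)
        = 48 * ((1 / (u\<^sup>2 * \<mu> ^ 4)) * mean_square (\<lambda>\<omega>. indicator G \<omega> * rest \<omega>))" by simp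
    also have "\<dots> \<le> 48 * (4 / (real n ^ 4 * a ^ 4) * (2 ^ 24 * D ^ 8 * a ^ 4 * real n ^ 4 * (real n * x\<^sup>2 + 1 / w)))"
      using i4 rest_second_moment n0 a_pos by (intro mult_left_mono mult_mono) auto
    also have "\<dots> = 192 * 2 ^ 24 * D ^ 8 * (real n * x\<^sup>2 + 1 / w)"
      using n0 a_pos by (simp add: field_simps)
    also have "\<dots> \<le> 2 ^ 32 * D ^ 8 * (2 + real n ^ 2 * x ^ 3)"
    proof -
      have "1 / w \<le> 1" using w_ge by simp
      then have "real n * x\<^sup>2 + 1 / w \<le> 2 + real n ^ 2 * x ^ 3" using nx2_le by linarith
      then show ?thesis using D_ge w0 by (intro mult_mono) auto
    qed
    finally show "48 / (u\<^sup>2 * \<mu> ^ 4) * mean_square (\<lambda>\<omega>. indicator G \<omega> * rest \<omega>) \<le> 2 ^ 32 * D ^ 8 * (2 + real n ^ 2 * x ^ 3)" .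
  next
    have "centre\<^sup>2 = q\<^sup>2 * (1 / (u\<^sup>2 * \<mu> ^ 4))"
      by (simp add: centre_def power_mult_distrib power_divide flip: power_mult)
    also have "\<dots> \<le> real n ^ 8 * (a ^ 4 * x ^ 4) * (4 / (real n ^ 4 * a ^ 4))"
      using q2 i4 u_pos \<mu>_pos a_pos x_nonneg by (intro mult_mono) auto
    also have "\<dots> = 4 * real n ^ 4 * x ^ 4"
      using n0 a_pos by (simp add: field_simps eval_nat_numeral)
    also have "\<dots> \<le> 4 * real n ^ 12 * (D\<^sup>2) ^ 4"
      using x_le x_nonneg n_ge by (intro mult_mono power_mono power_increasing) auto
    finally have m2: "centre\<^sup>2 \<le> 4 * real n ^ 12 * D ^ 8" by (simp flip: power_mult)
    have "1 \<le> D ^ 8" using D_power_le[of 0 8] by simp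
    then have "real n ^ 12 * 1 \<le> real n ^ 12 * D ^ 8" by (intro mult_left_mono) auto
    moreover have "(256 * real n ^ 6)\<^sup>2 = 65536 * (real n ^ 12 * 1)"
      by (simp add: power_mult_distrib flip: power_mult)
    ultimately have "2 * (256 * real n ^ 6)\<^sup>2 + 2 * centre\<^sup>2 \<le> 262144 * (real n ^ 12 * D ^ 8)"
      using m2 zero_le_power2[of centre] unfolding mult.assoc[of 4] by linarith
    then have "2 * (256 * real n ^ 6)\<^sup>2 + 2 * centre\<^sup>2 \<le> 2 ^ 18 * real n ^ 12 * D ^ 8" by simp
    then have "(2 * (256 * real n ^ 6)\<^sup>2 + 2 * centre\<^sup>2) * (1 - prob G) \<le> (2 ^ 18 * real n ^ 12 * D ^ 8) * (2 * \<epsilon>)"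
      using prob_not_G by (intro mult_mono) (auto simp: prob_compl)
    also have "\<dots> = 2 ^ 19 * D ^ 8 * (real n ^ 12 * \<epsilon>)" by simp
    also have "\<dots> \<le> 2 ^ 20 * D ^ 8 * 1" using \<epsilon>_le \<epsilon>0 D_ge by (intro mult_mono) auto
    finally show "(2 * (256 * real n ^ 6)\<^sup>2 + 2 * centre\<^sup>2) * (1 - prob G) \<le> 2 ^ 20 * D ^ 8" by simp
  qed
  also have "\<dots> \<le> 2 ^ 35 * D ^ 8 * (1 + real n ^ 2 * x ^ 3 + real n ^ 2 * x ^ 4 / a)"
  proof -
    define c where "c = D ^ 8"
    define g where "g = real n ^ 2 * x ^ 4 / a"
    define h where "h = real n ^ 2 * x ^ 3"
    have "c * g \<ge> 0" "c * h \<ge> 0" "c \<ge> 0"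
      using D_ge x_nonneg a_pos by (auto simp: c_def g_def h_def)
    then have "2 ^ 17 * c * g + 2 ^ 32 * c * (1 + h) + 2 ^ 32 * c * (2 + h) + 2 ^ 20 * c \<le> 2 ^ 35 * c * (1 + h + g)"
      by (simp add: algebra_simps)
    then show ?thesis unfolding c_def g_def h_def .
  qed
  finally show ?thesis .
qed

end

section \<open>The trace of the fourth power of the signal matrix\<close>

text \<open>For a symmetric matrix \<open>B\<close> the left-hand side is the square of \<open>v' B\<^sup>2 v\<close>, so this is Cauchy--Schwarz for
  the entries of \<open>v v'\<close> and \<open>B\<^sup>2\<close>. It bounds the trace of \<open>B\<^sup>4\<close> from below by a test vector.\<close>
lemma quadratic_form_square_le:
  fixes B :: "nat \<Rightarrow> nat \<Rightarrow> real"
  assumes sym: "\<And>i j. i < n \<Longrightarrow> j < n \<Longrightarrow> B i j = B j i"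
  shows "(\<Sum>i<n. (\<Sum>j<n. B i j * v j)\<^sup>2)\<^sup>2
    \<le> (\<Sum>i<n. (v i)\<^sup>2)\<^sup>2 * (\<Sum>i<n. \<Sum>j<n. (\<Sum>m<n. B i m * B m j)\<^sup>2)"
proof -
  let ?M = "\<lambda>i j. \<Sum>m<n. B i m * B m j"
  have "(\<Sum>i<n. (\<Sum>j<n. B i j * v j)\<^sup>2) = (\<Sum>i<n. \<Sum>j<n. \<Sum>j'<n. (v j * v j') * (B j i * B i j'))"
    using sym by (auto simp: power2_eq_square sum_product mult_ac intro!: sum.cong)
  also have "\<dots> = (\<Sum>j<n. \<Sum>j'<n. (v j * v j') * ?M j j')"
    by (subst sum.swap, rule sum.cong, simp, subst sum.swap) (simp add: sum_distrib_left)
  also have "\<dots> = (\<Sum>(j, j')\<in>{..<n} \<times> {..<n}. (v j * v j') * ?M j j')"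
    by (rule sum.cartesian_product)
  finally have "(\<Sum>i<n. (\<Sum>j<n. B i j * v j)\<^sup>2)\<^sup>2 =
      (\<Sum>p\<in>{..<n} \<times> {..<n}. (v (fst p) * v (snd p)) * ?M (fst p) (snd p))\<^sup>2"
    by (simp add: case_prod_beta)
  also have "\<dots> \<le> (\<Sum>p\<in>{..<n} \<times> {..<n}. (v (fst p) * v (snd p))\<^sup>2) *
      (\<Sum>p\<in>{..<n} \<times> {..<n}. (?M (fst p) (snd p))\<^sup>2)"
    by (rule Cauchy_Schwarz_ineq_sum)
  also have "(\<Sum>p\<in>{..<n} \<times> {..<n}. (v (fst p) * v (snd p))\<^sup>2) = (\<Sum>i<n. (v i)\<^sup>2)\<^sup>2"
    unfolding power2_eq_square[of "sum _ _"] sum_product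
    by (simp add: sum.cartesian_product case_prod_beta power_mult_distrib)
  also have "(\<Sum>p\<in>{..<n} \<times> {..<n}. (?M (fst p) (snd p))\<^sup>2) = (\<Sum>i<n. \<Sum>j<n. (?M i j)\<^sup>2)"
    by (simp add: sum.cartesian_product case_prod_beta)
  finally show ?thesis .
qed

text \<open>\<open>H\<close> is the inverse of the Gram matrix of the membership vectors, with its norm bound stated for the
  quadratic form.\<close>
locale weighted_memberships =
  fixes n K :: nat and \<pi> :: "nat \<Rightarrow> nat \<Rightarrow> real" and H :: "nat \<Rightarrow> nat \<Rightarrow> real" and C :: real
  assumes n_pos: "n > 0" and C_pos: "C > 0"
    and right_inverse: "\<And>k m. k < K \<Longrightarrow> m < K \<Longrightarrow>
      (\<Sum>l<K. (\<Sum>i<n. \<pi> i k * \<pi> i l) / real n * H l m) = of_bool (k = m)"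
    and H_form: "\<And>y. (\<Sum>k<K. y k * (\<Sum>l<K. H k l * y l)) \<le> C * (\<Sum>k<K. (y k)\<^sup>2)"
begin

definition lift :: "(nat \<Rightarrow> real) \<Rightarrow> nat \<Rightarrow> real" where
  "lift z i = (\<Sum>k<K. \<pi> i k * z k)"

lemma sum_lift: "(\<Sum>i<n. \<pi> i m * lift z i) = real n * (\<Sum>l<K. (\<Sum>i<n. \<pi> i m * \<pi> i l) / real n * z l)"
proof -
  have "(\<Sum>i<n. \<pi> i m * lift z i) = (\<Sum>i<n. \<Sum>l<K. \<pi> i m * \<pi> i l * z l)"
    by (simp add: lift_def sum_distrib_left mult_ac)
  also have "\<dots> = (\<Sum>l<K. \<Sum>i<n. \<pi> i m * \<pi> i l * z l)" by (rule sum.swap)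
  also have "\<dots> = (\<Sum>l<K. real n * ((\<Sum>i<n. \<pi> i m * \<pi> i l) / real n * z l))"
    using n_pos by (simp add: sum_distrib_right)
  finally show ?thesis by (simp add: sum_distrib_left)
qed

lemma sum_lift_lift: "(\<Sum>i<n. lift y i * f i) = (\<Sum>k<K. y k * (\<Sum>i<n. \<pi> i k * f i))"
proof -
  have "(\<Sum>i<n. lift y i * f i) = (\<Sum>i<n. \<Sum>k<K. y k * (\<pi> i k * f i))"
    unfolding lift_def sum_distrib_right by (intro sum.cong refl) (simp only: mult_ac)
  also have "\<dots> = (\<Sum>k<K. \<Sum>i<n. y k * (\<pi> i k * f i))" by (rule sum.swap)
  finally show ?thesis by (simp add: sum_distrib_left)
qed

lemma sum_lift_H:
  assumes "k < K"
  shows "(\<Sum>i<n. \<pi> i k * lift (\<lambda>l. \<Sum>m<K. H l m * y m) i) = real n * y k"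
proof -
  have "(\<Sum>l<K. (\<Sum>i<n. \<pi> i k * \<pi> i l) / real n * (\<Sum>m<K. H l m * y m)) =
      (\<Sum>l<K. \<Sum>m<K. ((\<Sum>i<n. \<pi> i k * \<pi> i l) / real n * H l m) * y m)"
    unfolding sum_distrib_left by (simp only: mult.assoc)
  also have "\<dots> = (\<Sum>m<K. \<Sum>l<K. ((\<Sum>i<n. \<pi> i k * \<pi> i l) / real n * H l m) * y m)" by (rule sum.swap)
  also have "\<dots> = (\<Sum>m<K. (\<Sum>l<K. (\<Sum>i<n. \<pi> i k * \<pi> i l) / real n * H l m) * y m)"
    by (simp add: sum_distrib_right)
  also have "\<dots> = (\<Sum>m<K. of_bool (k = m) * y m)"
    using right_inverse assms by (intro sum.cong) auto
  also have "\<dots> = y k" using assms by (simp add: of_bool_def if_distrib[of "\<lambda>c. c * _"] sum.delta cong: if_cong)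
  finally show ?thesis unfolding sum_lift by simp
qed

text \<open>The least eigenvalue of the Gram matrix is at least \<open>1 / C\<close>. Since \<open>y\<close> is the Gram matrix applied to
  \<open>H y\<close>, the squared norm of \<open>y\<close> is, up to the factor \<open>n\<close>, an inner product of the lifts of \<open>y\<close> and \<open>H y\<close>, and the square of the
  latter is again a quadratic form in \<open>H\<close>.\<close>
lemma lift_norm_ge: "real n * (\<Sum>k<K. (y k)\<^sup>2) \<le> C * (\<Sum>i<n. (lift y i)\<^sup>2)"
proof -
  define s where "s = (\<Sum>k<K. (y k)\<^sup>2)"
  define L where "L = (\<Sum>i<n. (lift y i)\<^sup>2)"
  define z where "z k = (\<Sum>l<K. H k l * y l)" for k
  have "(\<Sum>i<n. lift y i * lift z i) = (\<Sum>k<K. y k * (real n * y k))"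
    unfolding sum_lift_lift z_def[abs_def] by (intro sum.cong) (auto simp: sum_lift_H)
  also have "\<dots> = real n * s" by (simp add: s_def sum_distrib_left power2_eq_square mult_ac)
  finally have 1: "(\<Sum>i<n. lift y i * lift z i) = real n * s" .
  have "(\<Sum>i<n. (lift z i)\<^sup>2) = (\<Sum>i<n. lift z i * lift z i)" by (simp add: power2_eq_square)
  also have "\<dots> = (\<Sum>k<K. z k * (real n * y k))"
    unfolding sum_lift_lift by (intro sum.cong) (auto simp: sum_lift_H z_def[abs_def])
  also have "\<dots> = real n * (\<Sum>k<K. y k * (\<Sum>l<K. H k l * y l))"
    by (simp add: z_def sum_distrib_left mult_ac)
  also have "\<dots> \<le> real n * (C * s)" unfolding s_def by (intro mult_left_mono H_form) auto
  finally have 2: "(\<Sum>i<n. (lift z i)\<^sup>2) \<le> real n * (C * s)" .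
  have L0: "L \<ge> 0" by (simp add: L_def sum_nonneg)
  have "(real n * s)\<^sup>2 \<le> L * (\<Sum>i<n. (lift z i)\<^sup>2)"
    unfolding 1[symmetric] L_def by (rule Cauchy_Schwarz_ineq_sum)
  also have "\<dots> \<le> L * (real n * (C * s))" using 2 L0 by (intro mult_left_mono)
  also have "\<dots> = (C * L) * (real n * s)" by (simp only: mult_ac)
  finally have 3: "(real n * s) * (real n * s) \<le> (C * L) * (real n * s)"
    unfolding power2_eq_square .
  have "real n * s \<le> C * L"
  proof (cases "s = 0")
    case False
    moreover have "s \<ge> 0" unfolding s_def by (rule sum_nonneg) simp
    ultimately have "s > 0" by linarith
    then have "real n * s > 0" using n_pos by simp
    then show ?thesis by (rule mult_right_le_imp_le[OF 3])
  qed (use L0 C_pos in simp)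
  then show ?thesis by (simp add: s_def L_def)
qed

text \<open>The right-hand side contains the trace of \<open>B\<^sup>4\<close> for \<open>B = \<Pi> t \<Pi>'\<close>. The test vector is the lift of the column \<open>l\<close>
  of \<open>H\<close>: the Gram matrix cancels \<open>H\<close>, so \<open>B\<close> maps it to \<open>n\<close> times the lift of the column \<open>l\<close> of
  \<open>t\<close>, whose length is controlled from below.\<close>
lemma frobenius_square_ge:
  fixes t :: "nat \<Rightarrow> nat \<Rightarrow> real"
  assumes sym: "\<And>k l. k < K \<Longrightarrow> l < K \<Longrightarrow> t k l = t l k"
    and B: "\<And>i j. i < n \<Longrightarrow> j < n \<Longrightarrow> B i j = (\<Sum>k<K. \<Sum>l<K. \<pi> i k * t k l * \<pi> j l)"
    and k: "k < K" and l: "l < K"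
  shows "real n ^ 4 * t k l ^ 4 \<le> C ^ 4 * (\<Sum>i<n. \<Sum>j<n. (\<Sum>m<n. B i m * B m j)\<^sup>2)"
proof -
  let ?F = "\<Sum>i<n. \<Sum>j<n. (\<Sum>m<n. B i m * B m j)\<^sup>2"
  define e :: "nat \<Rightarrow> real" where "e m = of_bool (m = l)" for m
  \<comment> \<open>\<open>z\<close> is the column \<open>l\<close> of \<open>H\<close>, and its lift is the test vector.\<close>
  define z where "z k = (\<Sum>m<K. H k m * e m)" for k
  define y where "y k = t k l" for k
  define s where "s = (\<Sum>k<K. (y k)\<^sup>2)"
  have delta: "(\<Sum>m<K. f m * e m) = f l" "(\<Sum>m<K. e m * f m) = f l" for f
    using l by (simp_all add: e_def of_bool_def if_distrib[of "\<lambda>c. _ * c"] if_distrib[of "\<lambda>c. c * _"] sum.delta cong: if_cong)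
  have Bsym: "B i j = B j i" if "i < n" "j < n" for i j
  proof -
    have "B i j = (\<Sum>l<K. \<Sum>k<K. \<pi> i k * t k l * \<pi> j l)" unfolding B[OF that] by (rule sum.swap)
    also have "\<dots> = B j i" unfolding B[OF that(2,1)] using sym by (intro sum.cong) (auto simp: mult_ac)
    finally show ?thesis .
  qed
  have v2: "(\<Sum>i<n. (lift z i)\<^sup>2) = real n * z l"
  proof -
    have "(\<Sum>i<n. (lift z i)\<^sup>2) = (\<Sum>k<K. z k * (\<Sum>i<n. \<pi> i k * lift z i))"
      by (simp add: power2_eq_square sum_lift_lift)
    also have "\<dots> = (\<Sum>k<K. (real n * z k) * e k)"
      by (intro sum.cong) (auto simp: sum_lift_H z_def[abs_def])
    finally show ?thesis by (simp only: delta)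
  qed
  have "z l \<le> C"
  proof -
    have "(\<Sum>k<K. (e k)\<^sup>2) = 1" using delta(1)[of e] by (simp add: power2_eq_square e_def)
    then have "(\<Sum>k<K. e k * z k) \<le> C" using H_form[of e] by (simp add: z_def)
    then show ?thesis by (simp only: delta)
  qed
  moreover have "z l \<ge> 0"
  proof -
    have "0 \<le> real n * z l" unfolding v2[symmetric] by (rule sum_nonneg) simp
    then show ?thesis using n_pos by (simp add: zero_le_mult_iff)
  qed
  ultimately have nz: "(real n * z l)\<^sup>2 \<le> (real n * C)\<^sup>2" by (intro power_mono mult_left_mono) auto
  have Bv: "(\<Sum>j<n. B i j * lift z j) = real n * lift y i" if i: "i < n" for i
  proof -
    have "(\<Sum>j<n. B i j * lift z j) = (\<Sum>j<n. \<Sum>k<K. \<Sum>m<K. \<pi> i k * t k m * (\<pi> j m * lift z j))"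
    proof (rule sum.cong)
      fix j assume "j \<in> {..<n}"
      then have j: "j < n" by simp
      show "B i j * lift z j = (\<Sum>k<K. \<Sum>m<K. \<pi> i k * t k m * (\<pi> j m * lift z j))"
        unfolding B[OF i j] sum_distrib_right by (intro sum.cong refl) (simp only: mult_ac)
    qed simp
    also have "\<dots> = (\<Sum>k<K. \<Sum>m<K. \<Sum>j<n. \<pi> i k * t k m * (\<pi> j m * lift z j))"
      by (subst sum.swap, rule sum.cong, simp, subst sum.swap) simp
    also have "\<dots> = (\<Sum>k<K. \<Sum>m<K. \<pi> i k * t k m * (real n * e m))"
      by (intro sum.cong) (auto simp: sum_lift_H z_def[abs_def] simp flip: sum_distrib_left)
    also have "\<dots> = (\<Sum>k<K. \<Sum>m<K. (real n * (\<pi> i k * t k m)) * e m)" by (simp add: mult_ac)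
    also have "\<dots> = (\<Sum>k<K. real n * (\<pi> i k * t k l))" by (simp only: delta)
    finally show ?thesis by (simp add: lift_def y_def sum_distrib_left)
  qed
  have L0: "(\<Sum>i<n. (lift y i)\<^sup>2) \<ge> 0" by (simp add: sum_nonneg)
  have "real n * real n * (\<Sum>i<n. (lift y i)\<^sup>2) = (\<Sum>i<n. (\<Sum>j<n. B i j * lift z j)\<^sup>2)"
    by (simp add: Bv power_mult_distrib power2_eq_square[of "real n"] sum_distrib_left)
  then have "(real n * real n * (\<Sum>i<n. (lift y i)\<^sup>2))\<^sup>2 = (\<Sum>i<n. (\<Sum>j<n. B i j * lift z j)\<^sup>2)\<^sup>2"
    by simp
  also have "\<dots> \<le> (\<Sum>i<n. (lift z i)\<^sup>2)\<^sup>2 * ?F" by (rule quadratic_form_square_le[OF Bsym])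
  also have "\<dots> \<le> (real n * C)\<^sup>2 * ?F"
    unfolding v2 using nz by (intro mult_right_mono) (auto intro!: sum_nonneg)
  finally have 1: "(real n * real n * (\<Sum>i<n. (lift y i)\<^sup>2))\<^sup>2 \<le> (real n * C)\<^sup>2 * ?F" .
  have "(t k l)\<^sup>2 \<le> s" unfolding s_def y_def using k by (intro member_le_sum) auto
  then have "real n * (t k l)\<^sup>2 \<le> real n * s" by (intro mult_left_mono) auto
  also have "\<dots> \<le> C * (\<Sum>i<n. (lift y i)\<^sup>2)" unfolding s_def by (rule lift_norm_ge)
  finally have "real n * (t k l)\<^sup>2 \<le> C * (\<Sum>i<n. (lift y i)\<^sup>2)" .
  then have "(real n * real n * (real n * (t k l)\<^sup>2))\<^sup>2 \<le> (real n * real n * (C * (\<Sum>i<n. (lift y i)\<^sup>2)))\<^sup>2"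
    by (intro power_mono mult_left_mono) auto
  also have "\<dots> = C\<^sup>2 * (real n * real n * (\<Sum>i<n. (lift y i)\<^sup>2))\<^sup>2" by (simp add: power_mult_distrib mult_ac)
  also have "\<dots> \<le> C\<^sup>2 * ((real n * C)\<^sup>2 * ?F)" using 1 by (intro mult_left_mono) auto
  finally have "real n ^ 2 * (real n ^ 4 * t k l ^ 4) \<le> real n ^ 2 * (C ^ 4 * ?F)"
    by (simp add: power_mult_distrib mult_ac flip: power_mult power_add)
  then show ?thesis by (rule mult_left_le_imp_le) (use n_pos in simp)
qed

end

section \<open>The operator norm\<close>

lemma l2_norm_nonneg: "l2_norm v \<ge> 0"
  by (simp add: l2_norm_def L2_set_nonneg)

lemma l2_norm_square: "(l2_norm v)\<^sup>2 = (\<Sum>k<dim_vec v. (v $ k)\<^sup>2)"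
  by (simp add: l2_norm_def L2_set_def sum_nonneg)

definition frobenius :: "real mat \<Rightarrow> real" where
  "frobenius B = (\<Sum>i<dim_row B. \<Sum>j<dim_col B. (B $$ (i, j))\<^sup>2)"

lemma frobenius_nonneg: "frobenius B \<ge> 0"
  by (simp add: frobenius_def sum_nonneg)

lemma mult_mat_vec_index:
  assumes "i < dim_row B" "v \<in> carrier_vec (dim_col B)"
  shows "(B *\<^sub>v v) $ i = (\<Sum>j<dim_col B. B $$ (i, j) * v $ j)"
  using assms by (simp add: scalar_prod_def atLeast0LessThan)

lemma l2_norm_mult_square_le:
  assumes v: "v \<in> carrier_vec (dim_col B)"
  shows "(l2_norm (B *\<^sub>v v))\<^sup>2 \<le> frobenius B * (l2_norm v)\<^sup>2"
proof -
  have "(l2_norm (B *\<^sub>v v))\<^sup>2 = (\<Sum>i<dim_row B. (\<Sum>j<dim_col B. B $$ (i, j) * v $ j)\<^sup>2)"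
    using v by (simp add: l2_norm_square mult_mat_vec_index del: index_mult_mat_vec)
  also have "\<dots> \<le> (\<Sum>i<dim_row B. (\<Sum>j<dim_col B. (B $$ (i, j))\<^sup>2) * (\<Sum>j<dim_col B. (v $ j)\<^sup>2))"
    by (intro sum_mono Cauchy_Schwarz_ineq_sum)
  also have "\<dots> = frobenius B * (l2_norm v)\<^sup>2"
    using v by (simp add: frobenius_def l2_norm_square sum_distrib_right)
  finally show ?thesis .
qed

lemma l2_norm_ratio_le:
  assumes v: "v \<in> carrier_vec (dim_col B)"
  shows "l2_norm (B *\<^sub>v v) / l2_norm v \<le> sqrt (frobenius B)"
proof (cases "l2_norm v = 0")
  case False
  have "l2_norm (B *\<^sub>v v) \<le> sqrt (frobenius B * (l2_norm v)\<^sup>2)"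
    using l2_norm_mult_square_le[OF v] by (rule real_le_rsqrt)
  then show ?thesis
    using False l2_norm_nonneg[of v] by (simp add: real_sqrt_mult field_simps)
qed (simp add: frobenius_nonneg)

lemma op_norm_bdd: "bdd_above ((\<lambda>v. l2_norm (B *\<^sub>v v) / l2_norm v) ` carrier_vec (dim_col B))"
  using l2_norm_ratio_le by (intro bdd_aboveI2) auto

lemma op_norm_le_frobenius: "op_norm B \<le> sqrt (frobenius B)"
  unfolding op_norm_def
  by (rule cSUP_least) (use zero_carrier_vec l2_norm_ratio_le in blast)+

lemma op_norm_nonneg: "op_norm B \<ge> 0"
proof -
  have "0 \<le> l2_norm (B *\<^sub>v 0\<^sub>v (dim_col B)) / l2_norm (0\<^sub>v (dim_col B) :: real vec)"
    by (simp add: l2_norm_nonneg)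
  also have "\<dots> \<le> op_norm B"
    unfolding op_norm_def by (rule cSUP_upper[OF _ op_norm_bdd]) simp
  finally show ?thesis .
qed

lemma l2_norm_mult_le:
  assumes v: "v \<in> carrier_vec (dim_col B)"
  shows "l2_norm (B *\<^sub>v v) \<le> op_norm B * l2_norm v"
proof (cases "l2_norm v = 0")
  case True
  then have "(l2_norm (B *\<^sub>v v))\<^sup>2 \<le> 0" using l2_norm_mult_square_le[OF v] by simp
  then show ?thesis using True by simp
next
  case False
  have "l2_norm (B *\<^sub>v v) / l2_norm v \<le> op_norm B"
    unfolding op_norm_def by (rule cSUP_upper[OF v op_norm_bdd])
  then show ?thesis using False l2_norm_nonneg[of v] by (simp add: field_simps)
qed

lemma entry_le_op_norm:
  assumes i: "i < dim_row B" and j: "j < dim_col B"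
  shows "\<bar>B $$ (i, j)\<bar> \<le> op_norm B"
proof -
  let ?e = "unit_vec (dim_col B) j :: real vec"
  have e: "?e \<in> carrier_vec (dim_col B)" by simp
  have "(l2_norm ?e)\<^sup>2 = (\<Sum>k<dim_col B. if k = j then 1 else 0)"
    unfolding l2_norm_square using j by (intro sum.cong) auto
  then have "(l2_norm ?e)\<^sup>2 = 1" using j by simp
  then have e1: "l2_norm ?e = 1" using l2_norm_nonneg[of ?e] by (simp add: power2_eq_1_iff)
  have "(B *\<^sub>v ?e) $ i = B $$ (i, j)" using i j by simp
  then have "(B $$ (i, j))\<^sup>2 \<le> (l2_norm (B *\<^sub>v ?e))\<^sup>2"
    unfolding l2_norm_square using i by (intro order_trans[OF _ member_le_sum[of i]]) auto
  then have "\<bar>B $$ (i, j)\<bar> \<le> l2_norm (B *\<^sub>v ?e)"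
    using l2_norm_nonneg by (simp add: abs_le_square_iff[symmetric])
  then show ?thesis using l2_norm_mult_le[OF e] e1 by simp
qed

lemma quadratic_form_le_op_norm:
  assumes H: "H \<in> carrier_mat K K"
  shows "(\<Sum>k<K. y k * (\<Sum>l<K. H $$ (k, l) * y l)) \<le> op_norm H * (\<Sum>k<K. (y k)\<^sup>2)"
proof -
  define v where "v = vec K y"
  have v: "v \<in> carrier_vec (dim_col H)" using H by (simp add: v_def)
  have Hv: "dim_vec (H *\<^sub>v v) = K" using H by simp
  have v2: "(l2_norm v)\<^sup>2 = (\<Sum>k<K. (y k)\<^sup>2)" by (simp add: l2_norm_square v_def)
  have "(\<Sum>k<K. y k * (\<Sum>l<K. H $$ (k, l) * y l)) = (\<Sum>k<K. v $ k * (H *\<^sub>v v) $ k)"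
  proof (rule sum.cong)
    fix k assume k: "k \<in> {..<K}"
    then have "(H *\<^sub>v v) $ k = (\<Sum>l<K. H $$ (k, l) * v $ l)"
      using mult_mat_vec_index[OF _ v] H by auto
    then show "y k * (\<Sum>l<K. H $$ (k, l) * y l) = v $ k * (H *\<^sub>v v) $ k"
      using k by (simp add: v_def)
  qed simp
  also have "\<dots> \<le> \<bar>\<dots>\<bar>" by simp
  also have "\<dots> \<le> sqrt ((l2_norm v)\<^sup>2 * (l2_norm (H *\<^sub>v v))\<^sup>2)"
    unfolding l2_norm_square[of v] l2_norm_square[of "H *\<^sub>v v"] Hv
    using Cauchy_Schwarz_ineq_sum[of "\<lambda>k. v $ k" "\<lambda>k. (H *\<^sub>v v) $ k" "{..<K}"]
    by (intro real_le_rsqrt) (simp add: v_def)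
  also have "\<dots> = l2_norm v * l2_norm (H *\<^sub>v v)" by (simp add: real_sqrt_mult l2_norm_nonneg)
  also have "\<dots> \<le> l2_norm v * (op_norm H * l2_norm v)"
    using l2_norm_mult_le[OF v] l2_norm_nonneg by (intro mult_left_mono) auto
  also have "\<dots> = op_norm H * (\<Sum>k<K. (y k)\<^sup>2)" unfolding v2[symmetric] by (simp add: power2_eq_square)
  finally show ?thesis .
qed

section \<open>Deterministic consequences of the model assumptions\<close>

lemma card_degenerate_quads_le:
  "card ({..<n} \<times> {..<n} \<times> {..<n} \<times> {..<n} - quads n) \<le> 6 * n ^ 3"
proof -
  let ?cube = "{..<n} \<times> {..<n} \<times> {..<n}"
  let ?fs = "[\<lambda>(i :: nat, j :: nat, k :: nat). (i, i, j, k), \<lambda>(i, j, k). (i, j, i, k), \<lambda>(i, j, k). (i, j, k, i),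
    \<lambda>(i, j, k). (j, i, i, k), \<lambda>(i, j, k). (j, i, k, i), \<lambda>(i, j, k). (j, k, i, i)]"
  have "{..<n} \<times> {..<n} \<times> {..<n} \<times> {..<n} - quads n \<subseteq> (\<Union>f\<in>set ?fs. f ` ?cube)"
    by (auto simp: quads_def image_iff)
  then have "card ({..<n} \<times> {..<n} \<times> {..<n} \<times> {..<n} - quads n) \<le> card (\<Union>f\<in>set ?fs. f ` ?cube)"
    by (intro card_mono) auto
  also have "\<dots> \<le> (\<Sum>f\<in>set ?fs. card (f ` ?cube))" by (rule card_UN_le) simp
  also have "\<dots> \<le> (\<Sum>f\<in>set ?fs. n ^ 3)"
  proof (rule sum_mono)
    fix f :: "nat \<times> nat \<times> nat \<Rightarrow> nat \<times> nat \<times> nat \<times> nat"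
    have "card (f ` ?cube) \<le> card ?cube" by (rule card_image_le) auto
    then show "card (f ` ?cube) \<le> n ^ 3" by (simp add: card_cartesian_product eval_nat_numeral)
  qed
  also have "\<dots> \<le> 6 * n ^ 3"
  proof -
    have "card (set ?fs) \<le> length ?fs" by (rule card_length)
    then show ?thesis by (simp only: sum_constant of_nat_id) (intro mult_right_mono; simp)
  qed
  finally show ?thesis .
qed

text \<open>Telescoping over the four factors; the constant is \<open>8 + 4 + 2 + 1\<close>.\<close>
lemma prod4_perturbation:
  fixes y z :: "nat \<Rightarrow> real"
  assumes y: "\<And>m. m < 4 \<Longrightarrow> \<bar>y m\<bar> \<le> \<beta>" and z: "\<And>m. m < 4 \<Longrightarrow> \<bar>z m\<bar> \<le> 2 * \<beta>"
    and d: "\<And>m. m < 4 \<Longrightarrow> \<bar>z m - y m\<bar> \<le> \<delta>"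
  shows "\<bar>(\<Prod>m<4. z m) - (\<Prod>m<4. y m)\<bar> \<le> 15 * \<beta> ^ 3 * \<delta>"
proof -
  have triangle: "\<bar>a + b + c + d\<bar> \<le> \<bar>a\<bar> + \<bar>b\<bar> + \<bar>c\<bar> + \<bar>d\<bar>" for a b c d :: real
    by linarith
  have four_factors: "\<bar>a * b * c * d\<bar> \<le> A * B * C * D"
    if "\<bar>a\<bar> \<le> A" "\<bar>b\<bar> \<le> B" "\<bar>c\<bar> \<le> C" "\<bar>d\<bar> \<le> D" for a b c d A B C D :: real
    unfolding abs_mult
    by (intro mult_mono mult_nonneg_nonneg that abs_ge_zero
        order_trans[OF abs_ge_zero that(1)] order_trans[OF abs_ge_zero that(2)]
        order_trans[OF abs_ge_zero that(3)])
  have telescope: "(\<Prod>m<4. z m) - (\<Prod>m<4. y m) = (z 0 - y 0) * z 1 * z 2 * z 3 + y 0 * (z 1 - y 1) * z 2 * z 3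
      + y 0 * y 1 * (z 2 - y 2) * z 3 + y 0 * y 1 * y 2 * (z 3 - y 3)"
    by (simp add: lessThan_4 algebra_simps)
  have bound: "\<bar>(z 0 - y 0) * z 1 * z 2 * z 3\<bar> + \<bar>y 0 * (z 1 - y 1) * z 2 * z 3\<bar>
      + \<bar>y 0 * y 1 * (z 2 - y 2) * z 3\<bar> + \<bar>y 0 * y 1 * y 2 * (z 3 - y 3)\<bar>
      \<le> \<delta> * (2 * \<beta>) * (2 * \<beta>) * (2 * \<beta>) + \<beta> * \<delta> * (2 * \<beta>) * (2 * \<beta>)
      + \<beta> * \<beta> * \<delta> * (2 * \<beta>) + \<beta> * \<beta> * \<beta> * \<delta>"
    by (intro add_mono four_factors y z d) simp_all
  have total: "\<delta> * (2 * \<beta>) * (2 * \<beta>) * (2 * \<beta>) + \<beta> * \<delta> * (2 * \<beta>) * (2 * \<beta>)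
      + \<beta> * \<beta> * \<delta> * (2 * \<beta>) + \<beta> * \<beta> * \<beta> * \<delta> = 15 * \<beta> ^ 3 * \<delta>"
    by (simp add: power3_eq_cube)
  show ?thesis
    unfolding telescope total[symmetric] by (rule order_trans[OF triangle bound])
qed

lemma sum_offdiagonal_eq:
  fixes f :: "nat \<Rightarrow> nat \<Rightarrow> real"
  assumes sym: "\<And>i j. i < n \<Longrightarrow> j < n \<Longrightarrow> f i j = f j i"
  shows "(\<Sum>i<n. \<Sum>j<n. f i j) = 2 * (\<Sum>(i, j)\<in>edges n. f i j) + (\<Sum>i<n. f i i)"
proof -
  let ?sw = "\<lambda>(i, j). (j, i) :: nat \<times> nat"
  have split: "{..<n} \<times> {..<n} = (edges n \<union> ?sw ` edges n) \<union> (\<lambda>i. (i, i)) ` {..<n}"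
    by (auto simp: edges_def image_iff)
  have "(\<Sum>i<n. \<Sum>j<n. f i j) = (\<Sum>(i, j)\<in>{..<n} \<times> {..<n}. f i j)" by (rule sum.cartesian_product)
  also have "\<dots> = (\<Sum>(i, j)\<in>edges n \<union> ?sw ` edges n. f i j) + (\<Sum>(i, j)\<in>(\<lambda>i. (i, i)) ` {..<n}. f i j)"
    unfolding split by (rule sum.union_disjoint) (simp, simp, auto simp: edges_def)
  also have "(\<Sum>(i, j)\<in>(\<lambda>i. (i, i)) ` {..<n}. f i j) = (\<Sum>i<n. f i i)"
    by (subst sum.reindex) (auto simp: inj_on_def)
  also have "(\<Sum>(i, j)\<in>edges n \<union> ?sw ` edges n. f i j) =
      (\<Sum>(i, j)\<in>edges n. f i j) + (\<Sum>(i, j)\<in>?sw ` edges n. f i j)"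
    by (rule sum.union_disjoint) (simp, simp, auto simp: edges_def)
  also have "(\<Sum>(i, j)\<in>?sw ` edges n. f i j) = (\<Sum>(i, j)\<in>edges n. f i j)"
    by (subst sum.reindex) (auto simp: inj_on_def edges_def sym intro!: sum.cong)
  finally show ?thesis by simp
qed

text \<open>Symmetry and the zero diagonal turn the sum of all entries into twice the sum over the edges and allow
  the entries along a cycle to be read above the diagonal.\<close>
lemma test_stat_eq_cycle_stat:
  assumes A: "A \<in> carrier_mat n n" and sym: "transpose_mat A = A"
    and diag: "\<And>i. i < n \<Longrightarrow> A $$ (i, i) = 0"
  shows "test_stat n A = cycle_stat n (\<lambda>e. A $$ e)"
proof -
  have symA: "A $$ (i, j) = A $$ (j, i)" if "i < n" "j < n" for i j
    using that A arg_cong[OF sym, of "\<lambda>B. B $$ (i, j)"] by simp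
  have edgeA: "A $$ edge i j = A $$ (i, j)" if "i < n" "j < n" for i j
    using symA[OF that] by (simp add: edge_def min_def max_def)
  have "ones n \<bullet> (A *\<^sub>v ones n) = (\<Sum>i<n. \<Sum>j<n. A $$ (i, j))"
    using A by (simp add: ones_def scalar_prod_def atLeast0LessThan)
  also have "\<dots> = 2 * (\<Sum>(i, j)\<in>edges n. A $$ (i, j))"
    using sum_offdiagonal_eq[of n "\<lambda>i j. A $$ (i, j)"] symA diag by simp
  also have "(\<Sum>(i, j)\<in>edges n. A $$ (i, j)) = (\<Sum>e\<in>edges n. A $$ e)"
    by (simp add: case_prod_beta)
  finally have dens: "alpha_hat n A = edge_density n (\<lambda>e. A $$ e)"
    by (simp add: alpha_hat_def edge_density_def Let_def)
  have "Q_stat n A = (\<Sum>t\<in>quads n. \<Prod>m<4. A $$ cyc t m - alpha_hat n A)"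
    unfolding Q_stat_def quads_def[symmetric]
  proof (rule sum.cong)
    fix t assume "t \<in> quads n"
    moreover obtain i j k l where t: "t = (i, j, k, l)" by (cases t)
    ultimately have "i < n" "j < n" "k < n" "l < n" by (simp_all add: quads_def)
    then show "(case t of (i1, i2, i3, i4) \<Rightarrow>
        (A $$ (i1, i2) - alpha_hat n A) * (A $$ (i2, i3) - alpha_hat n A) *
        (A $$ (i3, i4) - alpha_hat n A) * (A $$ (i4, i1) - alpha_hat n A)) =
        (\<Prod>m<4. A $$ cyc t m - alpha_hat n A)"
      by (simp add: t lessThan_4 cyc_def edgeA mult.assoc)
  qed simp
  then show ?thesis unfolding test_stat_def cycle_stat_def dens by simp
qed

locale mmsbm_parameters =
  fixes n K :: nat and P PI H :: "real mat" and C :: real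
  assumes n_ge: "n \<ge> 2" and C_pos: "C > 0"
    and PI_carrier: "PI \<in> carrier_mat n K" and weights: "\<And>i. i < n \<Longrightarrow> weight_vector (row PI i)"
    and P_carrier: "P \<in> carrier_mat K K" and P_sym: "transpose_mat P = P"
    and P_range: "\<And>k l. k < K \<Longrightarrow> l < K \<Longrightarrow> P $$ (k, l) \<in> {0..1}"
    and GH: "inverts_mat (G_mat PI) H" and HG: "inverts_mat H (G_mat PI)" and H_norm: "op_norm H \<le> C"
begin

definition a :: real where "a = alpha0 P PI"

definition \<beta> :: real where "\<beta> = op_norm (P - alpha0 P PI \<cdot>\<^sub>m ones_mat K)"

definition \<pi> :: "nat \<Rightarrow> nat \<Rightarrow> real" where "\<pi> i k = PI $$ (i, k)"

definition \<Omega> :: "nat \<Rightarrow> nat \<Rightarrow> real" where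
  "\<Omega> i j = (\<Sum>k<K. \<Sum>l<K. \<pi> i k * P $$ (k, l) * \<pi> j l)"

definition t :: "nat \<Rightarrow> nat \<Rightarrow> real" where "t k l = P $$ (k, l) - a"

lemma row_PI: "i < n \<Longrightarrow> k < K \<Longrightarrow> row PI i $ k = \<pi> i k"
  using PI_carrier by (auto simp: \<pi>_def)

lemma \<pi>_nonneg: "i < n \<Longrightarrow> k < K \<Longrightarrow> \<pi> i k \<ge> 0"
  using weights[of i] PI_carrier row_PI[of i k] unfolding weight_vector_def by auto

lemma \<pi>_sum: "i < n \<Longrightarrow> (\<Sum>k<K. \<pi> i k) = 1"
proof -
  assume i: "i < n"
  then have "(\<Sum>k<K. row PI i $ k) = 1"
    using weights[OF i] PI_carrier unfolding weight_vector_def by simp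
  also have "(\<Sum>k<K. row PI i $ k) = (\<Sum>k<K. \<pi> i k)"
    using row_PI[OF i] by (intro sum.cong) auto
  finally show ?thesis .
qed

lemma \<pi>_le_1: "i < n \<Longrightarrow> k < K \<Longrightarrow> \<pi> i k \<le> 1"
  using member_le_sum[of k "{..<K}" "\<pi> i"] \<pi>_nonneg[of i] \<pi>_sum[of i] by auto

lemma Omega_index: "i < n \<Longrightarrow> j < n \<Longrightarrow> Omega P PI $$ (i, j) = \<Omega> i j"
proof -
  assume ij: "i < n" "j < n"
  have "Omega P PI $$ (i, j) = (\<Sum>k<K. PI $$ (i, k) * (\<Sum>l<K. P $$ (k, l) * PI $$ (j, l)))"
    using ij PI_carrier P_carrier by (simp add: Omega_def scalar_prod_def atLeast0LessThan)
  also have "\<dots> = \<Omega> i j" by (simp add: \<Omega>_def \<pi>_def sum_distrib_left mult.assoc)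
  finally show ?thesis .
qed

lemma P_symmetric: "k < K \<Longrightarrow> l < K \<Longrightarrow> P $$ (k, l) = P $$ (l, k)"
  using P_carrier arg_cong[OF P_sym, of "\<lambda>B. B $$ (k, l)"] by simp

lemma \<Omega>_sym: "\<Omega> i j = \<Omega> j i"
proof -
  have "\<Omega> i j = (\<Sum>l<K. \<Sum>k<K. \<pi> i k * P $$ (k, l) * \<pi> j l)" unfolding \<Omega>_def by (rule sum.swap)
  also have "\<dots> = \<Omega> j i" unfolding \<Omega>_def using P_symmetric by (intro sum.cong) (auto simp: mult_ac)
  finally show ?thesis .
qed

lemma weighted_average:
  assumes "i < n" "j < n"
  shows "(\<Sum>k<K. \<Sum>l<K. \<pi> i k * c * \<pi> j l) = c"
proof -
  have "(\<Sum>k<K. \<Sum>l<K. \<pi> i k * c * \<pi> j l) = (\<Sum>k<K. \<pi> i k * c * (\<Sum>l<K. \<pi> j l))"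
    by (simp add: sum_distrib_left)
  also have "\<dots> = (\<Sum>k<K. \<pi> i k) * c"
    using assms by (simp add: \<pi>_sum flip: sum_distrib_right)
  finally show ?thesis using assms by (simp add: \<pi>_sum)
qed

lemma weighted_average_mono:
  assumes "i < n" "j < n" and "\<And>k l. k < K \<Longrightarrow> l < K \<Longrightarrow> f k l \<le> g k l"
  shows "(\<Sum>k<K. \<Sum>l<K. \<pi> i k * f k l * \<pi> j l) \<le> (\<Sum>k<K. \<Sum>l<K. \<pi> i k * g k l * \<pi> j l)"
  using assms \<pi>_nonneg by (intro sum_mono mult_right_mono mult_left_mono) auto

lemma \<Omega>_range: "i < n \<Longrightarrow> j < n \<Longrightarrow> 0 \<le> \<Omega> i j \<and> \<Omega> i j \<le> 1"
  using weighted_average_mono[of i j "\<lambda>_ _. 0" "\<lambda>k l. P $$ (k, l)"]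
    weighted_average_mono[of i j "\<lambda>k l. P $$ (k, l)" "\<lambda>_ _. 1"] P_range
    weighted_average[of i j 1]
  by (auto simp: \<Omega>_def)

lemma G_index: "k < K \<Longrightarrow> l < K \<Longrightarrow> G_mat PI $$ (k, l) = (\<Sum>i<n. \<pi> i k * \<pi> i l) / real n"
  using PI_carrier by (auto simp: G_mat_def \<pi>_def intro!: sum.cong)

lemma H_carrier: "H \<in> carrier_mat K K"
proof -
  have G: "G_mat PI \<in> carrier_mat K K" using PI_carrier by (simp add: G_mat_def)
  have "dim_col (G_mat PI * H) = K" "dim_col (H * G_mat PI) = dim_row H"
    using GH HG G unfolding inverts_mat_def by auto
  then show ?thesis using G by auto
qed

sublocale wm: weighted_memberships n K \<pi> "\<lambda>k l. H $$ (k, l)" C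
proof
  show "n > 0" using n_ge by simp
  show "C > 0" by (rule C_pos)
  have G: "G_mat PI \<in> carrier_mat K K" using PI_carrier by (simp add: G_mat_def)
  fix k m assume km: "k < K" "m < K"
  have "(G_mat PI * H) $$ (k, m) = (\<Sum>l<K. G_mat PI $$ (k, l) * H $$ (l, m))"
    using G H_carrier km by (simp add: scalar_prod_def atLeast0LessThan)
  moreover have "G_mat PI * H = 1\<^sub>m K" using GH G by (simp add: inverts_mat_def)
  ultimately have "(\<Sum>l<K. G_mat PI $$ (k, l) * H $$ (l, m)) = 1\<^sub>m K $$ (k, m)" by simp
  also have "\<dots> = of_bool (k = m)" using km by simp
  finally have "(\<Sum>l<K. G_mat PI $$ (k, l) * H $$ (l, m)) = of_bool (k = m)" .
  then show "(\<Sum>l<K. (\<Sum>i<n. \<pi> i k * \<pi> i l) / real n * H $$ (l, m)) = of_bool (k = m)"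
    using km by (simp add: G_index)
next
  fix y :: "nat \<Rightarrow> real"
  have "op_norm H * (\<Sum>k<K. (y k)\<^sup>2) \<le> C * (\<Sum>k<K. (y k)\<^sup>2)"
    using H_norm by (intro mult_right_mono sum_nonneg) auto
  then show "(\<Sum>k<K. y k * (\<Sum>l<K. H $$ (k, l) * y l)) \<le> C * (\<Sum>k<K. (y k)\<^sup>2)"
    using quadratic_form_le_op_norm[OF H_carrier, of y] by linarith
qed

text \<open>The lower eigenvalue bound at the basis vector \<open>k\<close>, combined with \<open>\<pi>\<^sub>i\<^sub>k\<^sup>2 \<le> \<pi>\<^sub>i\<^sub>k\<close>: no community is small.\<close>
lemma community_mass_ge:
  assumes k: "k < K"
  shows "real n / C \<le> (\<Sum>i<n. \<pi> i k)"
proof -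
  define e :: "nat \<Rightarrow> real" where "e l = of_bool (l = k)" for l
  have delta: "(\<Sum>l<K. f l * e l) = f k" for f
    using k by (simp add: e_def of_bool_def if_distrib[of "\<lambda>c. _ * c"] sum.delta cong: if_cong)
  have "(\<Sum>l<K. (e l)\<^sup>2) = 1" using delta[of e] by (simp add: power2_eq_square e_def)
  then have "real n \<le> C * (\<Sum>i<n. (wm.lift e i)\<^sup>2)" using wm.lift_norm_ge[of e] by simp
  also have "(\<Sum>i<n. (wm.lift e i)\<^sup>2) = (\<Sum>i<n. (\<pi> i k)\<^sup>2)" unfolding wm.lift_def delta ..
  also have "C * \<dots> \<le> C * (\<Sum>i<n. \<pi> i k)"
    using C_pos k \<pi>_nonneg \<pi>_le_1
    by (intro mult_left_mono sum_mono) (auto simp: power2_eq_square mult_left_le)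
  finally show ?thesis using C_pos by (simp add: field_simps)
qed

lemma alpha_double_sum: "real n ^ 2 * a = (\<Sum>k<K. \<Sum>l<K. (\<Sum>i<n. \<pi> i k) * P $$ (k, l) * (\<Sum>j<n. \<pi> j l))"
proof -
  have h: "h_vec PI $ k = (\<Sum>i<n. \<pi> i k) / real n" if "k < K" for k
    using that PI_carrier by (auto simp: h_vec_def \<pi>_def intro!: sum.cong)
  have dim: "dim_vec (h_vec PI) = K" using PI_carrier by (simp add: h_vec_def)
  have "a = (\<Sum>k<K. h_vec PI $ k * (\<Sum>l<K. P $$ (k, l) * h_vec PI $ l))"
    using P_carrier dim by (simp add: a_def alpha0_def scalar_prod_def atLeast0LessThan)
  also have "\<dots> = (\<Sum>k<K. \<Sum>l<K. (\<Sum>i<n. \<pi> i k) * P $$ (k, l) * (\<Sum>j<n. \<pi> j l) / real n ^ 2)"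
  proof (rule sum.cong)
    fix k assume k: "k \<in> {..<K}"
    have "h_vec PI $ k * (\<Sum>l<K. P $$ (k, l) * h_vec PI $ l) =
        (\<Sum>l<K. h_vec PI $ k * (P $$ (k, l) * h_vec PI $ l))" by (rule sum_distrib_left)
    also have "\<dots> = (\<Sum>l<K. (\<Sum>i<n. \<pi> i k) * P $$ (k, l) * (\<Sum>j<n. \<pi> j l) / real n ^ 2)"
      using k by (intro sum.cong) (auto simp: h power2_eq_square)
    finally show "h_vec PI $ k * (\<Sum>l<K. P $$ (k, l) * h_vec PI $ l) = \<dots>" .
  qed simp
  also have "\<dots> = (\<Sum>k<K. \<Sum>l<K. (\<Sum>i<n. \<pi> i k) * P $$ (k, l) * (\<Sum>j<n. \<pi> j l)) / real n ^ 2"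
    by (simp add: sum_divide_distrib)
  finally show ?thesis using n_ge by simp
qed

lemma \<Omega>_double_sum: "(\<Sum>i<n. \<Sum>j<n. \<Omega> i j) = real n ^ 2 * a"
proof -
  have "(\<Sum>i<n. \<Sum>j<n. \<Omega> i j) = (\<Sum>i<n. \<Sum>k<K. \<Sum>j<n. \<Sum>l<K. \<pi> i k * P $$ (k, l) * \<pi> j l)"
    unfolding \<Omega>_def by (intro sum.cong refl sum.swap)
  also have "\<dots> = (\<Sum>k<K. \<Sum>i<n. \<Sum>l<K. \<Sum>j<n. \<pi> i k * P $$ (k, l) * \<pi> j l)"
    by (subst sum.swap, intro sum.cong refl sum.swap)
  also have "\<dots> = (\<Sum>k<K. \<Sum>l<K. \<Sum>i<n. \<Sum>j<n. \<pi> i k * P $$ (k, l) * \<pi> j l)"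
    by (intro sum.cong refl sum.swap)
  also have "\<dots> = real n ^ 2 * a"
    unfolding alpha_double_sum
    by (intro sum.cong refl, subst sum.swap) (simp add: sum_distrib_left sum_distrib_right)
  finally show ?thesis .
qed

text \<open>A single entry of \<open>P\<close> contributes to the average \<open>a\<close> with weight \<open>h\<^sub>k h\<^sub>l \<ge> C\<^sup>-\<^sup>2\<close>, so all edge
  probabilities are of order \<open>a\<close>.\<close>
lemma P_le:
  assumes k: "k < K" and l: "l < K"
  shows "P $$ (k, l) \<le> C\<^sup>2 * a"
proof -
  let ?s = "\<lambda>k. \<Sum>i<n. \<pi> i k"
  have s0: "?s k \<ge> 0" if "k < K" for k using \<pi>_nonneg that by (intro sum_nonneg) auto
  have nn: "0 \<le> ?s k * P $$ (k, l) * ?s l" if "k < K" "l < K" for k l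
    using s0 P_range that by (auto intro!: mult_nonneg_nonneg)
  have "(real n / C) * P $$ (k, l) * (real n / C) \<le> ?s k * P $$ (k, l) * ?s l"
    using community_mass_ge[OF k] community_mass_ge[OF l] P_range[OF k l] s0[OF k] C_pos
    by (intro mult_mono mult_nonneg_nonneg) auto
  also have "\<dots> \<le> (\<Sum>l<K. ?s k * P $$ (k, l) * ?s l)"
    using nn k l by (intro member_le_sum) auto
  also have "\<dots> \<le> (\<Sum>k<K. \<Sum>l<K. ?s k * P $$ (k, l) * ?s l)"
    using nn k by (intro member_le_sum[of k "{..<K}" "\<lambda>k. \<Sum>l<K. ?s k * P $$ (k, l) * ?s l"] sum_nonneg) auto
  finally have "real n ^ 2 * P $$ (k, l) \<le> real n ^ 2 * (C\<^sup>2 * a)"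
    unfolding alpha_double_sum[symmetric] using C_pos by (simp add: field_simps power2_eq_square)
  then show ?thesis using n_ge by simp
qed

lemma \<Omega>_le: "i < n \<Longrightarrow> j < n \<Longrightarrow> \<Omega> i j \<le> C\<^sup>2 * a"
  using weighted_average_mono[of i j "\<lambda>k l. P $$ (k, l)" "\<lambda>_ _. C\<^sup>2 * a"] P_le weighted_average[of i j "C\<^sup>2 * a"]
  by (simp add: \<Omega>_def)

lemma centred_matrix:
  "P - alpha0 P PI \<cdot>\<^sub>m ones_mat K \<in> carrier_mat K K"
  "k < K \<Longrightarrow> l < K \<Longrightarrow> (P - alpha0 P PI \<cdot>\<^sub>m ones_mat K) $$ (k, l) = t k l"
  using P_carrier by (auto simp: ones_mat_def ones_def t_def a_def)

lemma t_abs_le: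
  assumes "k < K" "l < K"
  shows "\<bar>t k l\<bar> \<le> \<beta>"
proof -
  have "k < dim_row (P - alpha0 P PI \<cdot>\<^sub>m ones_mat K)" "l < dim_col (P - alpha0 P PI \<cdot>\<^sub>m ones_mat K)"
    using centred_matrix(1) assms by auto
  then show ?thesis
    using entry_le_op_norm[of k "P - alpha0 P PI \<cdot>\<^sub>m ones_mat K" l]
    unfolding centred_matrix(2)[OF assms] \<beta>_def by blast
qed

lemma \<beta>_nonneg: "\<beta> \<ge> 0" by (simp add: \<beta>_def op_norm_nonneg)

lemma \<beta>_power4_le:
  assumes "\<And>k l. k < K \<Longrightarrow> l < K \<Longrightarrow> t k l ^ 4 \<le> c"
  shows "\<beta> ^ 4 \<le> real K ^ 4 * c"
proof -
  let ?B = "P - alpha0 P PI \<cdot>\<^sub>m ones_mat K"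
  have "\<beta>\<^sup>2 \<le> (sqrt (frobenius ?B))\<^sup>2"
    unfolding \<beta>_def by (intro power_mono op_norm_le_frobenius op_norm_nonneg)
  also have "\<dots> = (\<Sum>k<K. \<Sum>l<K. (t k l)\<^sup>2)"
    using centred_matrix P_carrier by (simp add: frobenius_nonneg) (simp add: frobenius_def ones_mat_def t_def a_def ones_def)
  also have "\<dots> = (\<Sum>(k, l)\<in>{..<K} \<times> {..<K}. (t k l)\<^sup>2)" by (rule sum.cartesian_product)
  finally have "(\<beta>\<^sup>2)\<^sup>2 \<le> (\<Sum>(k, l)\<in>{..<K} \<times> {..<K}. (t k l)\<^sup>2)\<^sup>2" by (intro power_mono) auto
  also have "\<dots> \<le> (\<Sum>(k, l)\<in>{..<K} \<times> {..<K}. ((t k l)\<^sup>2)\<^sup>2) * real (card ({..<K} \<times> {..<K}))"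
    using sum_squared_le_sum_of_squares[of "\<lambda>(k, l). (t k l)\<^sup>2" "{..<K} \<times> {..<K}"] by (simp add: case_prod_beta)
  also have "\<dots> \<le> (\<Sum>(k, l)\<in>{..<K} \<times> {..<K}. c) * real (card ({..<K} \<times> {..<K}))"
    using assms by (intro mult_right_mono sum_mono) (auto simp flip: power_mult)
  also have "\<dots> = real K ^ 4 * c" by (simp add: card_cartesian_product eval_nat_numeral)
  finally show ?thesis by (simp flip: power_mult)
qed

end

context mmsbm_parameters
begin

definition p :: "nat \<times> nat \<Rightarrow> real" where "p e = \<Omega> (fst e) (snd e)"

definition \<mu> :: real where "\<mu> = 2 * (\<Sum>e\<in>edges n. p e) / (real n * (real n - 1))"

definition q :: real where "q = (\<Sum>t\<in>quads n. \<Prod>m<4. p (cyc t m) - \<mu>)"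

lemma p_edge: "p (edge i j) = \<Omega> i j"
  using \<Omega>_sym[of i j] by (simp add: p_def edge_def min_def max_def)

lemma \<Omega>_centred:
  assumes "i < n" "j < n"
  shows "\<Omega> i j - a = (\<Sum>k<K. \<Sum>l<K. \<pi> i k * t k l * \<pi> j l)"
proof -
  have "(\<Sum>k<K. \<Sum>l<K. \<pi> i k * t k l * \<pi> j l) =
      \<Omega> i j - (\<Sum>k<K. \<Sum>l<K. \<pi> i k * a * \<pi> j l)"
    by (simp add: \<Omega>_def t_def algebra_simps sum_subtractf)
  then show ?thesis using weighted_average[OF assms, of a] by simp
qed

lemma \<Omega>_centred_abs_le:
  assumes "i < n" "j < n"
  shows "\<bar>\<Omega> i j - a\<bar> \<le> \<beta>"
proof -
  have "t k l \<le> \<beta>" "- \<beta> \<le> t k l" if "k < K" "l < K" for k l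
    using t_abs_le[OF that] by linarith+
  then have "(\<Sum>k<K. \<Sum>l<K. \<pi> i k * t k l * \<pi> j l) \<le> (\<Sum>k<K. \<Sum>l<K. \<pi> i k * \<beta> * \<pi> j l)"
    and "(\<Sum>k<K. \<Sum>l<K. \<pi> i k * (- \<beta>) * \<pi> j l) \<le> (\<Sum>k<K. \<Sum>l<K. \<pi> i k * t k l * \<pi> j l)"
    by (intro weighted_average_mono assms; simp)+
  then show ?thesis
    unfolding \<Omega>_centred[OF assms] weighted_average[OF assms] by linarith
qed

text \<open>The centred probabilities sum to zero over all ordered pairs including the diagonal, so leaving out the
  diagonal shifts the average only by the mean of \<open>n\<close> bounded terms.\<close>
lemma \<mu>_close: "\<bar>\<mu> - a\<bar> \<le> \<beta> / (real n - 1)"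
proof -
  have n2: "real n \<ge> 2" using n_ge by simp
  have "real n ^ 2 * a = 2 * (\<Sum>e\<in>edges n. p e) + (\<Sum>i<n. \<Omega> i i)"
    unfolding \<Omega>_double_sum[symmetric] using sum_offdiagonal_eq[of n \<Omega>] \<Omega>_sym by (simp add: p_def case_prod_beta)
  then have "2 * (\<Sum>e\<in>edges n. p e) = (real n * (real n - 1)) * a - (\<Sum>i<n. \<Omega> i i - a)"
    by (simp add: sum_subtractf power2_eq_square algebra_simps)
  then have "\<mu> = ((real n * (real n - 1)) * a - (\<Sum>i<n. \<Omega> i i - a)) / (real n * (real n - 1))"
    by (simp add: \<mu>_def)
  also have "\<dots> = a - (\<Sum>i<n. \<Omega> i i - a) / (real n * (real n - 1))"
    using n2 by (simp add: diff_divide_distrib)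
  finally have "\<bar>\<mu> - a\<bar> = \<bar>\<Sum>i<n. \<Omega> i i - a\<bar> / (real n * (real n - 1))"
    using n2 by (simp add: abs_mult)
  also have "\<dots> \<le> (\<Sum>i<n. \<beta>) / (real n * (real n - 1))"
    using n2 \<Omega>_centred_abs_le by (intro divide_right_mono order_trans[OF sum_abs sum_mono]) auto
  also have "\<dots> = \<beta> / (real n - 1)" using n2 by simp
  finally show ?thesis .
qed

lemma \<mu>_close': "\<bar>\<mu> - a\<bar> \<le> \<beta>"
proof -
  have "\<beta> / (real n - 1) \<le> \<beta> / 1" using n_ge \<beta>_nonneg by (intro divide_left_mono) auto
  then show ?thesis using \<mu>_close by simp
qed

lemma edge_deviation_le:
  assumes "e \<in> edges n"
  shows "\<bar>p e - \<mu>\<bar> \<le> 2 * \<beta>"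
proof -
  have "\<bar>p e - a\<bar> \<le> \<beta>" unfolding p_def using assms by (intro \<Omega>_centred_abs_le) (auto simp: edges_def)
  then show ?thesis using \<mu>_close' by linarith
qed

lemma a_nonneg: "a \<ge> 0"
proof -
  have "0 \<le> (\<Sum>i<n. \<Sum>j<n. \<Omega> i j)" using \<Omega>_range by (intro sum_nonneg) auto
  then show ?thesis unfolding \<Omega>_double_sum using n_ge by (simp add: zero_le_mult_iff)
qed

lemma \<beta>_le: "\<beta> \<le> real K * (C\<^sup>2 + 1) * a"
proof (rule power_le_imp_le_base[of _ 3])
  have "t k l ^ 4 \<le> ((C\<^sup>2 + 1) * a) ^ 4" if "k < K" "l < K" for k l
  proof -
    have "0 \<le> C\<^sup>2 * a" using a_nonneg by simp
    moreover have "0 \<le> P $$ (k, l)" using P_range[OF that] by simp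
    ultimately have "\<bar>t k l\<bar> \<le> C\<^sup>2 * a + a"
      using P_le[OF that] a_nonneg unfolding t_def by linarith
    then have "\<bar>t k l\<bar> \<le> (C\<^sup>2 + 1) * a" by (simp add: algebra_simps)
    then have "\<bar>t k l\<bar> ^ 4 \<le> ((C\<^sup>2 + 1) * a) ^ 4" by (intro power_mono) auto
    then show ?thesis by (simp add: power_even_abs)
  qed
  from \<beta>_power4_le[OF this] show "\<beta> ^ Suc 3 \<le> (real K * (C\<^sup>2 + 1) * a) ^ Suc 3"
    by (simp add: power_mult_distrib)
  show "0 \<le> real K * (C\<^sup>2 + 1) * a" using a_nonneg by simp
qed

text \<open>Summed over all closed walks instead of cycles, with centring at \<open>a\<close> instead of \<open>\<mu>\<close>, the signal is the
  trace of the fourth power of the centred matrix \<open>\<Pi> t \<Pi>'\<close>, which the largest entry of \<open>t\<close> bounds from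
  below. Walks with a repeated node and the change of the centre both cost a factor \<open>n\<close>, so they only
  affect lower order terms.\<close>
lemma q_ge:
  assumes K: "K \<ge> 1"
  shows "q \<ge> real n ^ 4 * \<beta> ^ 4 / (real K ^ 4 * C ^ 4) - 36 * real n ^ 3 * \<beta> ^ 4"
proof -
  let ?all = "{..<n} \<times> {..<n} \<times> {..<n} \<times> {..<n}"
  define B where "B i j = \<Omega> i j - a" for i j
  define F where "F = (\<Sum>i<n. \<Sum>j<n. (\<Sum>m<n. B i m * B m j)\<^sup>2)"
  define y where "y t m = B (node t m) (node t (Suc m mod 4))" for t m
  have n2: "real n \<ge> 2" using n_ge by simp
  have Bsym: "B i j = B j i" for i j using \<Omega>_sym[of i j] by (simp add: B_def)
  have "real n ^ 4 * t k l ^ 4 \<le> C ^ 4 * F" if "k < K" "l < K" for k l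
    unfolding F_def
    by (rule wm.frobenius_square_ge[where t = t])
      (use P_symmetric \<Omega>_centred that in \<open>auto simp: B_def t_def\<close>)
  then have "t k l ^ 4 \<le> C ^ 4 * F / real n ^ 4" if "k < K" "l < K" for k l
    using that n2 by (simp add: field_simps)
  from \<beta>_power4_le[OF this] have "\<beta> ^ 4 \<le> real K ^ 4 * (C ^ 4 * F / real n ^ 4)" by blast
  then have F_ge: "real n ^ 4 * \<beta> ^ 4 / (real K ^ 4 * C ^ 4) \<le> F"
    using n2 K C_pos by (simp add: field_simps)
  have F_eq: "F = (\<Sum>t\<in>?all. \<Prod>m<4. y t m)"
  proof -
    \<comment> \<open>The two copies of \<open>B\<^sup>2\<close> in the square supply the paths through \<open>j\<close> and through \<open>l\<close>.\<close>
    have "F = (\<Sum>i<n. \<Sum>k<n. \<Sum>j<n. \<Sum>l<n. B i j * B j k * B k l * B l i)"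
      unfolding F_def power2_eq_square sum_product
    proof (intro sum.cong refl)
      fix i k j l
      show "B i j * B j k * (B i l * B l k) = B i j * B j k * B k l * B l i"
        using Bsym[of i l] Bsym[of l k] by simp
    qed
    also have "\<dots> = (\<Sum>i<n. \<Sum>j<n. \<Sum>k<n. \<Sum>l<n. B i j * B j k * B k l * B l i)"
      by (intro sum.cong refl sum.swap)
    also have "\<dots> = (\<Sum>(i, j, k, l)\<in>?all. B i j * B j k * B k l * B l i)"
      by (simp add: sum.cartesian_product)
    also have "\<dots> = (\<Sum>t\<in>?all. \<Prod>m<4. y t m)"
      by (intro sum.cong refl) (auto simp: y_def lessThan_4 mult.assoc)
    finally show ?thesis .
  qed
  have node: "node t m < n" if "t \<in> ?all" "m < 4" for t m
    using that less_4_cases[OF that(2)] by (cases t) auto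
  have y_le: "\<bar>y t m\<bar> \<le> \<beta>" if "t \<in> ?all" "m < 4" for t m
    unfolding y_def B_def using that by (intro \<Omega>_centred_abs_le node) auto
  have prod_y: "\<bar>\<Prod>m<4. y t m\<bar> \<le> \<beta> ^ 4" if "t \<in> ?all" for t
  proof -
    have "\<bar>\<Prod>m<4. y t m\<bar> \<le> (\<Prod>m<4::nat. \<beta>)"
      unfolding abs_prod using y_le[OF that] by (intro prod_mono) auto
    then show ?thesis by simp
  qed
  have sub: "quads n \<subseteq> ?all" by (rule quads_subset)
  have "F = (\<Sum>t\<in>?all - quads n. \<Prod>m<4. y t m) + (\<Sum>t\<in>quads n. \<Prod>m<4. y t m)"
    unfolding F_eq by (rule sum.subset_diff[OF sub]) simp
  moreover have "\<bar>\<Sum>t\<in>?all - quads n. \<Prod>m<4. y t m\<bar> \<le> 6 * real n ^ 3 * \<beta> ^ 4"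
  proof -
    have "\<bar>\<Sum>t\<in>?all - quads n. \<Prod>m<4. y t m\<bar> \<le> (\<Sum>t\<in>?all - quads n. \<beta> ^ 4)"
      using prod_y by (intro order_trans[OF sum_abs sum_mono]) auto
    also have "\<dots> = real (card (?all - quads n)) * \<beta> ^ 4" by simp
    also have "\<dots> \<le> real (6 * n ^ 3) * \<beta> ^ 4"
      using card_degenerate_quads_le by (intro mult_right_mono of_nat_mono) auto
    finally show ?thesis by simp
  qed
  moreover have "\<bar>q - (\<Sum>t\<in>quads n. \<Prod>m<4. y t m)\<bar> \<le> 30 * real n ^ 3 * \<beta> ^ 4"
  proof -
    have "\<bar>q - (\<Sum>t\<in>quads n. \<Prod>m<4. y t m)\<bar> \<le> (\<Sum>t\<in>quads n. 15 * \<beta> ^ 3 * (\<beta> / (real n - 1)))"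
      unfolding q_def sum_subtractf[symmetric]
    proof (rule order_trans[OF sum_abs sum_mono], rule prod4_perturbation)
      fix t m assume t: "t \<in> quads n" "m < (4 :: nat)"
      then show "\<bar>y t m\<bar> \<le> \<beta>" using sub by (intro y_le) auto
      show "\<bar>p (cyc t m) - \<mu>\<bar> \<le> 2 * \<beta>" using t by (intro edge_deviation_le cyc_in_edges)
      have "p (cyc t m) - \<mu> - y t m = a - \<mu>" by (simp add: y_def B_def cyc_def p_edge)
      then show "\<bar>p (cyc t m) - \<mu> - y t m\<bar> \<le> \<beta> / (real n - 1)" using \<mu>_close by (simp add: abs_minus_commute)
    qed
    also have "\<dots> = real (card (quads n)) * (15 * \<beta> ^ 3 * (\<beta> / (real n - 1)))" by simp
    also have "\<dots> \<le> real n ^ 4 * (15 * \<beta> ^ 3 * (\<beta> / (real n / 2)))"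
      using card_quads_le[of n] n2 \<beta>_nonneg
      by (intro mult_mono divide_left_mono mult_left_mono) (auto simp flip: of_nat_power)
    also have "\<dots> = 30 * real n ^ 3 * \<beta> ^ 4" using n2 by (simp add: field_simps eval_nat_numeral)
    finally show ?thesis .
  qed
  ultimately show ?thesis using F_ge by linarith
qed

end

section \<open>From the adjacency matrix to the abstract model\<close>

lemma (in prob_space) bernoulli_law:
  assumes f: "f \<in> borel_measurable M" and r: "0 \<le> r" "r \<le> 1"
    and law: "distr M borel f = distr (measure_pmf (bernoulli_pmf r)) borel of_bool"
  shows "AE \<omega> in M. f \<omega> \<in> {0, 1 :: real}"
    and "expectation (\<lambda>\<omega>. of_bool (f \<omega> = 1)) = r"
proof -
  have single: "prob {\<omega> \<in> space M. f \<omega> = of_bool c} = pmf (bernoulli_pmf r) c" for c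
  proof -
    have "prob {\<omega> \<in> space M. f \<omega> = of_bool c} = measure (distr M borel f) {of_bool c}"
      using f by (subst measure_distr) (auto intro!: arg_cong[where f = prob])
    also have "\<dots> = measure (measure_pmf (bernoulli_pmf r)) (of_bool -` {of_bool c :: real})"
      unfolding law by (subst measure_distr) auto
    also have "of_bool -` {of_bool c :: real} = {c}" by auto
    finally show ?thesis by (simp add: measure_pmf_single)
  qed
  have [measurable]: "f \<in> borel_measurable M" by (rule f)
  have one: "prob {\<omega> \<in> space M. f \<omega> = 1} = r" and zero: "prob {\<omega> \<in> space M. f \<omega> = 0} = 1 - r"
    using single[of True] single[of False] r by simp_all
  have "prob ({\<omega> \<in> space M. f \<omega> = 1} \<union> {\<omega> \<in> space M. f \<omega> = 0}) =
      prob {\<omega> \<in> space M. f \<omega> = 1} + prob {\<omega> \<in> space M. f \<omega> = 0}"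
    by (rule finite_measure_Union) auto
  also have "\<dots> = 1" unfolding one zero by simp
  finally have "prob ({\<omega> \<in> space M. f \<omega> = 1} \<union> {\<omega> \<in> space M. f \<omega> = 0}) = 1" .
  then have "AE \<omega> in M. \<omega> \<in> {\<omega> \<in> space M. f \<omega> = 1} \<union> {\<omega> \<in> space M. f \<omega> = 0}"
    by (subst (asm) prob_eq_1) auto
  then show "AE \<omega> in M. f \<omega> \<in> {0, 1}" by eventually_elim auto
  have "expectation (\<lambda>\<omega>. of_bool (f \<omega> = 1)) = expectation (indicator {\<omega> \<in> space M. f \<omega> = 1})"
    by (intro Bochner_Integration.integral_cong) (auto simp: indicator_def)
  also have "\<dots> = prob {\<omega> \<in> space M. f \<omega> = 1}" by simp
  finally show "expectation (\<lambda>\<omega>. of_bool (f \<omega> = 1)) = r" unfolding one .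
qed

context mmsbm_parameters
begin

text \<open>Verifies the conditions of the abstract model with \<open>b = 2 \<beta>\<close> and \<open>D = 2 K (C\<^sup>2 + 1)\<close>.\<close>
lemma instance_bounds:
  fixes M :: "'a measure" and A :: "'a \<Rightarrow> real mat"
  defines "D \<equiv> 2 * real K * (C\<^sup>2 + 1)" and "\<epsilon> \<equiv> exp (- sqrt (real n) / 32)"
    and "x \<equiv> (2 * \<beta>)\<^sup>2 / a"
  assumes model: "mmsbm n K P PI M A" and K: "K \<ge> 2"
    and n256: "n \<ge> 256" and na: "real n * a \<ge> 1" and ac: "a \<le> c"
    and nD: "real n \<ge> 2 * D + 1" and nKC: "real n \<ge> 72 * (real K ^ 4 * C ^ 4)"
    and margin: "c + D / (real n - 1) + sqrt (1 / sqrt (real n) ^ 3) < 1"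
    and \<epsilon>4: "4 * \<epsilon> \<le> 1" and n\<epsilon>: "real n ^ 12 * \<epsilon> \<le> 1"
  shows "prob_space.expectation M (\<lambda>\<omega>. test_stat n (A \<omega>)) \<ge>
      real n ^ 2 * \<beta> ^ 4 / (192 * real K ^ 4 * C ^ 4 * a\<^sup>2) -
      2 ^ 20 * D ^ 5 * ((sqrt \<epsilon> + 1 / sqrt (real n) + real n ^ 6 * \<epsilon>) * (1 + real n * (x * sqrt x))
        + sqrt (real n * x\<^sup>2 + 1 / sqrt (real n)))"
    and "prob_space.variance M (\<lambda>\<omega>. test_stat n (A \<omega>)) \<le>
      2 ^ 35 * D ^ 8 * (1 + real n ^ 2 * x ^ 3 + real n ^ 2 * x ^ 4 / a)"
proof -
  interpret prob_space M using model by (simp add: mmsbm_def)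
  \<comment> \<open>The entries of \<open>A\<close> lie in \<open>{0, 1}\<close> almost surely; this version does so everywhere.\<close>
  define X where "X e \<omega> = (of_bool (A \<omega> $$ e = 1) :: real)" for e \<omega>
  have n2: "real n \<ge> 2" using n_ge by simp
  have indepA: "indep_vars (\<lambda>_. borel) (\<lambda>e \<omega>. A \<omega> $$ e) (edges n)"
    using model by (simp add: mmsbm_def edges_def)
  have measA: "(\<lambda>\<omega>. A \<omega> $$ e) \<in> borel_measurable M" if "e \<in> edges n" for e
    using indepA that by (auto simp: indep_vars_def)
  have lawA: "distr M borel (\<lambda>\<omega>. A \<omega> $$ e) = distr (measure_pmf (bernoulli_pmf (p e))) borel of_bool"
    if "e \<in> edges n" for e
  proof -
    obtain i j where e: "e = (i, j)" "i < j" "j < n"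
      using \<open>e \<in> edges n\<close> by (cases e) (auto simp: edges_def)
    have "distr M borel (\<lambda>\<omega>. A \<omega> $$ (i, j)) =
        distr (measure_pmf (bernoulli_pmf (Omega P PI $$ (i, j)))) borel of_bool"
      using model e unfolding mmsbm_def by blast
    then show ?thesis using e Omega_index[of i j] by (simp add: p_def)
  qed
  have p_range: "0 \<le> p e" "p e \<le> 1" if "e \<in> edges n" for e
    using that \<Omega>_range by (auto simp: p_def edges_def)
  have X_AE: "AE \<omega> in M. A \<omega> $$ e = X e \<omega>" if "e \<in> edges n" for e
    using bernoulli_law(1)[OF measA p_range lawA, OF that that that that] by eventually_elim (auto simp: X_def)
  have indepX: "indep_vars (\<lambda>_. borel) X (edges n)"
  proof -
    have "indep_vars (\<lambda>_. borel) (\<lambda>e \<omega>. of_bool (A \<omega> $$ e = 1) :: real) (edges n)"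
      by (rule indep_vars_compose2[OF indepA, of "\<lambda>_ y. of_bool (y = 1)"]) measurable
    then show ?thesis by (simp add: X_def[abs_def])
  qed
  have D1: "D \<ge> 1"
  proof -
    have "2 * 2 * 1 \<le> 2 * real K * (C\<^sup>2 + 1)" using K by (intro mult_mono) auto
    then show ?thesis by (simp add: D_def)
  qed
  have a0: "a > 0" using na n2 by (metis a_nonneg less_eq_real_def mult_zero_right not_one_le_zero)
  have c1: "c < 1"
  proof -
    have "0 \<le> D / (real n - 1)" "0 \<le> sqrt (1 / sqrt (real n) ^ 3)" using D1 n2 by auto
    then show ?thesis using margin by linarith
  qed
  have \<beta>D: "2 * \<beta> \<le> D * a" using \<beta>_le by (simp add: D_def)
  have dev: "\<bar>\<mu> - a\<bar> \<le> D / 2 / (real n - 1) * a"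
  proof -
    have "\<beta> / (real n - 1) \<le> (D / 2 * a) / (real n - 1)" using \<beta>D n2 by (intro divide_right_mono) auto
    then show ?thesis using \<mu>_close by simp
  qed
  have "D / 2 / (real n - 1) \<le> 1 / 2" using nD n2 D1 by (simp add: field_simps)
  then have "D / 2 / (real n - 1) * a \<le> 1 / 2 * a" using a0 by (intro mult_right_mono) auto
  with dev have "\<bar>\<mu> - a\<bar> \<le> 1 / 2 * a" by (rule order_trans)
  then have \<mu>a: "a / 2 \<le> \<mu>" "\<mu> \<le> 2 * a" using a0 by linarith+
  have pD: "p e \<le> D * a" if "e \<in> edges n" for e
  proof -
    have "C\<^sup>2 \<le> 1 * (C\<^sup>2 + 1)" by simp
    also have "\<dots> \<le> 2 * real K * (C\<^sup>2 + 1)" using K by (intro mult_right_mono) auto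
    finally have "C\<^sup>2 * a \<le> D * a" unfolding D_def using a0 by (intro mult_right_mono) auto
    moreover have "p e \<le> C\<^sup>2 * a" using \<Omega>_le that by (auto simp: p_def edges_def)
    ultimately show ?thesis by linarith
  qed
  interpret fc: four_cycle_model M n X p \<mu> "2 * \<beta>" D a
  proof
    show "\<mu> * (real n * (real n - 1)) = 2 * (\<Sum>e\<in>edges n. p e)" using n2 by (simp add: \<mu>_def)
    show "expectation (X e) = p e" if "e \<in> edges n" for e
      using bernoulli_law(2)[OF measA p_range lawA, OF that that that that] by (simp add: X_def[abs_def])
  qed (use indepX edge_deviation_le pD \<beta>_nonneg D1 a0 n256 ac c1 na \<mu>a \<beta>D in \<open>auto simp: X_def\<close>)
  interpret fc: four_cycle_model_sparse M n X p \<mu> "2 * \<beta>" D a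
  proof
    have "fc.\<eta> \<le> sqrt (1 / sqrt (real n) ^ 3)"
      unfolding fc.\<eta>_def fc.w_def using ac c1 n2 by (intro real_sqrt_le_mono divide_right_mono) auto
    moreover have "\<mu> \<le> c + D / (real n - 1)"
    proof -
      have "D / 2 / (real n - 1) * a \<le> D / 2 / (real n - 1) * 1"
        using D1 n2 ac c1 by (intro mult_left_mono) auto
      also have "\<dots> \<le> D / (real n - 1)" using D1 n2 by (simp add: field_simps)
      finally show ?thesis using dev ac by (simp add: abs_le_iff)
    qed
    ultimately show "\<mu> + fc.\<eta> < 1" using margin by linarith
  qed
  have eq: "fc.\<epsilon> = \<epsilon>" "fc.w = sqrt (real n)" "fc.x = x" "fc.q = q" "fc.Y = 1 + real n * (x * sqrt x)"
    by (simp_all add: fc.\<epsilon>_def fc.w_def fc.x_def fc.q_def fc.Y_def \<epsilon>_def x_def q_def)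
  have stat: "test_stat n (A \<omega>) = cycle_stat n (\<lambda>e. A \<omega> $$ e)" if "\<omega> \<in> space M" for \<omega>
    using model that by (intro test_stat_eq_cycle_stat) (auto simp: mmsbm_def)
  have measT: "(\<lambda>\<omega>. test_stat n (A \<omega>)) \<in> borel_measurable M"
    using cycle_stat_measurable[OF measA] stat by (subst measurable_cong) auto
  have AE_T: "AE \<omega> in M. test_stat n (A \<omega>) = fc.T \<omega>"
  proof -
    have "AE \<omega> in M. \<forall>e\<in>edges n. A \<omega> $$ e = X e \<omega>"
      using X_AE by (subst AE_finite_all) auto
    then show ?thesis using AE_space
    proof eventually_elim
      case (elim \<omega>)
      have "(\<Sum>e\<in>edges n. A \<omega> $$ e) = (\<Sum>e\<in>edges n. X e \<omega>)" using elim by (intro sum.cong) auto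
      moreover have "(\<Prod>m<4. A \<omega> $$ cyc t m - y) = (\<Prod>m<4. X (cyc t m) \<omega> - y)" if "t \<in> quads n" for t y
        using elim cyc_in_edges[OF that] by (intro prod.cong) auto
      ultimately show ?case using stat elim
        by (simp add: fc.T_def cycle_stat_def edge_density_def cong: sum.cong)
    qed
  qed
  have measfT: "fc.T \<in> borel_measurable M" using fc.bounded_T by (simp add: bounded_rv_def)
  have ET: "expectation (\<lambda>\<omega>. test_stat n (A \<omega>)) = expectation fc.T"
    by (rule integral_cong_AE[OF measT measfT AE_T])
  have VT: "variance (\<lambda>\<omega>. test_stat n (A \<omega>)) = variance fc.T"
    unfolding ET using AE_T measT measfT by (intro integral_cong_AE) auto
  show "variance (\<lambda>\<omega>. test_stat n (A \<omega>)) \<le> 2 ^ 35 * D ^ 8 * (1 + real n ^ 2 * x ^ 3 + real n ^ 2 * x ^ 4 / a)"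
    unfolding VT using fc.variance_T_le n\<epsilon> unfolding eq by blast
  have q_lower: "q \<ge> real n ^ 4 * \<beta> ^ 4 / (2 * (real K ^ 4 * C ^ 4))"
  proof -
    have KC: "real K ^ 4 * C ^ 4 > 0" using K C_pos by simp
    have "36 * real n ^ 3 * \<beta> ^ 4 * (2 * (real K ^ 4 * C ^ 4)) \<le> real n ^ 3 * \<beta> ^ 4 * real n"
      using mult_left_mono[OF nKC, of "real n ^ 3 * \<beta> ^ 4"] by (simp add: mult_ac)
    also have "\<dots> = real n ^ 4 * \<beta> ^ 4" by (simp add: eval_nat_numeral)
    finally have "36 * real n ^ 3 * \<beta> ^ 4 \<le> real n ^ 4 * \<beta> ^ 4 / (2 * (real K ^ 4 * C ^ 4))"
      using KC by (simp add: pos_le_divide_eq)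
    moreover have "real n ^ 4 * \<beta> ^ 4 / (real K ^ 4 * C ^ 4) =
        2 * (real n ^ 4 * \<beta> ^ 4 / (2 * (real K ^ 4 * C ^ 4)))" by simp
    ultimately show ?thesis using q_ge K by linarith
  qed
  have q0: "q \<ge> 0" using C_pos by (intro order_trans[OF _ q_lower]) simp
  have "real n ^ 2 * \<beta> ^ 4 / (192 * real K ^ 4 * C ^ 4 * a\<^sup>2) =
      (real n ^ 4 * \<beta> ^ 4 / (2 * (real K ^ 4 * C ^ 4))) / (96 * real n ^ 2 * a\<^sup>2)"
    using n2 a0 K C_pos by (simp add: field_simps eval_nat_numeral)
  also have "\<dots> \<le> q / (96 * real n ^ 2 * a\<^sup>2)" using q_lower by (intro divide_right_mono) auto
  also have "\<dots> \<le> q / (8 * fc.u * \<mu>\<^sup>2)"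
  proof (rule divide_left_mono)
    have "sqrt 2 \<le> 3 / 2" by (rule real_le_lsqrt) (auto simp: power2_eq_square)
    then have "fc.u \<le> 3 * real n ^ 2" unfolding fc.u_def by (intro mult_right_mono) auto
    moreover have "\<mu>\<^sup>2 \<le> (2 * a)\<^sup>2" using \<mu>a a0 by (intro power_mono) auto
    ultimately have "8 * fc.u * \<mu>\<^sup>2 \<le> 8 * (3 * real n ^ 2) * (2 * a)\<^sup>2"
      using fc.u_pos by (intro mult_mono mult_left_mono) auto
    then show "8 * fc.u * \<mu>\<^sup>2 \<le> 96 * real n ^ 2 * a\<^sup>2" by (simp add: power_mult_distrib)
    show "0 < 96 * real n ^ 2 * a\<^sup>2 * (8 * fc.u * \<mu>\<^sup>2)" using n2 a0 fc.u_pos fc.\<mu>_pos by simp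
  qed (rule q0)
  finally show "expectation (\<lambda>\<omega>. test_stat n (A \<omega>)) \<ge>
      real n ^ 2 * \<beta> ^ 4 / (192 * real K ^ 4 * C ^ 4 * a\<^sup>2) -
      2 ^ 20 * D ^ 5 * ((sqrt \<epsilon> + 1 / sqrt (real n) + real n ^ 6 * \<epsilon>) * (1 + real n * (x * sqrt x))
        + sqrt (real n * x\<^sup>2 + 1 / sqrt (real n)))"
    using fc.expectation_T_ge q0 \<epsilon>4 unfolding ET eq by fastforce
qed

end

section \<open>Asymptotics\<close>

text \<open>The same interpolation as before, now with a gain: \<open>sqrt m x\<close> is \<open>m\<^sup>-\<^sup>1\<^sup>/\<^sup>6\<close> times the power \<open>2/3\<close> of
  \<open>m x\<^sup>3\<^sup>/\<^sup>2\<close>. This is why the biased terms are negligible in the mean.\<close>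
lemma sqrt_remainder_le:
  fixes m x :: real
  assumes m: "m \<ge> 1" and x: "x \<ge> 0"
  shows "sqrt (m * x\<^sup>2 + 1 / sqrt m) \<le> 2 * m powr (- 1 / 6) * (1 + m * (x * sqrt x))"
proof (rule real_le_lsqrt)
  let ?Y = "1 + m * (x * sqrt x)"
  have Y: "?Y \<ge> 1" using m x by simp
  \<comment> \<open>Chosen so that \<open>y\<^sup>3\<^sup>/\<^sup>2 = m x\<^sup>3\<^sup>/\<^sup>2\<close>.\<close>
  define y where "y = m powr (2 / 3) * x"
  have y0: "y \<ge> 0" using x by (simp add: y_def)
  have "y * sqrt y = (m powr (2 / 3) * sqrt (m powr (2 / 3))) * (x * sqrt x)"
    by (simp add: y_def real_sqrt_mult)
  also have "sqrt (m powr (2 / 3)) = m powr (1 / 3)"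
    using m by (simp add: powr_half_sqrt[symmetric] powr_powr)
  also have "m powr (2 / 3) * m powr (1 / 3) = m" using m by (simp flip: powr_add)
  finally have ysq: "y * sqrt y = m * (x * sqrt x)" .
  have "y \<le> 1 + y * sqrt y"
  proof (cases "y \<le> 1")
    case True
    then show ?thesis using y0 by (intro order_trans[OF True]) simp
  next
    case False
    then have "y * 1 \<le> y * sqrt y" by (intro mult_left_mono) auto
    then show ?thesis by simp
  qed
  then have "y\<^sup>2 \<le> ?Y\<^sup>2" unfolding ysq using y0 by (intro power_mono)
  then have "m powr (- 1 / 3) * y\<^sup>2 \<le> m powr (- 1 / 3) * ?Y\<^sup>2" by (intro mult_left_mono) auto
  moreover have "m powr (- 1 / 3) * y\<^sup>2 = m * x\<^sup>2"
  proof -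
    have "m powr (- 1 / 3) * y\<^sup>2 = (m powr (- 1 / 3) * (m powr (2 / 3) * m powr (2 / 3))) * x\<^sup>2"
      by (simp add: y_def power2_eq_square)
    also have "m powr (- 1 / 3) * (m powr (2 / 3) * m powr (2 / 3)) = m"
      using m by (simp flip: powr_add)
    finally show ?thesis .
  qed
  moreover have "1 / sqrt m \<le> m powr (- 1 / 3) * ?Y\<^sup>2"
  proof -
    have "1 / sqrt m = m powr (- 1 / 2)" using m by (simp add: powr_half_sqrt powr_minus_divide)
    also have "\<dots> \<le> m powr (- 1 / 3) * 1" using m by (simp add: powr_mono)
    also have "\<dots> \<le> m powr (- 1 / 3) * ?Y\<^sup>2" using Y by (intro mult_left_mono) (auto simp: one_le_power)
    finally show ?thesis .
  qed
  ultimately have "m * x\<^sup>2 + 1 / sqrt m \<le> 4 * (m powr (- 1 / 3) * ?Y\<^sup>2)"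
    using mult_nonneg_nonneg[OF powr_ge_zero zero_le_power2, of m "- 1 / 3" ?Y] by linarith
  also have "m powr (- 1 / 3) = (m powr (- 1 / 6))\<^sup>2"
    using m by (simp add: power2_eq_square flip: powr_add)
  finally show "m * x\<^sup>2 + 1 / sqrt m \<le> (2 * m powr (- 1 / 6) * ?Y)\<^sup>2"
    by (simp add: power_mult_distrib)
qed (use assms in auto)

lemma square_powr:
  fixes s :: real
  assumes "s > 0"
  shows "(s\<^sup>2) powr (3 / 4) = s * sqrt s" and "(s\<^sup>2) powr (3 / 2) = s ^ 3"
proof -
  have s2: "s\<^sup>2 = s powr 2" using assms by simp
  have "(s\<^sup>2) powr (3 / 4) = s powr (1 + 1 / 2)" unfolding s2 by (simp add: powr_powr)
  also have "\<dots> = s * sqrt s" using assms by (simp only: powr_add powr_half_sqrt[OF less_imp_le] powr_one)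
  finally show "(s\<^sup>2) powr (3 / 4) = s * sqrt s" .
  have "(s\<^sup>2) powr (3 / 2) = s powr 3" unfolding s2 by (simp add: powr_powr)
  then show "(s\<^sup>2) powr (3 / 2) = s ^ 3" using assms by simp
qed

definition err :: "nat \<Rightarrow> real" where
  "err n = sqrt (exp (- sqrt (real n) / 32)) + 1 / sqrt (real n)
     + real n ^ 6 * exp (- sqrt (real n) / 32) + 2 * real n powr (- 1 / 6)"

lemma err_nonneg: "err n \<ge> 0" by (simp add: err_def)

lemma err_smallo: "err \<in> o(\<lambda>_. 1)"
  unfolding err_def[abs_def] by real_asymp

context mmsbm_parameters
begin

text \<open>Translates the bounds through \<open>x = 4 s / n\<close>, where \<open>s\<close> is the square root of \<open>\<tau>\<close>.\<close>
lemma test_stat_bounds: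
  fixes M :: "'a measure" and A :: "'a \<Rightarrow> real mat"
  defines "D \<equiv> 2 * real K * (C\<^sup>2 + 1)" and "\<epsilon> \<equiv> exp (- sqrt (real n) / 32)"
    and "\<tau> \<equiv> tau n K P PI"
  assumes model: "mmsbm n K P PI M A" and K: "K \<ge> 2" and \<tau>: "\<tau> > 0"
    and n256: "n \<ge> 256" and na: "real n * a \<ge> 1" and ac: "a \<le> c"
    and nD: "real n \<ge> 2 * D + 1" and nKC: "real n \<ge> 72 * (real K ^ 4 * C ^ 4)"
    and margin: "c + D / (real n - 1) + sqrt (1 / sqrt (real n) ^ 3) < 1"
    and \<epsilon>4: "4 * \<epsilon> \<le> 1" and n\<epsilon>: "real n ^ 12 * \<epsilon> \<le> 1"
  shows "prob_space.expectation M (\<lambda>\<omega>. test_stat n (A \<omega>)) \<ge>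
      1 / (192 * real K ^ 4 * C ^ 4) * \<tau>
      - (2 ^ 23 * D ^ 5 * err n) * (1 + real n powr (- 1 / 2) * \<tau> powr (3 / 4))"
    and "prob_space.variance M (\<lambda>\<omega>. test_stat n (A \<omega>)) \<le>
      2 ^ 43 * D ^ 8 * (1 + inverse (real n) * \<tau> powr (3 / 2)
        + inverse (real n ^ 2) * inverse (alpha0 P PI) * \<tau>\<^sup>2 * ln (real n))"
proof -
  note bounds = instance_bounds[OF model K n256 na ac nD[unfolded D_def] nKC margin[unfolded D_def]
    \<epsilon>4[unfolded \<epsilon>_def] n\<epsilon>[unfolded \<epsilon>_def], folded D_def]
  define s where "s = real n * \<beta>\<^sup>2 / a"
  define x where "x = (2 * \<beta>)\<^sup>2 / a"
  have n1: "real n \<ge> 1" using n256 by simp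
  have a0: "a > 0" using na n1 by (metis a_nonneg less_eq_real_def mult_zero_right not_one_le_zero)
  have \<tau>_eq: "\<tau> = real n ^ 2 * \<beta> ^ 4 / a\<^sup>2" by (simp add: \<tau>_def tau_def \<beta>_def a_def)
  also have "\<dots> = s\<^sup>2" by (simp add: s_def power_divide power_mult_distrib flip: power_mult)
  finally have \<tau>s: "\<tau> = s\<^sup>2" .
  have "s \<ge> 0" using a0 by (simp add: s_def)
  moreover have "s \<noteq> 0" using \<tau> \<tau>s by auto
  ultimately have s0: "s > 0" by linarith
  have xs: "x = 4 * s / real n" using n1 a0 by (simp add: x_def s_def field_simps)
  have x0: "x \<ge> 0" using s0 n1 by (simp add: xs)
  have D0: "D \<ge> 0" by (simp add: D_def)
  let ?f = "1 + real n powr (- 1 / 2) * \<tau> powr (3 / 4)"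
  let ?Y = "1 + real n * (x * sqrt x)"
  have Y: "?Y \<le> 8 * ?f"
  proof -
    have "real n powr (- 1 / 2) = 1 / sqrt (real n)" by (simp add: powr_half_sqrt powr_minus_divide)
    moreover have "real n * (x * sqrt x) = 8 * (1 / sqrt (real n) * (s * sqrt s))"
      using n1 by (simp add: xs real_sqrt_mult real_sqrt_divide)
    ultimately have "real n * (x * sqrt x) = 8 * (real n powr (- 1 / 2) * \<tau> powr (3 / 4))"
      unfolding \<tau>s square_powr[OF s0] by simp
    then show ?thesis by simp
  qed
  have "(sqrt \<epsilon> + 1 / sqrt (real n) + real n ^ 6 * \<epsilon>) * ?Y + sqrt (real n * x\<^sup>2 + 1 / sqrt (real n))
      \<le> (sqrt \<epsilon> + 1 / sqrt (real n) + real n ^ 6 * \<epsilon>) * ?Y + 2 * real n powr (- 1 / 6) * ?Y"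
    using sqrt_remainder_le[OF n1 x0] by (rule add_left_mono)
  also have "\<dots> = err n * ?Y" by (simp add: err_def \<epsilon>_def algebra_simps)
  also have "\<dots> \<le> err n * (8 * ?f)" using Y err_nonneg by (rule mult_left_mono)
  finally have "2 ^ 20 * D ^ 5 * ((sqrt \<epsilon> + 1 / sqrt (real n) + real n ^ 6 * \<epsilon>) * ?Y
      + sqrt (real n * x\<^sup>2 + 1 / sqrt (real n))) \<le> 2 ^ 20 * D ^ 5 * (err n * (8 * ?f))"
    using D0 by (intro mult_left_mono) auto
  also have "\<dots> = (2 ^ 23 * D ^ 5 * err n) * ?f" by simp
  finally have err: "2 ^ 20 * D ^ 5 * ((sqrt \<epsilon> + 1 / sqrt (real n) + real n ^ 6 * \<epsilon>) * ?Y
      + sqrt (real n * x\<^sup>2 + 1 / sqrt (real n))) \<le> (2 ^ 23 * D ^ 5 * err n) * ?f" .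
  have "1 / (192 * real K ^ 4 * C ^ 4) * \<tau> = real n ^ 2 * \<beta> ^ 4 / (192 * real K ^ 4 * C ^ 4 * a\<^sup>2)"
    by (simp add: \<tau>_eq)
  then show "prob_space.expectation M (\<lambda>\<omega>. test_stat n (A \<omega>)) \<ge>
      1 / (192 * real K ^ 4 * C ^ 4) * \<tau> - (2 ^ 23 * D ^ 5 * err n) * ?f"
    using bounds(1) err unfolding x_def \<epsilon>_def by linarith
  let ?v1 = "inverse (real n) * \<tau> powr (3 / 2)"
  let ?v2 = "inverse (real n ^ 2) * inverse (alpha0 P PI) * \<tau>\<^sup>2"
  have v1: "real n ^ 2 * x ^ 3 = 64 * ?v1"
    unfolding \<tau>s square_powr[OF s0] using n1 by (simp add: xs field_simps eval_nat_numeral)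
  have v2: "real n ^ 2 * x ^ 4 / a = 256 * ?v2"
    unfolding \<tau>s using n1 a0 by (simp add: xs a_def[symmetric] field_simps eval_nat_numeral)
  have "exp 1 \<le> real n" using exp_le n256 by linarith
  then have ln1: "ln (real n) \<ge> 1" using n1 by (simp add: ln_ge_iff)
  have v20: "?v2 \<ge> 0" using a0 by (simp add: a_def)
  have v10: "?v1 \<ge> 0" by simp
  have "?v2 * 1 \<le> ?v2 * ln (real n)" using ln1 v20 by (intro mult_left_mono)
  moreover have "1 + 64 * y1 + 256 * y2 \<le> 2 ^ 8 * (1 + y1 + y3)" if "y2 * 1 \<le> y3" "0 \<le> y1"
    for y1 y2 y3 :: real using that by simp
  ultimately have "1 + real n ^ 2 * x ^ 3 + real n ^ 2 * x ^ 4 / a \<le> 2 ^ 8 * (1 + ?v1 + ?v2 * ln (real n))"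
    unfolding v1 v2 using v10 by blast
  then have "2 ^ 35 * D ^ 8 * (1 + real n ^ 2 * x ^ 3 + real n ^ 2 * x ^ 4 / a)
      \<le> 2 ^ 35 * D ^ 8 * (2 ^ 8 * (1 + ?v1 + ?v2 * ln (real n)))"
    using D0 by (intro mult_left_mono) auto
  also have "\<dots> = 2 ^ 43 * D ^ 8 * (1 + ?v1 + ?v2 * ln (real n))" by simp
  finally show "prob_space.variance M (\<lambda>\<omega>. test_stat n (A \<omega>)) \<le>
      2 ^ 43 * D ^ 8 * (1 + ?v1 + ?v2 * ln (real n))"
    using bounds(2) unfolding x_def by linarith
qed

end

theorem theorem3p3:
  fixes K :: nat and C c :: real
    and P PI :: "nat \<Rightarrow> real mat"
    and M :: "nat \<Rightarrow> 'a measure" and A :: "nat \<Rightarrow> 'a \<Rightarrow> real mat"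
  assumes "K \<ge> 2" and "C > 0" and "0 < c" and "c < 1"
    and "\<forall>\<^sub>F n in sequentially. mmsbm n K (P n) (PI n) (M n) (A n)"
    and "\<forall>\<^sub>F n in sequentially. associated_with_INC n K (P n) (PI n)"
    and "\<forall>\<^sub>F n in sequentially.
           (MAX k\<in>{..<K}. h_vec (PI n) $ k) / (MIN k\<in>{..<K}. h_vec (PI n) $ k) \<le> C"
    and "\<forall>\<^sub>F n in sequentially. \<exists>H. inverts_mat (G_mat (PI n)) H \<and> inverts_mat H (G_mat (PI n)) \<and>
           op_norm H \<le> C"
    and "\<forall>\<^sub>F n in sequentially. alpha0 (P n) (PI n) \<le> c"
    and "\<forall>\<^sub>F n in sequentially. real n * alpha0 (P n) (PI n) \<ge> inverse c"
    and "\<forall>\<^sub>F n in sequentially. tau n K (P n) (PI n) \<ge> C"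
  shows "\<exists>c2>0.
      (\<exists>r \<in> o(\<lambda>n. 1 + real n powr (- 1 / 2) * tau n K (P n) (PI n) powr (3 / 4)).
         \<forall>\<^sub>F n in sequentially.
           prob_space.expectation (M n) (\<lambda>\<omega>. test_stat n (A n \<omega>))
             \<ge> c2 * tau n K (P n) (PI n) - r n) \<and>
      (\<lambda>n. prob_space.variance (M n) (\<lambda>\<omega>. test_stat n (A n \<omega>)))
        \<in> O(\<lambda>n. 1 + inverse (real n) * tau n K (P n) (PI n) powr (3 / 2)
               + inverse ((real n)\<^sup>2) * inverse (alpha0 (P n) (PI n)) * (tau n K (P n) (PI n))\<^sup>2
                 * ln (real n))"
proof -
  define D where "D = 2 * real K * (C\<^sup>2 + 1)"
  define c2 where "c2 = 1 / (192 * real K ^ 4 * C ^ 4)"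
  let ?f = "\<lambda>n. 1 + real n powr (- 1 / 2) * tau n K (P n) (PI n) powr (3 / 4)"
  let ?g = "\<lambda>n. 1 + inverse (real n) * tau n K (P n) (PI n) powr (3 / 2)
    + inverse (real n ^ 2) * inverse (alpha0 (P n) (PI n)) * (tau n K (P n) (PI n))\<^sup>2 * ln (real n)"
  define r where "r n = (2 ^ 23 * D ^ 5 * err n) * ?f n" for n
  have c2: "c2 > 0" using assms(1,2) by (simp add: c2_def)
  have "(\<lambda>n. 2 ^ 23 * D ^ 5 * err n) \<in> o(\<lambda>_. 1)"
    using err_smallo by (rule landau_o.small.cmult_in_iff[THEN iffD2, rotated]) (use assms(1,2) in \<open>auto simp: D_def add_nonneg_eq_0_iff\<close>)
  then have r: "r \<in> o(?f)"
    using landau_o.small.mult_right[of "\<lambda>n. 2 ^ 23 * D ^ 5 * err n" sequentially "\<lambda>_. 1" ?f]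
    unfolding r_def[abs_def] by simp
  have "((\<lambda>n. c + D / (real n - 1) + sqrt (1 / sqrt (real n) ^ 3)) \<longlongrightarrow> c) sequentially"
    by real_asymp
  then have margin: "\<forall>\<^sub>F n in sequentially. c + D / (real n - 1) + sqrt (1 / sqrt (real n) ^ 3) < 1"
    using assms(4) by (rule order_tendstoD)
  have small1: "\<forall>\<^sub>F n in sequentially. 4 * exp (- sqrt (real n) / 32) \<le> 1" by real_asymp
  have small2: "\<forall>\<^sub>F n in sequentially. real n ^ 12 * exp (- sqrt (real n) / 32) \<le> 1" by real_asymp
  have large: "\<forall>\<^sub>F n in sequentially. n \<ge> 256 \<and> real n \<ge> 2 * D + 1 \<and> real n \<ge> 72 * (real K ^ 4 * C ^ 4)"
    by (intro eventually_conj eventually_ge_at_top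
        eventually_compose_filterlim[OF eventually_ge_at_top filterlim_real_sequentially])
  have both: "\<forall>\<^sub>F n in sequentially.
      prob_space.expectation (M n) (\<lambda>\<omega>. test_stat n (A n \<omega>)) \<ge> c2 * tau n K (P n) (PI n) - r n \<and>
      0 \<le> prob_space.variance (M n) (\<lambda>\<omega>. test_stat n (A n \<omega>)) \<and>
      prob_space.variance (M n) (\<lambda>\<omega>. test_stat n (A n \<omega>)) \<le> 2 ^ 43 * D ^ 8 * ?g n"
    using assms(5,8-11) margin small1 small2 large
  proof eventually_elim
    case (elim n)
    obtain H where H: "inverts_mat (G_mat (PI n)) H" "inverts_mat H (G_mat (PI n))" "op_norm H \<le> C"
      using elim(2) by blast
    interpret mmsbm_parameters n K "P n" "PI n" H C
      using elim(1,9) H assms(2) by unfold_locales (auto simp: mmsbm_def)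
    have "1 \<le> inverse c" using assms(3,4) by (simp add: one_le_inverse)
    then have na: "real n * a \<ge> 1" using elim(4) by (simp add: a_def)
    have \<tau>: "tau n K (P n) (PI n) > 0" using elim(5) assms(2) by linarith
    have ac: "a \<le> c" using elim(3) by (simp add: a_def)
    note b = test_stat_bounds[OF elim(1) assms(1) \<tau> _ na ac, folded D_def]
    have "prob_space (M n)" using elim(1) by (simp add: mmsbm_def)
    then show ?case
      using b elim(6-9) unfolding c2_def r_def by (auto intro: prob_space.variance_positive)
  qed
  have "(\<lambda>n. prob_space.variance (M n) (\<lambda>\<omega>. test_stat n (A n \<omega>))) \<in> O(?g)"
  proof (rule bigoI)
    show "\<forall>\<^sub>F n in sequentially. norm (prob_space.variance (M n) (\<lambda>\<omega>. test_stat n (A n \<omega>)))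
        \<le> (2 ^ 43 * D ^ 8) * norm (?g n)"
      using both
    proof eventually_elim
      case (elim n)
      have "2 ^ 43 * D ^ 8 * ?g n \<le> 2 ^ 43 * D ^ 8 * norm (?g n)"
        by (intro mult_left_mono) auto
      then show ?case using elim by (simp only: real_norm_def abs_of_nonneg) linarith
    qed
  qed
  moreover have "\<forall>\<^sub>F n in sequentially.
      prob_space.expectation (M n) (\<lambda>\<omega>. test_stat n (A n \<omega>)) \<ge> c2 * tau n K (P n) (PI n) - r n"
    using both by eventually_elim simp
  ultimately show ?thesis using c2 r by blast
qed

end
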